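(* Let $(I,g)$ be an $S$-unimodal system whose kneading sequence $\mathcal K(g)$ is periodic and odd. Then $(I,g)$ is a factor of a finite automaton.
   Context: Unimodal systems. A dynamical system $(I,g)$ on a real interval $I=[a,b]$ is unimodal if $g$ is continuous, $g(a)=g(b)=a$, and there is a critical point $c\in(a,b)$ such that $g$ is (strictly) increasing on $[a,c]$ and (strictly) decreasing on $[c,b]$. It is $S$-unimodal if moreover $g$ has a continuous third derivative, $g''(c)<0$, and $Sg(x)<0$ for all $x\neq c$, where $Sg(x)=\frac{g'''(x)}{g'(x)}-\frac32\left(\frac{g''(x)}{g'(x)}\right)^2$. Kneading sequence. For $u\in\{0,1\}^{\mathbb N}$ put $\tau_n(u)=\sum_{i=0}^n u_i \bmod 2$. The itinerary $\mathcal I(x)\in\{0,1\}^{\mathbb N}$ of $x\in I$ is defined recursively by: $g^i(x)<c\Rightarrow\mathcal I(x)_i=0$; $g^i(x)>c\Rightarrow\mathcal I(x)_i=1$; $g^i(x)=c\Rightarrow\mathcal I(x)_i$ is chosen so that $\tau_i(\mathcal I(x))=0$. The kneading sequence is $\mathcal K(g)=\mathcal I(g(c))$. A sequence $u\in\{0,1\}^{\mathbb N}$ is periodic if it is the infinite repetition $\overline v=vvv\ldots$ of a finite nonempty word $v$; a periodic $u$ is odd if the shortest word $v$ with $u=\overline v$ contains an odd number of letters $1$. A dynamical system $(X,f)$ is a continuous map $f:X\to X$ of a compact metric space $X$ to itself. $(Y,g)$ is a factor of $(X,f)$ if there is a continuous surjective map $\varphi:X\to Y$ with $g\varphi=\varphi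 f$. Finite automata. For a finite alphabet $A$ let $A^{\mathbb N}$ be the set of infinite sequences $u=u_0u_1u_2\ldots$ with $u_i\in A$ and metric $2^{-n}$, $n=\inf\{i\ge 0: u_i\ne v_i\}$. Let $\bullet,\sharp$ be symbols not in the alphabets, and define on $A^{\mathbb N}$: $\sigma_\sharp(u_0u_1u_2\ldots)=u_1u_2u_3\ldots$, $\sigma_\bullet(u)=u$, and $\sigma_a(u_0u_1\ldots)=au_0u_1\ldots$ for $a\in A$. Let $T$ be a finite set (of tapes) and for each $t\in T$ let $A_t$ be a finite alphabet. Put $Q=\prod_{t\in T}A_t$, $X=\prod_{t\in T}A_t^{\mathbb N}$ with a product metric, and $\pi:X\to Q$, $\pi(u)_t=u_{t0}$. The automaton with transition functions $f_t:Q\to A_t\cup\{\bullet,\sharp\}$ $(t\in T)$ is the dynamical system $(X,f)$ with $f(u)_t=\sigma_{f_t(\pi(u))}(u_t)$ for $u\in X$, $t\in T$. A tape $t$ is an input tape if $f_t(q)\in\{\bullet,\sharp\}$ for all $q\in Q$, and an output tape if $f_t(q)\in A_t\cup\{\bullet\}$ for all $q\in Q$. The automaton is a finite automaton if every tape is an input tape or an output tape. *)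

theory Defs
  imports "HOL-Analysis.Analysis"
begin

section \<open>Dynamical systems and factors\<close>

text \<open>A system is a carrier with a metric and a self-map. Outside the carrier the metric and the
  map are irrelevant.\<close>

definition dynamical_system :: "'a set \<Rightarrow> ('a \<Rightarrow> 'a \<Rightarrow> real) \<Rightarrow> ('a \<Rightarrow> 'a) \<Rightarrow> bool" where
  "dynamical_system X d f \<longleftrightarrow>
     Metric_space X d \<and>
     compact_space (Metric_space.mtopology X d) \<and>
     continuous_map (Metric_space.mtopology X d) (Metric_space.mtopology X d) f"

definition is_factor_of ::
  "'b set \<Rightarrow> ('b \<Rightarrow> 'b \<Rightarrow> real) \<Rightarrow> ('b \<Rightarrow> 'b) \<Rightarrow> 'a set \<Rightarrow> ('a \<Rightarrow> 'a \<Rightarrow> real) \<Rightarrow> ('a \<Rightarrow> 'a) \<Rightarrow> bool" where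
  "is_factor_of Y e g X d f \<longleftrightarrow>
     dynamical_system Y e g \<and> dynamical_system X d f \<and>
     (\<exists>\<phi>. continuous_map (Metric_space.mtopology X d) (Metric_space.mtopology Y e) \<phi> \<and>
          \<phi> ` X = Y \<and>
          (\<forall>x\<in>X. g (\<phi> x) = \<phi> (f x)))"

section \<open>Unimodal systems\<close>

definition unimodal :: "real \<Rightarrow> real \<Rightarrow> real \<Rightarrow> (real \<Rightarrow> real) \<Rightarrow> bool" where
  "unimodal a b c g \<longleftrightarrow>
     a < c \<and> c < b \<and>
     continuous_on {a..b} g \<and> g ` {a..b} \<subseteq> {a..b} \<and>
     g a = a \<and> g b = a \<and>
     strict_mono_on {a..c} g \<and> strict_antimono_on {c..b} g"

text \<open>The Schwarzian derivative in terms of the first three derivatives of \<open>g\<close>.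
  Where \<open>g1 x = 0\<close> it takes the value \<open>0\<close> (division by zero), so requiring it to be
  negative includes the requirement that it is defined.\<close>

definition schwarzian ::
  "(real \<Rightarrow> real) \<Rightarrow> (real \<Rightarrow> real) \<Rightarrow> (real \<Rightarrow> real) \<Rightarrow> real \<Rightarrow> real" where
  "schwarzian g1 g2 g3 x = g3 x / g1 x - 3/2 * (g2 x / g1 x)\<^sup>2"

text \<open>Derivatives are taken within \<open>{a..b}\<close>, hence one-sided at the endpoints.\<close>

definition S_unimodal :: "real \<Rightarrow> real \<Rightarrow> real \<Rightarrow> (real \<Rightarrow> real) \<Rightarrow> bool" where
  "S_unimodal a b c g \<longleftrightarrow>
     unimodal a b c g \<and>
     (\<exists>g1 g2 g3.
        (\<forall>x\<in>{a..b}. (g has_real_derivative g1 x) (at x within {a..b})) \<and>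
        (\<forall>x\<in>{a..b}. (g1 has_real_derivative g2 x) (at x within {a..b})) \<and>
        (\<forall>x\<in>{a..b}. (g2 has_real_derivative g3 x) (at x within {a..b})) \<and>
        continuous_on {a..b} g3 \<and>
        g2 c < 0 \<and>
        (\<forall>x\<in>{a..b} - {c}. schwarzian g1 g2 g3 x < 0))"

section \<open>Kneading sequences\<close>

definition tau :: "nat \<Rightarrow> (nat \<Rightarrow> nat) \<Rightarrow> nat" where
  "tau n u = (\<Sum>i\<le>n. u i) mod 2"

text \<open>In the last case the value is the only element of \<open>{0, 1}\<close> that makes \<open>tau i\<close> vanish;
  see \<open>itinerary_unique\<close>.\<close>

fun itinerary :: "(real \<Rightarrow> real) \<Rightarrow> real \<Rightarrow> real \<Rightarrow> nat \<Rightarrow> nat" where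
  "itinerary g c x i =
     (if (g ^^ i) x < c then 0
      else if (g ^^ i) x > c then 1
      else (\<Sum>j\<in>{..<i}. itinerary g c x j) mod 2)"

declare itinerary.simps [simp del]

definition kneading :: "(real \<Rightarrow> real) \<Rightarrow> real \<Rightarrow> nat \<Rightarrow> nat" where
  "kneading g c = itinerary g c (g c)"

lemma itinerary_less: "(g ^^ i) x < c \<Longrightarrow> itinerary g c x i = 0"
  by (simp only: itinerary.simps[of g c x i] if_True)

lemma itinerary_greater: "(g ^^ i) x > c \<Longrightarrow> itinerary g c x i = 1"
  by (simp only: itinerary.simps[of g c x i] if_True if_False order_less_not_sym)

lemma itinerary_equal:
  "(g ^^ i) x = c \<Longrightarrow> itinerary g c x i = (\<Sum>j<i. itinerary g c x j) mod 2"
  by (simp only: itinerary.simps[of g c x i] if_False less_irrefl)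

lemma tau_eq_0_iff:
  assumes "u i = 0 \<or> u i = 1"
  shows "tau i u = 0 \<longleftrightarrow> u i = (\<Sum>j<i. u j) mod 2"
proof -
  have "tau i u = ((\<Sum>j<i. u j) + u i) mod 2"
    unfolding tau_def lessThan_Suc_atMost [symmetric] sum.lessThan_Suc ..
  moreover have "(s + k) mod 2 = 0 \<longleftrightarrow> k = s mod 2" if "k = 0 \<or> k = 1" for s k :: nat
    using that by presburger
  ultimately show ?thesis
    using assms by presburger
qed

lemma itinerary_binary: "itinerary g c x i = 0 \<or> itinerary g c x i = 1"
  by (cases "(g ^^ i) x" c rule: linorder_cases)
    (simp_all only: itinerary_less itinerary_greater itinerary_equal, presburger+)

lemma itinerary_critical: "(g ^^ i) x = c \<Longrightarrow> tau i (itinerary g c x) = 0"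
  by (rule iffD2 [OF tau_eq_0_iff [of "itinerary g c x" i, OF itinerary_binary] itinerary_equal])

lemma itinerary_unique:
  "u = itinerary g c x \<longleftrightarrow>
     (\<forall>i. u i \<in> {0, 1} \<and>
          ((g ^^ i) x < c \<longrightarrow> u i = 0) \<and>
          ((g ^^ i) x > c \<longrightarrow> u i = 1) \<and>
          ((g ^^ i) x = c \<longrightarrow> tau i u = 0))" (is "_ \<longleftrightarrow> ?R u")
proof
  assume u: "u = itinerary g c x"
  show "?R u"
    unfolding u insert_iff empty_iff simp_thms
    by (intro allI conjI impI itinerary_binary itinerary_less itinerary_greater itinerary_critical)
next
  assume R: "?R u"
  have "u i = itinerary g c x i" for i
  proof (induction i rule: less_induct)
    case (less i)
    have "u i \<in> {0, 1}" and lt: "(g ^^ i) x < c \<Longrightarrow> u i = 0"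
      and gt: "(g ^^ i) x > c \<Longrightarrow> u i = 1" and eq: "(g ^^ i) x = c \<Longrightarrow> tau i u = 0"
      using R by blast+
    then have bin: "u i = 0 \<or> u i = 1"
      by blast
    have sums: "(\<Sum>j<i. u j) = (\<Sum>j<i. itinerary g c x j)"
      by (rule sum.cong) (use less in simp_all)
    show ?case
    proof (cases "(g ^^ i) x" c rule: linorder_cases)
      case less
      then show ?thesis by (simp only: lt itinerary_less)
    next
      case greater
      then show ?thesis by (simp only: gt itinerary_greater)
    next
      case equal
      then have "u i = (\<Sum>j<i. u j) mod 2"
        using eq tau_eq_0_iff [of u i, OF bin] by blast
      then show ?thesis
        by (simp only: itinerary_equal [OF equal] sums)
    qed
  qed
  then show "u = itinerary g c x"
    by blast
qed

definition repetition :: "'a list \<Rightarrow> nat \<Rightarrow> 'a" where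
  "repetition v i = v ! (i mod length v)"

definition periodic :: "(nat \<Rightarrow> nat) \<Rightarrow> bool" where
  "periodic u \<longleftrightarrow> (\<exists>v. v \<noteq> [] \<and> u = repetition v)"

text \<open>The shortest \<open>v\<close> below is unique, its letters being the first \<open>length v\<close> terms of \<open>u\<close>.\<close>

definition odd_periodic :: "(nat \<Rightarrow> nat) \<Rightarrow> bool" where
  "odd_periodic u \<longleftrightarrow>
     periodic u \<and>
     (\<exists>v. v \<noteq> [] \<and> u = repetition v \<and>
          (\<forall>w. w \<noteq> [] \<and> u = repetition w \<longrightarrow> length v \<le> length w) \<and>
          odd (count_list v 1))"

section \<open>Finite automata\<close>

text \<open>\<open>Stay\<close>, \<open>Shift\<close> and \<open>Push a\<close> stand for the values \<open>\<bullet>\<close>, \<open>\<sharp>\<close> and \<open>a\<close>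
  of a transition function.\<close>

datatype 'a move = Stay | Shift | Push 'a

fun apply_move :: "'a move \<Rightarrow> (nat \<Rightarrow> 'a) \<Rightarrow> nat \<Rightarrow> 'a" where
  "apply_move Stay u = u"
| "apply_move Shift u = (\<lambda>i. u (Suc i))"
| "apply_move (Push a) u = case_nat a u"

definition sequences :: "'a set \<Rightarrow> (nat \<Rightarrow> 'a) set" where
  "sequences A = {u. \<forall>i. u i \<in> A}"

definition seq_dist :: "(nat \<Rightarrow> 'a) \<Rightarrow> (nat \<Rightarrow> 'a) \<Rightarrow> real" where
  "seq_dist u v = (if u = v then 0 else (1/2) ^ (LEAST i. u i \<noteq> v i))"

definition states :: "'t set \<Rightarrow> ('t \<Rightarrow> 'a set) \<Rightarrow> ('t \<Rightarrow> 'a) set" where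
  "states T A = (\<Pi>\<^sub>E t\<in>T. A t)"

definition configs :: "'t set \<Rightarrow> ('t \<Rightarrow> 'a set) \<Rightarrow> ('t \<Rightarrow> nat \<Rightarrow> 'a) set" where
  "configs T A = (\<Pi>\<^sub>E t\<in>T. sequences (A t))"

definition config_dist :: "'t set \<Rightarrow> ('t \<Rightarrow> nat \<Rightarrow> 'a) \<Rightarrow> ('t \<Rightarrow> nat \<Rightarrow> 'a) \<Rightarrow> real" where
  "config_dist T u v = (\<Sum>t\<in>T. seq_dist (u t) (v t))"

definition read_heads :: "'t set \<Rightarrow> ('t \<Rightarrow> nat \<Rightarrow> 'a) \<Rightarrow> 't \<Rightarrow> 'a" where
  "read_heads T u = (\<lambda>t\<in>T. u t 0)"

definition automaton_map ::
  "'t set \<Rightarrow> ('t \<Rightarrow> ('t \<Rightarrow> 'a) \<Rightarrow> 'a move) \<Rightarrow> ('t \<Rightarrow> nat \<Rightarrow> 'a) \<Rightarrow> 't \<Rightarrow> nat \<Rightarrow> 'a" where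
  "automaton_map T f u = (\<lambda>t\<in>T. apply_move (f t (read_heads T u)) (u t))"

definition automaton ::
  "'t set \<Rightarrow> ('t \<Rightarrow> 'a set) \<Rightarrow> ('t \<Rightarrow> ('t \<Rightarrow> 'a) \<Rightarrow> 'a move) \<Rightarrow> bool" where
  "automaton T A f \<longleftrightarrow>
     finite T \<and> (\<forall>t\<in>T. finite (A t)) \<and>
     (\<forall>t\<in>T. \<forall>q\<in>states T A. f t q \<in> Push ` A t \<union> {Stay, Shift})"

definition input_tape ::
  "'t set \<Rightarrow> ('t \<Rightarrow> 'a set) \<Rightarrow> ('t \<Rightarrow> ('t \<Rightarrow> 'a) \<Rightarrow> 'a move) \<Rightarrow> 't \<Rightarrow> bool" where
  "input_tape T A f t \<longleftrightarrow> (\<forall>q\<in>states T A. f t q \<in> {Stay, Shift})"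

definition output_tape ::
  "'t set \<Rightarrow> ('t \<Rightarrow> 'a set) \<Rightarrow> ('t \<Rightarrow> ('t \<Rightarrow> 'a) \<Rightarrow> 'a move) \<Rightarrow> 't \<Rightarrow> bool" where
  "output_tape T A f t \<longleftrightarrow> (\<forall>q\<in>states T A. f t q \<in> Push ` A t \<union> {Stay})"

definition finite_automaton ::
  "'t set \<Rightarrow> ('t \<Rightarrow> 'a set) \<Rightarrow> ('t \<Rightarrow> ('t \<Rightarrow> 'a) \<Rightarrow> 'a move) \<Rightarrow> bool" where
  "finite_automaton T A f \<longleftrightarrow>
     automaton T A f \<and> (\<forall>t\<in>T. input_tape T A f t \<or> output_tape T A f t)"

end

theory Submission
  imports Defs
begin

text \<open>
  The negative Schwarzian derivative makes \<open>g\<close> expand the cross-ratio of four points on either side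
  of \<open>c\<close>, and this property, unlike the differential one, passes trivially to iterates. If the
  kneading sequence has odd period \<open>n\<close>, then \<open>g ^^ n\<close> reverses the interval between \<open>g c\<close> and its
  \<open>n\<close>-th image, and cross-ratio expansion yields a fixed point of \<open>g ^^ (2 * n)\<close> there that attracts
  a neighbourhood of \<open>g c\<close>. Let \<open>G\<close> be the open set of all points attracted to its orbit. The
  complement of \<open>G\<close> stays away from \<open>c\<close>, so a wandering interval in it could be enlarged (bounded
  distortion), and by cross-ratio expansion the only interval that can recur in it is the basin of
  the end point \<open>a\<close>. Hence outside the basins the cylinders of a suitable partition into finitely
  many intervals shrink to points.

  The automaton reads a path through this partition from its input tape and keeps the current
  state on top of its output tape. Once the path has entered a trap it stops reading: the rest of
  the input is then the binary code of a point of the trap, and the number of states pushed since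
  then tells how often \<open>g\<close> has been applied to it.
\<close>

section \<open>Configurations of an automaton\<close>

text \<open>Neither tape can be rewritten, and an arbitrary interval map does not act on symbol
  sequences, so the automaton cannot transform a code. Where cylinders shrink to points this does no
  harm: the itinerary itself is the code. It fails in the basins, where whole intervals share an
  itinerary, and hence the traps: the code of a point is left untouched and applications of
  \<open>g\<close> are only counted. The configuration space also contains tapes that no sensible
  run produces, and there too the decoded point must exist, be unique and depend continuously on the
  tapes. On an infinite run of traps the count is infinite, and only uniform contraction of the
  traps makes the point unique. Contraction fails at the repelling ends of the basin components. A
  trap must therefore stay inside a component, and the strips left over at such ends become
  expanding states; an image of the strip eventually covers the strip again and, beyond it, a
  compact part of the basin. Oddness enters twice: it makes the return map reverse orientation, and
  it excludes that \<open>g ^^ n\<close> fixes \<open>g c\<close>.\<close>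

lemma seq_dist_le_power_iff: "seq_dist u v \<le> (1/2) ^ n \<longleftrightarrow> (\<forall>i<n. u i = v i)"
proof (cases "u = v")
  case False
  then obtain k where "u k \<noteq> v k" by auto
  then have "u (LEAST i. u i \<noteq> v i) \<noteq> v (LEAST i. u i \<noteq> v i)" by (rule LeastI)
  moreover have "seq_dist u v \<le> (1/2) ^ n \<longleftrightarrow> n \<le> (LEAST i. u i \<noteq> v i)"
    using False by (simp add: seq_dist_def power_decreasing_iff)
  ultimately show ?thesis by (meson not_less_Least order_less_le_trans leI)
qed (simp add: seq_dist_def)

lemma seq_dist_nonneg: "0 \<le> seq_dist u v"
  by (simp add: seq_dist_def)

lemma seq_dist_commute: "seq_dist u v = seq_dist v u"
proof -
  have "(\<lambda>i. u i \<noteq> v i) = (\<lambda>i. v i \<noteq> u i)" by auto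
  then show ?thesis by (auto simp: seq_dist_def)
qed

lemma seq_dist_eq_0_iff: "seq_dist u v = 0 \<longleftrightarrow> u = v"
  by (simp add: seq_dist_def)

text \<open>The distance is an ultrametric: the larger of the two distances is a power of 1/2, and
  agreement of prefixes up to its exponent is transitive.\<close>

lemma seq_dist_triangle: "seq_dist u w \<le> seq_dist u v + seq_dist v w"
proof -
  have "seq_dist u w \<le> max (seq_dist u v) (seq_dist v w)"
  proof (cases "u = v \<or> v = w")
    case False
    then obtain k l where "seq_dist u v = (1/2) ^ k" "seq_dist v w = (1/2) ^ l"
      by (simp add: seq_dist_def)
    then obtain m where m: "max (seq_dist u v) (seq_dist v w) = (1/2) ^ m"
      unfolding max_def by metis
    then have "seq_dist u v \<le> (1/2) ^ m" "seq_dist v w \<le> (1/2) ^ m" by (metis max.cobounded1 max.cobounded2)+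
    then have "seq_dist u w \<le> (1/2) ^ m" unfolding seq_dist_le_power_iff by simp
    then show ?thesis using m by simp
  qed (auto simp: seq_dist_nonneg seq_dist_eq_0_iff)
  then show ?thesis using seq_dist_nonneg[of u v] seq_dist_nonneg[of v w] by linarith
qed

lemma Metric_space_configs:
  assumes "finite T"
  shows "Metric_space (configs T A) (config_dist T)"
proof
  fix x y z :: "'a \<Rightarrow> nat \<Rightarrow> 'b"
  show "0 \<le> config_dist T x y"
    by (simp add: config_dist_def sum_nonneg seq_dist_nonneg)
  show "config_dist T x y = config_dist T y x"
    by (simp add: config_dist_def seq_dist_commute)
  show "config_dist T x z \<le> config_dist T x y + config_dist T y z"
    unfolding config_dist_def sum.distrib[symmetric] by (intro sum_mono seq_dist_triangle)
  assume xy: "x \<in> configs T A" "y \<in> configs T A"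
  show "config_dist T x y = 0 \<longleftrightarrow> x = y"
  proof
    assume "config_dist T x y = 0"
    then have "\<forall>t\<in>T. seq_dist (x t) (y t) = 0"
      using assms by (simp add: config_dist_def sum_nonneg_eq_0_iff seq_dist_nonneg)
    then have "\<forall>t\<in>T. x t = y t" by (simp add: seq_dist_eq_0_iff)
    then show "x = y" using xy unfolding configs_def by (intro PiE_ext) auto
  qed (simp add: config_dist_def seq_dist_def)
qed

lemma config_dist_less_powerD:
  assumes "finite T" "config_dist T u v < (1/2) ^ n" "t \<in> T" "i < n"
  shows "u t i = v t i"
proof -
  have "seq_dist (u t) (v t) \<le> config_dist T u v"
    unfolding config_dist_def using assms by (intro member_le_sum) (auto simp: seq_dist_nonneg)
  then have "seq_dist (u t) (v t) \<le> (1/2) ^ n" using assms by linarith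
  then show ?thesis using assms by (simp add: seq_dist_le_power_iff)
qed

lemma config_dist_less_if_prefix:
  assumes "finite T" "0 < \<epsilon>"
  obtains n where "\<And>u v. (\<And>t i. t \<in> T \<Longrightarrow> i < n \<Longrightarrow> u t i = v t i) \<Longrightarrow> config_dist T u v < \<epsilon>"
proof -
  define \<delta> where "\<delta> = \<epsilon> / (real (card T) + 1)"
  have "0 < \<delta>" using assms by (simp add: \<delta>_def add_pos_nonneg)
  then obtain n where n: "(1/2::real) ^ n < \<delta>"
    using real_arch_pow_inv[of \<delta> "1/2"] by auto
  show thesis
  proof (rule that)
    fix u v :: "'a \<Rightarrow> nat \<Rightarrow> 'b"
    assume "\<And>t i. t \<in> T \<Longrightarrow> i < n \<Longrightarrow> u t i = v t i"
    then have "config_dist T u v \<le> (\<Sum>t\<in>T. (1/2) ^ n)"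
      unfolding config_dist_def by (intro sum_mono) (simp add: seq_dist_le_power_iff)
    also have "\<dots> = real (card T) * (1/2) ^ n" by simp
    also have "\<dots> \<le> real (card T) * \<delta>" using n by (intro mult_left_mono) auto
    also have "\<dots> < \<epsilon>" using assms by (simp add: \<delta>_def field_simps)
    finally show "config_dist T u v < \<epsilon>" .
  qed
qed

text \<open>Tychonoff: the configurations are the continuous image, under the currying map
  \<open>F\<close>, of a product of finite discrete spaces indexed by the cells
  \<open>(t, i)\<close>.\<close>

lemma compact_space_configs:
  assumes T: "finite T" and A: "\<And>t. t \<in> T \<Longrightarrow> finite (A t)"
  shows "compact_space (Metric_space.mtopology (configs T A) (config_dist T))"
proof -
  interpret Metric_space "configs T A" "config_dist T" by (rule Metric_space_configs[OF T])
  define X where "X = product_topology (\<lambda>p::'a \<times> nat. discrete_topology (A (fst p))) (T \<times> UNIV)"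
  define F where "F = (\<lambda>v::'a \<times> nat \<Rightarrow> 'b. \<lambda>t\<in>T. \<lambda>i. v (t, i))"
  have top: "topspace X = (\<Pi>\<^sub>E p\<in>T \<times> UNIV. A (fst p))" by (simp add: X_def)
  have "compact_space X"
    unfolding X_def using A by (auto simp: compact_space_product_topology compact_space_discrete_topology)
  moreover have "continuous_map X mtopology F"
    unfolding continuous_map_to_metric
  proof (intro ballI allI impI)
    fix v \<epsilon> assume v: "v \<in> topspace X" and "(0::real) < \<epsilon>"
    obtain n where n: "\<And>u w::'a \<Rightarrow> nat \<Rightarrow> 'b. (\<And>t i. t \<in> T \<Longrightarrow> i < n \<Longrightarrow> u t i = w t i) \<Longrightarrow> config_dist T u w < \<epsilon>"
      using config_dist_less_if_prefix[OF T \<open>0 < \<epsilon>\<close>] by blast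
    define U where "U = (\<Pi>\<^sub>E p\<in>T \<times> UNIV. if snd p < n then {v p} else A (fst p))"
    have "openin X U"
    proof -
      have "{p \<in> T \<times> UNIV. (if snd p < n then {v p} else A (fst p)) \<noteq> A (fst p)} \<subseteq> T \<times> {..<n}"
        by (auto split: if_splits)
      then have "finite {p \<in> T \<times> UNIV. (if snd p < n then {v p} else A (fst p)) \<noteq> A (fst p)}"
        by (rule finite_subset) (use T in auto)
      moreover have "v p \<in> A (fst p)" if "p \<in> T \<times> UNIV" for p
        using v[unfolded top] that by (rule PiE_mem)
      ultimately show ?thesis
        unfolding X_def U_def openin_PiE_gen by auto
    qed
    moreover have "v \<in> U"
      using v unfolding top U_def by (auto simp: PiE_iff)
    moreover have "F y \<in> mball (F v) \<epsilon>" if y: "y \<in> U" for y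
    proof -
      have yp: "y p \<in> (if snd p < n then {v p} else A (fst p))" if "p \<in> T \<times> UNIV" for p
        using y that unfolding U_def by (rule PiE_mem)
      have vp: "v p \<in> A (fst p)" if "p \<in> T \<times> UNIV" for p
        using v[unfolded top] that by (rule PiE_mem)
      have "y (t, i) \<in> A t" if "t \<in> T" for t i
        using yp[of "(t, i)"] vp[of "(t, i)"] that by (auto split: if_splits)
      then have "F y \<in> configs T A" "F v \<in> configs T A"
        using vp by (auto simp: F_def configs_def sequences_def)
      moreover have "config_dist T (F v) (F y) < \<epsilon>"
      proof (rule n)
        fix t i assume "t \<in> T" "i < n"
        then show "F v t i = F y t i" using yp[of "(t, i)"] by (simp add: F_def)
      qed
      ultimately show ?thesis by simp
    qed
    ultimately show "\<exists>U. openin X U \<and> v \<in> U \<and> (\<forall>y\<in>U. F y \<in> mball (F v) \<epsilon>)" by blast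
  qed
  ultimately have "compactin mtopology (F ` topspace X)"
    using image_compactin compact_space_def by blast
  moreover have "F ` topspace X = configs T A"
  proof
    show "F ` topspace X \<subseteq> configs T A"
      unfolding top F_def configs_def sequences_def by (force simp: PiE_iff)
    show "configs T A \<subseteq> F ` topspace X"
    proof
      fix u assume u: "u \<in> configs T A"
      define v where "v = (\<lambda>p\<in>T \<times> (UNIV::nat set). u (fst p) (snd p))"
      have "v \<in> topspace X" using u unfolding top v_def configs_def sequences_def by (force simp: PiE_iff)
      moreover have "F v = u" using u unfolding F_def v_def configs_def by (force simp: PiE_iff extensional_def)
      ultimately show "u \<in> F ` topspace X" by blast
    qed
  qed
  ultimately show ?thesis by (simp add: compact_space_def)
qed

lemma automaton_map_configs:
  assumes "automaton T A f" "u \<in> configs T A"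
  shows "automaton_map T f u \<in> configs T A"
proof -
  have q: "read_heads T u \<in> states T A"
    using assms by (auto simp: read_heads_def states_def configs_def sequences_def)
  have "apply_move (f t (read_heads T u)) (u t) i \<in> A t" if t: "t \<in> T" for t i
  proof -
    have "f t (read_heads T u) \<in> Push ` A t \<union> {Stay, Shift}"
      using assms(1) q t by (auto simp: automaton_def)
    moreover have "u t j \<in> A t" for j using assms(2) t by (auto simp: configs_def sequences_def)
    ultimately show ?thesis by (auto split: nat.split)
  qed
  then show ?thesis by (auto simp: automaton_map_def configs_def sequences_def)
qed

lemma dynamical_system_automaton:
  assumes "automaton T A f"
  shows "dynamical_system (configs T A) (config_dist T) (automaton_map T f)"
proof -
  have T: "finite T" "\<And>t. t \<in> T \<Longrightarrow> finite (A t)" using assms by (auto simp: automaton_def)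
  interpret Metric_space "configs T A" "config_dist T" by (rule Metric_space_configs[OF T(1)])
  have "continuous_map mtopology mtopology (automaton_map T f)"
    unfolding metric_continuous_map[OF Metric_space_axioms]
  proof (intro conjI ballI allI impI)
    show "automaton_map T f ` configs T A \<subseteq> configs T A" using automaton_map_configs[OF assms] by auto
    fix u \<epsilon> assume "u \<in> configs T A" "(0::real) < \<epsilon>"
    obtain n where n: "\<And>u w::'a \<Rightarrow> nat \<Rightarrow> 'b. (\<And>t i. t \<in> T \<Longrightarrow> i < n \<Longrightarrow> u t i = w t i) \<Longrightarrow> config_dist T u w < \<epsilon>"
      using config_dist_less_if_prefix[OF T(1) \<open>0 < \<epsilon>\<close>] by blast
    \<comment> \<open>One symbol more than \<open>n\<close> is compared, because a shift moves cell
      \<open>n\<close> into the first \<open>n\<close> cells.\<close>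
    have "config_dist T (automaton_map T f u) (automaton_map T f v) < \<epsilon>"
      if d: "config_dist T u v < (1/2) ^ Suc n" for v
    proof (rule n)
      fix t i assume t: "t \<in> T" and i: "i < n"
      have eq: "u t j = v t j" if "t \<in> T" "j < Suc n" for t j
        using config_dist_less_powerD[OF T(1) d that] .
      then have "read_heads T u = read_heads T v" by (auto simp: read_heads_def)
      then show "automaton_map T f u t i = automaton_map T f v t i"
        using t i eq by (cases "f t (read_heads T v)") (auto simp: automaton_map_def split: nat.split)
    qed
    then show "\<exists>\<delta>>0. \<forall>v. v \<in> configs T A \<and> config_dist T u v < \<delta> \<longrightarrow>
        config_dist T (automaton_map T f u) (automaton_map T f v) < \<epsilon>"
      by (intro exI[of _ "(1/2) ^ Suc n"]) auto
  qed
  then show ?thesis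
    unfolding dynamical_system_def using compact_space_configs[of T A] T Metric_space_axioms by blast
qed

lemma mtopology_dist_eq:
  fixes S :: "real set"
  shows "Metric_space S dist" "Metric_space.mtopology S dist = top_of_set S"
proof -
  interpret Submetric UNIV dist S by unfold_locales auto
  show "Metric_space S dist" by (rule sub.Metric_space_axioms)
  show "Metric_space.mtopology S dist = top_of_set S" using mtopology_submetric by simp
qed

lemma dynamical_system_interval:
  fixes g :: "real \<Rightarrow> real"
  assumes "continuous_on {a..b} g" "g ` {a..b} \<subseteq> {a..b}"
  shows "dynamical_system {a..b} dist g"
  using assms by (auto simp: dynamical_system_def mtopology_dist_eq compact_space_subtopology
      continuous_map_in_subtopology)

text \<open>Closed graph theorem for a compact range: if continuity failed at \<open>u\<close>,
  configurations tending to \<open>u\<close> with values away from \<open>\<phi> u\<close> would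
  have a subsequence of convergent values, whose limit would have to be \<open>\<phi> u\<close>.
  Continuity of the decoding thus reduces to closedness of the relation
  \<open>codes\<close>.\<close>

lemma continuous_map_configs_real_if_closed:
  fixes \<phi> :: "('t \<Rightarrow> nat \<Rightarrow> 's) \<Rightarrow> real"
  assumes T: "finite T" and S: "compact S" and maps: "\<phi> ` configs T A \<subseteq> S"
    and closed: "\<And>v u x. (\<And>n. v n \<in> configs T A) \<Longrightarrow> u \<in> configs T A \<Longrightarrow> 
        (\<And>N. \<forall>\<^sub>F n in sequentially. \<forall>t\<in>T. \<forall>i<N. v n t i = u t i) \<Longrightarrow> (\<lambda>n. \<phi> (v n)) \<longlonglongrightarrow> x \<Longrightarrow> \<phi> u = x"
  shows "continuous_map (Metric_space.mtopology (configs T A) (config_dist T)) (Metric_space.mtopology S dist) \<phi>"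
proof -
  interpret Metric_space "configs T A" "config_dist T" by (rule Metric_space_configs[OF T])
  show ?thesis
    unfolding metric_continuous_map[OF mtopology_dist_eq(1)]
  proof (intro conjI ballI allI impI maps)
    fix u and \<epsilon> :: real assume u: "u \<in> configs T A" and "0 < \<epsilon>"
    show "\<exists>\<delta>>0. \<forall>v. v \<in> configs T A \<and> config_dist T u v < \<delta> \<longrightarrow> dist (\<phi> u) (\<phi> v) < \<epsilon>"
    proof (rule ccontr)
      assume neg: "\<not> ?thesis"
      have "\<exists>v. v \<in> configs T A \<and> config_dist T u v < (1/2) ^ n \<and> \<epsilon> \<le> dist (\<phi> u) (\<phi> v)" for n :: nat
      proof (rule ccontr)
        assume "\<not> ?thesis"
        then have "(1/2::real) ^ n > 0 \<and> (\<forall>v. v \<in> configs T A \<and> config_dist T u v < (1/2) ^ n \<longrightarrow> dist (\<phi> u) (\<phi> v) < \<epsilon>)"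
          by (auto simp: not_le)
        with neg show False by blast
      qed
      then obtain v where v: "\<And>n. v n \<in> configs T A" "\<And>n. config_dist T u (v n) < (1/2) ^ n"
          "\<And>n. \<epsilon> \<le> dist (\<phi> u) (\<phi> (v n))" by metis
      have "\<forall>n. \<phi> (v n) \<in> S" using v maps by auto
      then obtain x r where r: "strict_mono r" "((\<lambda>n. \<phi> (v n)) \<circ> r) \<longlonglongrightarrow> x"
        using S unfolding compact_def by (metis (no_types, lifting))
      have "\<forall>\<^sub>F n in sequentially. \<forall>t\<in>T. \<forall>i<N. v (r n) t i = u t i" for N
        unfolding eventually_sequentially
      proof (intro exI[of _ N] allI ballI impI)
        fix n t i assume *: "N \<le> n" "t \<in> T" "i < N"
        then have "i < r n" using seq_suble[OF r(1), of n] by linarith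
        then show "v (r n) t i = u t i" using config_dist_less_powerD[OF T v(2)] * by metis
      qed
      then have "\<phi> u = x" by (intro closed[of "\<lambda>n. v (r n)"]) (use v u r in \<open>auto simp: o_def\<close>)
      then have "(\<lambda>n. dist (\<phi> u) (\<phi> (v (r n)))) \<longlonglongrightarrow> dist (\<phi> u) (\<phi> u)"
        using r(2) by (intro tendsto_intros) (simp add: o_def)
      then have "\<epsilon> \<le> dist (\<phi> u) (\<phi> u)" by (rule LIMSEQ_le_const) (use v in auto)
      with \<open>0 < \<epsilon>\<close> show False by simp
    qed
  qed
qed

section \<open>Coding points by an input tape and an output tape\<close>

text \<open>A state in \<open>Tr\<close> is a trap: the automaton no longer reads its input but iterates \<open>nx\<close>.
  A point of a trap is coded by \<open>psi\<close>.\<close>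

locale interval_coding =
  fixes a b :: real and g :: "real \<Rightarrow> real" and K D :: nat
    and I :: "nat \<Rightarrow> real set" and Tr :: "nat set"
    and nx :: "nat \<Rightarrow> nat" and dl :: "nat \<Rightarrow> nat \<Rightarrow> nat" and psi :: "nat \<Rightarrow> (nat \<Rightarrow> nat) \<Rightarrow> real"
  assumes cont: "continuous_on {a..b} g" and maps: "g ` {a..b} \<subseteq> {a..b}"
    and I_compact: "s < K \<Longrightarrow> compact (I s)" and I_sub: "s < K \<Longrightarrow> I s \<subseteq> {a..b}" and I_ne: "s < K \<Longrightarrow> I s \<noteq> {}"
    and cover: "x \<in> {a..b} \<Longrightarrow> \<exists>s<K. x \<in> I s \<and> (\<forall>s'<K. nx s' \<noteq> s)"
    and ex_inj: "s < K \<Longrightarrow> s \<notin> Tr \<Longrightarrow> inj_on g (I s)"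
    and ex_dl: "s < K \<Longrightarrow> s \<notin> Tr \<Longrightarrow> l < D \<Longrightarrow> dl s l < K"
    and ex_image: "s < K \<Longrightarrow> s \<notin> Tr \<Longrightarrow> g ` I s = (\<Union>l<D. I (dl s l))"
    and ex_expansive: "(\<And>i. st i < K \<and> st i \<notin> Tr \<and> (g ^^ i) x \<in> I (st i) \<and> (g ^^ i) y \<in> I (st i)) \<Longrightarrow> x = y"
    and tr_nx: "s < K \<Longrightarrow> s \<in> Tr \<Longrightarrow> nx s < K \<and> nx s \<in> Tr"
    and tr_image: "s < K \<Longrightarrow> s \<in> Tr \<Longrightarrow> g ` I s \<subseteq> I (nx s)"
    and tr_shrink: "s < K \<Longrightarrow> s \<in> Tr \<Longrightarrow> 0 < \<epsilon> \<Longrightarrow>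
          \<exists>k. \<forall>j\<ge>k. \<forall>x\<in>I s. \<forall>y\<in>I s. \<bar>(g ^^ j) x - (g ^^ j) y\<bar> < (\<epsilon>::real)"
    and psi_image: "s < K \<Longrightarrow> s \<in> Tr \<Longrightarrow> psi s ` sequences {..<D} = I s"
    and psi_cont: "s < K \<Longrightarrow> s \<in> Tr \<Longrightarrow> (\<And>N. \<forall>\<^sub>F n in sequentially. \<forall>i<N. v n i = u i) \<Longrightarrow>
          (\<lambda>n. psi s (v n)) \<longlonglongrightarrow> psi s u"
begin

lemma iter_in: "x \<in> {a..b} \<Longrightarrow> (g ^^ i) x \<in> {a..b}"
  by (induction i) (use maps in \<open>auto simp del: atLeastAtMost_iff\<close>)

lemma iter_cont: "continuous_on {a..b} (g ^^ i)"
proof (induction i)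
  case (Suc i)
  have "continuous_on {a..b} (g \<circ> (g ^^ i))"
    by (rule continuous_on_compose[OF Suc], rule continuous_on_subset[OF cont]) (use iter_in in auto)
  then show ?case by simp
qed (simp add: id_def)

lemma iter_tendsto:
  assumes "\<And>n. x n \<in> {a..b}" "x \<longlonglongrightarrow> l"
  shows "(\<lambda>n. (g ^^ i) (x n)) \<longlonglongrightarrow> (g ^^ i) l"
proof -
  have "l \<in> {a..b}" using closed_sequentially[OF closed_atLeastAtMost, of x a b l] assms by auto
  then show ?thesis
    using continuous_on_sequentially[of "{a..b}" "g ^^ i"] iter_cont assms by (auto simp: o_def)
qed

section \<open>Decoding a pair of tapes to a point\<close>

primrec path :: "(nat \<Rightarrow> nat) \<Rightarrow> nat \<Rightarrow> nat \<Rightarrow> nat" where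
  "path u s 0 = s"
| "path u s (Suc i) = dl (path u s i) (u i)"

lemma path_shift: "path (\<lambda>i. u (Suc i)) (dl s (u 0)) i = path u s (Suc i)"
  by (induction i) auto

lemma path_cong: "(\<And>j. j < i \<Longrightarrow> u j = v j) \<Longrightarrow> path u s i = path v s i"
  by (induction i) auto

lemma path_less:
  assumes "u \<in> sequences {..<D}" "s < K" "\<forall>j<i. path u s j \<notin> Tr"
  shows "path u s i < K"
  using assms by (induction i) (auto simp: sequences_def intro!: ex_dl)

text \<open>The history of a configuration is not visible, only its tapes. The time spent in traps
  is therefore read off as the length of the initial run in which each symbol is the
  \<open>nx\<close>-image of the symbol below it.\<close>

definition chain :: "(nat \<Rightarrow> nat) \<Rightarrow> nat \<Rightarrow> bool" where
  "chain w j \<longleftrightarrow> w 0 \<in> Tr \<and> (\<forall>i<j. w (Suc i) \<in> Tr \<and> w i = nx (w (Suc i)))"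

lemma chain_mono: "chain w j \<Longrightarrow> i \<le> j \<Longrightarrow> chain w i"
  by (auto simp: chain_def)

lemma chain_Tr: "chain w j \<Longrightarrow> i \<le> j \<Longrightarrow> w i \<in> Tr"
  by (cases i) (auto simp: chain_def)

lemma last_chain:
  assumes "w 0 \<in> Tr" "\<not> (\<forall>j. chain w j)"
  obtains j where "chain w j" "\<not> chain w (Suc j)"
proof (rule ccontr)
  assume "\<not> thesis"
  then have step: "chain w j \<Longrightarrow> chain w (Suc j)" for j using that by blast
  have "chain w 0" using assms(1) by (simp add: chain_def)
  then have "chain w j" for j using step by (rule nat_induct)
  with assms show False by blast
qed

lemma chain_cong: "(\<And>i. i \<le> j \<Longrightarrow> w i = w' i) \<Longrightarrow> chain w j = chain w' j"
  by (auto simp: chain_def)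

text \<open>The first two clauses of \<open>codes\<close> concern an output tape with an expanding top state: the
  point follows the path read from \<open>u\<close>. The last two concern a trap on top: if \<open>w j\<close> is the deepest
  of the traps that successive steps \<open>nx\<close> may have pushed, the point is the \<open>j\<close>-th image of the point
  of that trap with code \<open>u\<close>. All clauses are closed conditions guarded by finite prefixes of \<open>u\<close> and
  \<open>w\<close>, which makes the coded point a continuous function of the tapes.\<close>

definition codes :: "(nat \<Rightarrow> nat) \<Rightarrow> (nat \<Rightarrow> nat) \<Rightarrow> real \<Rightarrow> bool" where
  "codes u w x \<longleftrightarrow>
     (\<forall>i. (\<forall>j<i. path u (w 0) j \<notin> Tr) \<longrightarrow> (g ^^ i) x \<in> I (path u (w 0) i)) \<and>
     (\<forall>i>0. (\<forall>j<i. path u (w 0) j \<notin> Tr) \<and> path u (w 0) i \<in> Tr \<longrightarrow>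
        (g ^^ i) x = psi (path u (w 0) i) (\<lambda>n. u (n + i))) \<and>
     (\<forall>j. chain w j \<longrightarrow> x \<in> (g ^^ j) ` I (w j)) \<and>
     (\<forall>j. chain w j \<and> \<not> chain w (Suc j) \<longrightarrow> x = (g ^^ j) (psi (w j) u))"

lemma codesD:
  assumes "codes u w x"
  shows "(\<And>j. j < i \<Longrightarrow> path u (w 0) j \<notin> Tr) \<Longrightarrow> (g ^^ i) x \<in> I (path u (w 0) i)"
    and "0 < i \<Longrightarrow> (\<And>j. j < i \<Longrightarrow> path u (w 0) j \<notin> Tr) \<Longrightarrow> path u (w 0) i \<in> Tr \<Longrightarrow>
        (g ^^ i) x = psi (path u (w 0) i) (\<lambda>n. u (n + i))"
    and "chain w i \<Longrightarrow> x \<in> (g ^^ i) ` I (w i)"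
    and "chain w i \<Longrightarrow> \<not> chain w (Suc i) \<Longrightarrow> x = (g ^^ i) (psi (w i) u)"
  using assms unfolding codes_def by blast+

context
  fixes u w assumes u: "u \<in> sequences {..<D}" and w: "w \<in> sequences {..<K}"
begin

lemma w_less: "w i < K" using w by (auto simp: sequences_def)

lemma codes_in: "codes u w x \<Longrightarrow> x \<in> {a..b}"
  using I_sub[OF w_less[of 0]] codesD(1)[of u w x 0] by auto

lemma psi_in: "s < K \<Longrightarrow> s \<in> Tr \<Longrightarrow> psi s (\<lambda>n. u (n + i)) \<in> I s" "s < K \<Longrightarrow> s \<in> Tr \<Longrightarrow> psi s u \<in> I s"
  using psi_image[of s] u by (auto simp: sequences_def)

text \<open>The conditions imposed by deeper and deeper traps are nested, because \<open>g\<close>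
  maps each trap into the one chosen by \<open>nx\<close>. This permits an intersection over all
  depths.\<close>

lemma chain_image: "chain w j \<Longrightarrow> i \<le> j \<Longrightarrow> (g ^^ j) ` I (w j) \<subseteq> (g ^^ i) ` I (w i)"
proof (induction j)
  case (Suc j)
  show ?case
  proof (cases "i = Suc j")
    case False
    have "w (Suc j) \<in> Tr" "w j = nx (w (Suc j))" using Suc.prems by (auto simp: chain_def)
    then have "g ` I (w (Suc j)) \<subseteq> I (w j)" using tr_image w_less by metis
    then have "(g ^^ j) ` g ` I (w (Suc j)) \<subseteq> (g ^^ j) ` I (w j)" by blast
    also have "(g ^^ j) ` g ` I (w (Suc j)) = (g ^^ Suc j) ` I (w (Suc j))"
      by (simp only: funpow_Suc_right image_comp)
    finally show ?thesis using Suc False chain_mono[OF Suc.prems(1), of j] by fastforce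
  qed simp
qed simp

text \<open>A point of the last interval is pulled back one step at a time. This is why
  \<open>ex_image\<close> is an equality: if the successors merely covered the image, there might be
  no preimage.\<close>

lemma path_preimage:
  assumes "\<forall>j<i. path u (w 0) j \<notin> Tr" "y \<in> I (path u (w 0) i)"
  shows "\<exists>x. (g ^^ i) x = y \<and> (\<forall>j\<le>i. (g ^^ j) x \<in> I (path u (w 0) j))"
  using assms
proof (induction i arbitrary: y)
  case (Suc i)
  let ?s = "path u (w 0) i"
  have s: "?s < K" "?s \<notin> Tr" using Suc.prems path_less[OF u w_less[of 0]] by auto
  have "y \<in> g ` I ?s" using ex_image[OF s] Suc.prems(2) u by (auto simp: sequences_def)
  then obtain z where z: "z \<in> I ?s" "y = g z" by auto
  then obtain x where "(g ^^ i) x = z" "\<forall>j\<le>i. (g ^^ j) x \<in> I (path u (w 0) j)"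
    using Suc.IH[of z] Suc.prems by auto
  then show ?case using z Suc.prems(2) by (intro exI[of _ x]) (auto simp: le_Suc_eq)
qed auto

lemma nested_Inter:
  fixes X :: "nat \<Rightarrow> real set"
  assumes "\<And>n. compact (X n)" "\<And>n. X n \<noteq> {}" "\<And>m n. m \<le> n \<Longrightarrow> X n \<subseteq> X m"
  shows "\<exists>x. \<forall>n. x \<in> X n"
proof -
  have "\<Inter>(range X) \<noteq> {}" by (rule compact_nest) (use assms in blast)+
  then show ?thesis by auto
qed

text \<open>If infinitely many conditions are imposed, compactness of a nested sequence yields the
  point: images of traps for an infinite chain, points following a path that never meets a trap.
  Otherwise a last condition gives it explicitly.\<close>

lemma codes_exists: "\<exists>x. codes u w x"
proof (cases "w 0 \<in> Tr")
  case Tr: True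
  have 1: "codes u w x" if "\<And>j. chain w j \<Longrightarrow> x \<in> (g ^^ j) ` I (w j)"
      "\<And>j. chain w j \<Longrightarrow> \<not> chain w (Suc j) \<Longrightarrow> x = (g ^^ j) (psi (w j) u)" for x
  proof -
    have "x \<in> I (w 0)" using that(1)[of 0] Tr by (auto simp: chain_def)
    then have "(g ^^ i) x \<in> I (path u (w 0) i)" if "\<forall>j<i. path u (w 0) j \<notin> Tr" for i
      using that Tr by (cases i) auto
    moreover have "\<not> (\<forall>j<i. path u (w 0) j \<notin> Tr)" if "i > 0" for i using that Tr by auto
    ultimately show ?thesis using that unfolding codes_def by blast
  qed
  show ?thesis
  proof (cases "\<forall>j. chain w j")
    case True
    have "\<exists>x. \<forall>j. x \<in> (g ^^ j) ` I (w j)"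
    proof (rule nested_Inter)
      show "compact ((g ^^ n) ` I (w n))" for n
        by (rule compact_continuous_image[OF continuous_on_subset[OF iter_cont] I_compact]) (use I_sub w_less in auto)
      show "(g ^^ n) ` I (w n) \<noteq> {}" for n using I_ne w_less by auto
      show "(g ^^ n) ` I (w n) \<subseteq> (g ^^ m) ` I (w m)" if "m \<le> n" for m n using chain_image True that by auto
    qed
    then show ?thesis using 1 True by blast
  next
    case False
    obtain j where j: "\<not> chain w (Suc j)" "chain w j" using last_chain[OF Tr False] by metis
    show ?thesis
    proof (intro exI 1)
      fix i assume i: "chain w i"
      then have "i \<le> j" using j(1) chain_mono not_less_eq_eq by blast
      moreover have "psi (w j) u \<in> I (w j)" using psi_in(2) w_less chain_Tr[OF j(2)] by auto
      ultimately show "(g ^^ j) (psi (w j) u) \<in> (g ^^ i) ` I (w i)" using chain_image[OF j(2)] by blast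
    next
      fix i assume i: "chain w i" "\<not> chain w (Suc i)"
      then have "i = j" using j chain_mono by (metis Suc_leI linorder_neqE_nat)
      then show "(g ^^ j) (psi (w j) u) = (g ^^ i) (psi (w i) u)" by simp
    qed
  qed
next
  case nTr: False
  then have 1: "\<not> chain w j" for j by (auto simp: chain_def)
  show ?thesis
  proof (cases "\<forall>j. path u (w 0) j \<notin> Tr")
    case True
    define X where "X = (\<lambda>n. {x \<in> {a..b}. \<forall>j\<le>n. (g ^^ j) x \<in> I (path u (w 0) j)})"
    have lt: "path u (w 0) j < K" for j using path_less[OF u w_less[of 0]] True by auto
    have "\<exists>x. \<forall>n. x \<in> X n"
    proof (rule nested_Inter)
      fix n
      have "X n = {a..b} \<inter> (\<Inter>j\<le>n. {a..b} \<inter> (g ^^ j) -` I (path u (w 0) j))" by (auto simp: X_def)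
      moreover have "closed ({a..b} \<inter> (g ^^ j) -` I (path u (w 0) j))" for j
        by (rule continuous_closed_preimage[OF iter_cont]) (use I_compact lt compact_imp_closed in auto)
      ultimately show "compact (X n)" by (metis (no_types, lifting) closed_INT compact_Icc compact_Int_closed)
      obtain y where "y \<in> I (path u (w 0) n)" using I_ne[OF lt] by auto
      then obtain x where x: "\<forall>j\<le>n. (g ^^ j) x \<in> I (path u (w 0) j)" using path_preimage[of n y] True by auto
      then have "x \<in> I (w 0)" by (auto dest: spec[of _ 0])
      then show "X n \<noteq> {}" using x I_sub[OF w_less] unfolding X_def by blast
    qed (auto simp: X_def)
    then obtain x where "\<And>n. x \<in> X n" by auto
    then have "codes u w x" unfolding codes_def using 1 True by (auto simp: X_def)
    then show ?thesis ..
  next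
    case False
    define k where "k = (LEAST k. path u (w 0) k \<in> Tr)"
    have k: "path u (w 0) k \<in> Tr" using False unfolding k_def by (auto intro: LeastI)
    have less: "path u (w 0) j \<notin> Tr" if "j < k" for j using that not_less_Least unfolding k_def by blast
    have lt: "path u (w 0) k < K" using path_less[OF u w_less[of 0]] less by auto
    obtain x where x: "(g ^^ k) x = psi (path u (w 0) k) (\<lambda>n. u (n + k))" "\<forall>j\<le>k. (g ^^ j) x \<in> I (path u (w 0) j)"
      using path_preimage[of k, OF _ psi_in(1)[OF lt k, of k]] less by metis
    have "i \<le> k" if "\<forall>j<i. path u (w 0) j \<notin> Tr" for i using that k not_le by blast
    then have "codes u w x" unfolding codes_def using 1 x less by (metis le_neq_implies_less)
    then show ?thesis ..
  qed
qed

lemma iter_inj: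
  assumes "\<And>j. j < i \<Longrightarrow> path u (w 0) j \<notin> Tr"
    "\<And>j. j < i \<Longrightarrow> (g ^^ j) x \<in> I (path u (w 0) j) \<and> (g ^^ j) y \<in> I (path u (w 0) j)"
    "(g ^^ i) x = (g ^^ i) y"
  shows "x = y"
  using assms
proof (induction i)
  case (Suc i)
  have "path u (w 0) i < K" using path_less[OF u w_less] Suc.prems by auto
  then have "inj_on g (I (path u (w 0) i))" using ex_inj Suc.prems by auto
  then have "(g ^^ i) x = (g ^^ i) y" using Suc.prems(2)[of i] Suc.prems(3) by (auto dest: inj_onD)
  then show ?case using Suc by auto
qed auto

text \<open>Uniqueness comes from contraction for an infinite chain, from expansivity for an
  infinite path of expanding states, and from injectivity of \<open>g\<close> on these states for a
  path that ends in a trap. A finite chain determines the point outright.\<close>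

lemma codes_unique:
  assumes x: "codes u w x" and y: "codes u w y"
  shows "x = y"
proof (cases "w 0 \<in> Tr")
  case Tr: True
  show ?thesis
  proof (cases "\<forall>j. chain w j")
    case True
    show ?thesis
    proof (rule ccontr)
      assume "x \<noteq> y"
      then have e: "\<bar>x - y\<bar> > 0" by simp
      have "\<forall>s\<in>{..<K} \<inter> Tr. \<exists>k. \<forall>j\<ge>k. \<forall>p\<in>I s. \<forall>q\<in>I s. \<bar>(g ^^ j) p - (g ^^ j) q\<bar> < \<bar>x - y\<bar>"
        using tr_shrink e by auto
      then obtain k where "\<forall>s\<in>{..<K} \<inter> Tr. \<forall>j\<ge>k s. \<forall>p\<in>I s. \<forall>q\<in>I s. \<bar>(g ^^ j) p - (g ^^ j) q\<bar> < \<bar>x - y\<bar>"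
        by (rule bchoice[THEN exE])
      then have k: "\<And>s j p q. s < K \<Longrightarrow> s \<in> Tr \<Longrightarrow> j \<ge> k s \<Longrightarrow> p \<in> I s \<Longrightarrow> q \<in> I s \<Longrightarrow> \<bar>(g ^^ j) p - (g ^^ j) q\<bar> < \<bar>x - y\<bar>"
        by blast
      \<comment> \<open>The trap \<open>w m\<close> is known only once \<open>m\<close> is chosen,
        so \<open>m\<close> has to serve all traps at once; there are finitely many.\<close>
      define m where "m = Max (insert 0 (k ` ({..<K} \<inter> Tr)))"
      have m: "k (w m) \<le> m" unfolding m_def using True w_less chain_Tr[OF spec[OF True] order_refl]
        by (intro Max_ge insertI2 imageI) auto
      obtain p q where "p \<in> I (w m)" "q \<in> I (w m)" "x = (g ^^ m) p" "y = (g ^^ m) q"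
        using x y True unfolding codes_def by (metis imageE)
      then show False using k[OF w_less[of m] _ m] True chain_Tr[of w m m] by auto
    qed
  next
    case False
    then obtain j where "chain w j" "\<not> chain w (Suc j)" using last_chain[of w] Tr by metis
    then show ?thesis using x y unfolding codes_def by auto
  qed
next
  case nTr: False
  show ?thesis
  proof (cases "\<forall>j. path u (w 0) j \<notin> Tr")
    case True
    show ?thesis
      by (rule ex_expansive[of "path u (w 0)"]) (use True x y path_less[OF u w_less[of 0]] in \<open>auto simp: codes_def\<close>)
  next
    case False
    define k where "k = (LEAST k. path u (w 0) k \<in> Tr)"
    have k: "path u (w 0) k \<in> Tr" using False unfolding k_def by (auto intro: LeastI)
    have less: "path u (w 0) j \<notin> Tr" if "j < k" for j using that not_less_Least unfolding k_def by blast
    have "k > 0" using k nTr by (cases k) auto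
    then have "(g ^^ k) x = (g ^^ k) y" using x y k less unfolding codes_def by auto
    then show ?thesis using iter_inj[of k x y] less x y unfolding codes_def by auto
  qed
qed

text \<open>The pushed symbol prolongs the chain by one, which matches one more application of
  \<open>g\<close> to the point coded by the unchanged \<open>u\<close>.\<close>

lemma codes_step_trap:
  assumes "codes u w x" "w 0 \<in> Tr"
  shows "codes u (case_nat (nx (w 0)) w) (g x)"
proof -
  let ?w = "case_nat (nx (w 0)) w"
  have nx: "nx (w 0) \<in> Tr" "g ` I (w 0) \<subseteq> I (nx (w 0))" using tr_nx tr_image w_less assms by auto
  have ch: "chain ?w (Suc j) \<longleftrightarrow> chain w j" for j
    using nx assms by (auto simp: chain_def less_Suc_eq_0_disj split: nat.split)
  have x: "x \<in> I (w 0)" using assms by (auto simp: codes_def dest: spec[of _ 0])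
  have c: "chain w j \<Longrightarrow> x \<in> (g ^^ j) ` I (w j)" "chain w j \<Longrightarrow> \<not> chain w (Suc j) \<Longrightarrow> x = (g ^^ j) (psi (w j) u)" for j
    using assms unfolding codes_def by auto
  have "chain w 0" using assms by (simp add: chain_def)
  then have "g x \<in> (g ^^ j) ` I (?w j)" if "chain ?w j" for j
    using that c(1)[of "j - 1"] nx x ch by (cases j) auto
  moreover have "g x = (g ^^ j) (psi (?w j) u)" if "chain ?w j" "\<not> chain ?w (Suc j)" for j
    using that c(2)[of "j - 1"] ch \<open>chain w 0\<close> by (cases j) auto
  moreover have "(g ^^ i) (g x) \<in> I (path u (?w 0) i)" if "\<forall>j<i. path u (?w 0) j \<notin> Tr" for i
    using that nx x by (cases i) auto
  moreover have "\<not> (\<forall>j<i. path u (?w 0) j \<notin> Tr)" if "i > 0" for i using that nx by auto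
  ultimately show ?thesis unfolding codes_def by blast
qed

text \<open>Reading a letter shifts the path by one. If the pushed symbol is a trap, its chain ends
  at once, because the old top \<open>w 0\<close> is no trap; so the count starts at zero.\<close>

lemma codes_step_expand:
  assumes "codes u w x" "w 0 \<notin> Tr"
  shows "codes (\<lambda>i. u (Suc i)) (case_nat (dl (w 0) (u 0)) w) (g x)"
proof -
  let ?w = "case_nat (dl (w 0) (u 0)) w" and ?u = "\<lambda>i. u (Suc i)"
  have p: "path ?u (?w 0) i = path u (w 0) (Suc i)" for i using path_shift[of u "w 0" i] by simp
  have pre: "(\<forall>j<i. path ?u (?w 0) j \<notin> Tr) \<longleftrightarrow> (\<forall>j<Suc i. path u (w 0) j \<notin> Tr)" for i
    unfolding p using assms(2) by (auto simp: less_Suc_eq_0_disj)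
  have c: "(\<forall>j<i. path u (w 0) j \<notin> Tr) \<Longrightarrow> (g ^^ i) x \<in> I (path u (w 0) i)"
    "i > 0 \<Longrightarrow> (\<forall>j<i. path u (w 0) j \<notin> Tr) \<Longrightarrow> path u (w 0) i \<in> Tr \<Longrightarrow>
        (g ^^ i) x = psi (path u (w 0) i) (\<lambda>n. u (n + i))" for i
    using assms(1) unfolding codes_def by blast+
  have "(g ^^ i) (g x) \<in> I (path ?u (?w 0) i)" if "\<forall>j<i. path ?u (?w 0) j \<notin> Tr" for i
    using c(1)[OF that[unfolded pre]] unfolding p by (simp only: funpow_Suc_right o_apply)
  moreover have gi: "(g ^^ i) (g x) = psi (path ?u (?w 0) i) (\<lambda>n. ?u (n + i))"
    if "\<forall>j<i. path ?u (?w 0) j \<notin> Tr" "path ?u (?w 0) i \<in> Tr" for i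
    using c(2)[OF zero_less_Suc that(1)[unfolded pre] that(2)[unfolded p]] unfolding p
    by (simp only: funpow_Suc_right o_apply add_Suc_right)
  moreover have j: "j = 0" if "chain ?w j" for j using that assms(2) by (cases j) (auto simp: chain_def)
  moreover have 0: "?w 0 \<in> Tr" if "chain ?w j" for j using that by (simp add: chain_def)
  moreover have "g x \<in> (g ^^ j) ` I (?w j)" if "chain ?w j" for j
    using j[OF that] 0[OF that] c(1)[of 1] assms(2) by simp
  moreover have "g x = (g ^^ j) (psi (?w j) ?u)" if "chain ?w j" for j
    using j[OF that] 0[OF that] gi[of 0] by simp
  ultimately show ?thesis unfolding codes_def by blast
qed

lemma codes_closed:
  assumes v: "\<And>n. v n \<in> sequences {..<D}" and z: "\<And>n. z n \<in> sequences {..<K}"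
    and cv: "\<And>N. \<forall>\<^sub>F n in sequentially. \<forall>i<N. v n i = u i"
    and cz: "\<And>N. \<forall>\<^sub>F n in sequentially. \<forall>i<N. z n i = w i"
    and c: "\<And>n. codes (v n) (z n) (x n)" and x_in: "\<And>n. x n \<in> {a..b}" and lim: "x \<longlonglongrightarrow> l"
  shows "codes u w l"
proof -
  have z0: "\<forall>\<^sub>F n in sequentially. z n 0 = w 0" using cz[of 1] by simp
  have ev_path: "\<forall>\<^sub>F n in sequentially. \<forall>j\<le>i. path (v n) (z n 0) j = path u (w 0) j" for i
    using cv[of i] z0
  proof eventually_elim
    case (elim n)
    then show ?case using path_cong[of _ "v n" u] by auto
  qed
  have ev_chain: "\<forall>\<^sub>F n in sequentially. z n j = w j \<and> chain (z n) j = chain w j \<and> chain (z n) (Suc j) = chain w (Suc j)" for j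
    using cz[of "Suc (Suc j)"]
  proof eventually_elim
    case (elim n)
    then show ?case using chain_cong[of j "z n" w] chain_cong[of "Suc j" "z n" w] by auto
  qed
  have ltends: "(\<lambda>n. (g ^^ i) (x n)) \<longlonglongrightarrow> (g ^^ i) l" for i using iter_tendsto[OF x_in lim] .
  show ?thesis
    unfolding codes_def
  proof (intro conjI allI impI)
    fix i assume i: "\<forall>j<i. path u (w 0) j \<notin> Tr"
    have "\<forall>\<^sub>F n in sequentially. (g ^^ i) (x n) \<in> I (path u (w 0) i)"
      using ev_path[of i]
    proof eventually_elim
      case (elim n)
      then show ?case using codesD(1)[OF c[of n], of i] i by simp
    qed
    moreover have "closed (I (path u (w 0) i))" using I_compact path_less[OF u w_less i] compact_imp_closed by auto
    ultimately show "(g ^^ i) l \<in> I (path u (w 0) i)"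
      using Lim_in_closed_set[OF _ _ _ ltends] by auto
  next
    fix i assume i: "(\<forall>j<i. path u (w 0) j \<notin> Tr) \<and> path u (w 0) i \<in> Tr" "0 < i"
    let ?s = "path u (w 0) i"
    have "\<forall>\<^sub>F n in sequentially. (g ^^ i) (x n) = psi ?s (\<lambda>m. v n (m + i))"
      using ev_path[of i]
    proof eventually_elim
      case (elim n)
      then show ?case using codesD(2)[OF c[of n], of i] i by simp
    qed
    moreover have "(\<lambda>n. psi ?s (\<lambda>m. v n (m + i))) \<longlonglongrightarrow> psi ?s (\<lambda>m. u (m + i))"
    proof (rule psi_cont)
      show "?s < K" using path_less[OF u w_less] i by auto
      show "?s \<in> Tr" using i by auto
      show "\<forall>\<^sub>F n in sequentially. \<forall>m<N. v n (m + i) = u (m + i)" for N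
        using cv[of "N + i"] by eventually_elim auto
    qed
    ultimately have "(\<lambda>n. (g ^^ i) (x n)) \<longlonglongrightarrow> psi ?s (\<lambda>m. u (m + i))"
      using tendsto_cong by fast
    then show "(g ^^ i) l = psi ?s (\<lambda>m. u (m + i))" using ltends LIMSEQ_unique by blast
  next
    fix j assume j: "chain w j"
    have "\<forall>\<^sub>F n in sequentially. x n \<in> (g ^^ j) ` I (w j)"
      using ev_chain[of j]
    proof eventually_elim
      case (elim n)
      then show ?case using codesD(3)[OF c[of n], of j] j by simp
    qed
    moreover have "compact ((g ^^ j) ` I (w j))"
      by (rule compact_continuous_image[OF continuous_on_subset[OF iter_cont] I_compact]) (use I_sub w_less in auto)
    ultimately show "l \<in> (g ^^ j) ` I (w j)"
      using Lim_in_closed_set[OF compact_imp_closed _ _ lim] by auto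
  next
    fix j assume j: "chain w j \<and> \<not> chain w (Suc j)"
    have Tr: "w j \<in> Tr" using j chain_Tr by blast
    have "\<forall>\<^sub>F n in sequentially. x n = (g ^^ j) (psi (w j) (v n))"
      using ev_chain[of j]
    proof eventually_elim
      case (elim n)
      then show ?case using codesD(4)[OF c[of n], of j] j by simp
    qed
    moreover have "psi (w j) (v n) \<in> {a..b}" for n
      using psi_image[OF w_less Tr] v[of n] I_sub[OF w_less] by blast
    then have "(\<lambda>n. (g ^^ j) (psi (w j) (v n))) \<longlonglongrightarrow> (g ^^ j) (psi (w j) u)"
      by (intro iter_tendsto psi_cont[OF w_less Tr cv])
    ultimately have "x \<longlonglongrightarrow> (g ^^ j) (psi (w j) u)" using tendsto_cong by fast
    then show "l = (g ^^ j) (psi (w j) u)" using lim LIMSEQ_unique by blast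
  qed
qed

end

text \<open>An output tape filled with one state outside the range of \<open>nx\<close> has no chain
  of positive length, so its top may carry any point of that state. The input then records a choice
  of successors up to the first trap, followed by the code of the image point in that trap.\<close>

lemma codes_surj:
  assumes x: "x \<in> {a..b}" and D: "0 < D"
  shows "\<exists>u\<in>sequences {..<D}. \<exists>w\<in>sequences {..<K}. codes u w x"
proof -
  obtain s where s: "s < K" "x \<in> I s" "\<And>s'. s' < K \<Longrightarrow> nx s' \<noteq> s" using cover[OF x] by auto
  define w where "w = (\<lambda>i::nat. s)"
  have w: "w \<in> sequences {..<K}" using s by (auto simp: w_def sequences_def)
  have ch: "chain w j \<longleftrightarrow> j = 0 \<and> s \<in> Tr" for j using s(3)[OF s(1)] by (auto simp: chain_def w_def)
  show ?thesis
  proof (cases "s \<in> Tr")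
    case True
    then obtain u where u: "u \<in> sequences {..<D}" "psi s u = x" using psi_image s by (metis imageE)
    have "i = 0" if "\<forall>j<i. path u (w 0) j \<notin> Tr" for i
      using that[rule_format, of 0] True by (cases i) (simp_all add: w_def)
    moreover have "w j = s" for j by (simp add: w_def)
    ultimately have "codes u w x" unfolding codes_def ch using s(2) u(2)
      by (intro conjI allI impI) fastforce+
    then show ?thesis using u w by blast
  next
    case nTr: False
    define L where "L = (\<lambda>t y. SOME l. l < D \<and> g y \<in> I (dl t l))"
    have L: "L t y < D" "g y \<in> I (dl t (L t y))" if "t < K" "t \<notin> Tr" "y \<in> I t" for t y
    proof -
      have "\<exists>l. l < D \<and> g y \<in> I (dl t l)" using ex_image[OF that(1,2)] that(3) by blast
      then have "L t y < D \<and> g y \<in> I (dl t (L t y))" unfolding L_def by (rule someI_ex)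
      then show "L t y < D" "g y \<in> I (dl t (L t y))" by auto
    qed
    define st where "st = rec_nat s (\<lambda>i t. dl t (L t ((g ^^ i) x)))"
    have st: "st 0 = s" "st (Suc i) = dl (st i) (L (st i) ((g ^^ i) x))" for i by (auto simp: st_def)
    have st_in: "st i < K \<and> (g ^^ i) x \<in> I (st i)" if "\<forall>j<i. st j \<notin> Tr" for i
      using that by (induction i) (use s L ex_dl st in auto)
    have path_st: "path u s i = st i" if "\<forall>j<i. u j = L (st j) ((g ^^ j) x)" for u i
      using that by (induction i) (auto simp: st)
    have nch: "\<not> chain w j" for j using ch nTr by auto
    show ?thesis
    proof (cases "\<forall>i. st i \<notin> Tr")
      case True
      define u where "u = (\<lambda>i. L (st i) ((g ^^ i) x))"
      have "u \<in> sequences {..<D}" using L st_in True by (auto simp: sequences_def u_def)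
      moreover have "codes u w x" unfolding codes_def using nch True st_in path_st[of _ u]
        by (auto simp: w_def u_def)
      ultimately show ?thesis using w by blast
    next
      case False
      define k where "k = (LEAST k. st k \<in> Tr)"
      have k: "st k \<in> Tr" using False unfolding k_def by (auto intro: LeastI)
      have less: "st j \<notin> Tr" if "j < k" for j using that not_less_Least unfolding k_def by blast
      have kin: "st k < K" "(g ^^ k) x \<in> I (st k)" using st_in[of k] less by auto
      then obtain u' where u': "u' \<in> sequences {..<D}" "psi (st k) u' = (g ^^ k) x"
        using psi_image[OF kin(1) k] by (metis imageE)
      define u where "u = (\<lambda>i. if i < k then L (st i) ((g ^^ i) x) else u' (i - k))"
      have u: "u \<in> sequences {..<D}" using L st_in less u' by (auto simp: sequences_def u_def)
      have p: "path u s i = st i" if "i \<le> k" for i using that by (intro path_st) (auto simp: u_def)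
      have ik: "i \<le> k" if "\<forall>j<i. path u s j \<notin> Tr" for i using that p[of k] k by (metis le_refl not_le)
      have "(\<lambda>n. u (n + k)) = u'" by (auto simp: u_def)
      then have "(g ^^ i) x = psi (path u s i) (\<lambda>n. u (n + i))"
        if "\<forall>j<i. path u s j \<notin> Tr" "path u s i \<in> Tr" for i
        using ik[OF that(1)] less[of i] p[of i] that(2) u' by (cases "i = k") auto
      moreover have "(g ^^ i) x \<in> I (path u s i)" if "\<forall>j<i. path u s j \<notin> Tr" for i
        using ik[OF that] p[of i] st_in[of i] less by auto
      ultimately have "codes u w x" unfolding codes_def using nch by (auto simp: w_def)
      then show ?thesis using u w by blast
    qed
  qed
qed

theorem finite_automaton_factor:
  assumes D: "0 < D"
  shows "\<exists>(T :: nat set) (A :: nat \<Rightarrow> nat set) (f :: nat \<Rightarrow> (nat \<Rightarrow> nat) \<Rightarrow> nat move).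
           finite_automaton T A f \<and>
           is_factor_of {a..b} dist g (configs T A) (config_dist T) (automaton_map T f)"
proof -
  define T where "T = {0, 1::nat}"
  define A where "A = (\<lambda>t::nat. if t = 0 then {..<D} else {..<K})"
  \<comment> \<open>Tape 0 is the input and tape 1 the output. The output is pushed at every step;
    the input is frozen as soon as the output shows a trap.\<close>
  define f where "f = (\<lambda>(t::nat) q. if t = 0 then (if q 1 \<in> Tr then Stay else Shift)
      else Push (if q 1 \<in> Tr then nx (q (1::nat)) else dl (q 1) (q 0)))"
  have qs: "q 0 < D" "q 1 < K" if "q \<in> states T A" for q
    using that by (auto simp: states_def T_def A_def PiE_iff)
  have aut: "finite_automaton T A f"
    unfolding finite_automaton_def automaton_def input_tape_def output_tape_def
    using qs tr_nx ex_dl by (auto simp: T_def A_def f_def)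
  have cu: "u 0 \<in> sequences {..<D}" "u 1 \<in> sequences {..<K}" if "u \<in> configs T A" for u
    using that by (auto simp: configs_def T_def A_def PiE_iff)
  define \<phi> where "\<phi> = (\<lambda>u. THE x. codes (u (0::nat)) (u (1::nat)) x)"
  have \<phi>_eq: "\<phi> u = x" if "codes (u 0) (u 1) x" "u \<in> configs T A" for u x
    unfolding \<phi>_def using that codes_unique[OF cu[OF that(2)]] by blast
  have \<phi>: "codes (u 0) (u 1) (\<phi> u)" if "u \<in> configs T A" for u
    using codes_exists[OF cu[OF that]] \<phi>_eq that by metis
  have \<phi>_in: "\<phi> u \<in> {a..b}" if "u \<in> configs T A" for u using codes_in[OF cu[OF that] \<phi>[OF that]] .
  have "continuous_map (Metric_space.mtopology (configs T A) (config_dist T)) (Metric_space.mtopology {a..b} dist) \<phi>"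
  proof (rule continuous_map_configs_real_if_closed)
    fix v u x
    assume v: "\<And>n. v n \<in> configs T A" and u: "u \<in> configs T A"
      and ev: "\<And>N. \<forall>\<^sub>F n in sequentially. \<forall>t\<in>T. \<forall>i<N. v n t i = u t i"
      and lim: "(\<lambda>n. \<phi> (v n)) \<longlonglongrightarrow> x"
    have ev': "\<forall>\<^sub>F n in sequentially. \<forall>i<N. v n t i = u t i" if "t \<in> T" for t N
      using ev[of N] by eventually_elim (use that in auto)
    have "codes (u 0) (u 1) x"
      by (rule codes_closed[OF cu[OF u], of "\<lambda>n. v n 0" "\<lambda>n. v n 1" "\<lambda>n. \<phi> (v n)"])
        (use v cu \<phi> \<phi>_in lim ev' in \<open>auto simp: T_def simp del: atLeastAtMost_iff\<close>)
    then show "\<phi> u = x" using \<phi>_eq u by blast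
  qed (use \<phi>_in in \<open>auto simp: T_def\<close>)
  moreover have "\<phi> ` configs T A = {a..b}"
  proof
    show "{a..b} \<subseteq> \<phi> ` configs T A"
    proof
      fix x assume "x \<in> {a..b}"
      then obtain u w where uw: "u \<in> sequences {..<D}" "w \<in> sequences {..<K}" "codes u w x"
        using codes_surj D by blast
      define z where "z = (\<lambda>t\<in>T. if t = 0 then u else w)"
      have "z \<in> configs T A" using uw by (auto simp: z_def T_def configs_def A_def)
      moreover have "\<phi> z = x" using uw \<phi>_eq[OF _ calculation] by (simp add: z_def T_def)
      ultimately show "x \<in> \<phi> ` configs T A" by blast
    qed
  qed (use \<phi>_in in auto)
  moreover have "g (\<phi> u) = \<phi> (automaton_map T f u)" if u: "u \<in> configs T A" for u
  proof -
    let ?v = "automaton_map T f u"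
    have "?v \<in> configs T A" using automaton_map_configs u aut by (auto simp: finite_automaton_def)
    moreover have "codes (?v 0) (?v 1) (g (\<phi> u))"
      using codes_step_trap[OF cu[OF u] \<phi>[OF u]] codes_step_expand[OF cu[OF u] \<phi>[OF u]]
      by (cases "u 1 0 \<in> Tr") (auto simp: automaton_map_def f_def T_def read_heads_def)
    ultimately show ?thesis using \<phi>_eq by metis
  qed
  moreover have "dynamical_system (configs T A) (config_dist T) (automaton_map T f)"
    using dynamical_system_automaton aut by (auto simp: finite_automaton_def)
  ultimately show ?thesis
    using aut dynamical_system_interval[OF cont maps] unfolding is_factor_of_def by blast
qed

end

section \<open>Binary codes for the points of an interval\<close>

definition binary_value :: "(nat \<Rightarrow> nat) \<Rightarrow> real" where
  "binary_value u = (\<Sum>i. (if u i = 0 then 0 else 1) * (1/2) ^ Suc i)"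

lemma summable_binary: "summable (\<lambda>i. (if u i = (0::nat) then 0 else 1) * (1/2::real) ^ Suc i)"
  by (rule summable_comparison_test'[of "\<lambda>i. (1/2::real) ^ Suc i" 0]) (auto intro: summable_mult)

lemma binary_value_bounds: "binary_value u \<in> {0..1}"
proof -
  have half: "(\<lambda>i. (1/2::real) ^ Suc i) sums 1" using power_half_series .
  have "binary_value u \<le> (\<Sum>i. (1/2::real) ^ Suc i)"
    unfolding binary_value_def
    by (rule suminf_le[OF _ summable_binary sums_summable[OF half]]) simp
  then have "binary_value u \<le> 1" using sums_unique[OF half] by simp
  moreover have "0 \<le> binary_value u"
    unfolding binary_value_def by (intro suminf_nonneg summable_binary) auto
  ultimately show ?thesis by simp
qed

lemma binary_value_split:
  "binary_value u = (\<Sum>i<n. (if u i = 0 then 0 else 1) * (1/2) ^ Suc i) + (1/2) ^ n * binary_value (\<lambda>i. u (i + n))"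
proof -
  let ?f = "\<lambda>i. (if u i = 0 then 0 else 1) * (1/2::real) ^ Suc i"
  have "binary_value u = (\<Sum>i. ?f (i + n)) + sum ?f {..<n}"
    unfolding binary_value_def by (rule suminf_split_initial_segment[OF summable_binary])
  also have "(\<Sum>i. ?f (i + n)) = (\<Sum>i. (1/2) ^ n * ((if u (i + n) = 0 then 0 else 1) * (1/2) ^ Suc i))"
    by (intro suminf_cong) (simp add: power_add algebra_simps)
  also have "\<dots> = (1/2) ^ n * binary_value (\<lambda>i. u (i + n))"
    unfolding binary_value_def by (rule suminf_mult[OF summable_binary])
  finally show ?thesis by simp
qed

lemma binary_value_tendsto:
  assumes "\<And>N. \<forall>\<^sub>F n in sequentially. \<forall>i<N. v n i = u i"
  shows "(\<lambda>n. binary_value (v n)) \<longlonglongrightarrow> binary_value u"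
proof (rule tendstoI)
  fix e :: real assume "0 < e"
  then obtain N where N: "(1/2::real) ^ N < e" using real_arch_pow_inv[of e "1/2"] by auto
  show "\<forall>\<^sub>F n in sequentially. dist (binary_value (v n)) (binary_value u) < e"
    using assms[of N]
  proof eventually_elim
    case (elim n)
    define p where "p = binary_value (\<lambda>i. v n (i + N))"
    define q where "q = binary_value (\<lambda>i. u (i + N))"
    have pq: "p \<in> {0..1}" "q \<in> {0..1}" unfolding p_def q_def by (rule binary_value_bounds)+
    have "(\<Sum>i<N. (if v n i = 0 then 0 else 1) * (1/2::real) ^ Suc i) = (\<Sum>i<N. (if u i = 0 then 0 else 1) * (1/2) ^ Suc i)"
      by (intro sum.cong) (use elim in auto)
    then have "binary_value (v n) - binary_value u = (1/2) ^ N * (p - q)"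
      unfolding binary_value_split[of "v n" N] binary_value_split[of u N] p_def q_def by (simp add: algebra_simps)
    then have "dist (binary_value (v n)) (binary_value u) = (1/2) ^ N * \<bar>p - q\<bar>"
      by (simp add: dist_real_def abs_mult)
    also have "\<dots> \<le> (1/2) ^ N * 1" by (intro mult_left_mono) (use pq in auto)
    finally show ?case using N by simp
  qed
qed

text \<open>The digits come from the orbit of \<open>y\<close> under the doubling map. As
  \<open>1/2\<close> has digit 0, the orbit may reach 1, which is then fixed with digit 1; so it
  never leaves the unit interval.\<close>

lemma binary_value_surj:
  assumes "y \<in> {0..1}" "2 \<le> D"
  obtains u where "u \<in> sequences {..<D}" "binary_value u = y"
proof -
  define d where "d = (\<lambda>z::real. if z \<le> 1/2 then 0 else 1::nat)"
  define x where "x = rec_nat y (\<lambda>_ z. 2 * z - real (d z))"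
  have x: "x 0 = y" "x (Suc i) = 2 * x i - real (d (x i))" for i by (auto simp: x_def)
  have x_in: "x i \<in> {0..1}" for i by (induction i) (use assms x in \<open>auto simp: d_def\<close>)
  define u where "u = (\<lambda>i. d (x i))"
  have ui: "(if u i = 0 then 0 else 1) = real (d (x i))" for i by (simp add: u_def d_def)
  have eq: "y = (\<Sum>i<n. (if u i = 0 then 0 else 1) * (1/2) ^ Suc i) + (1/2) ^ n * x n" for n
    unfolding ui
  proof (induction n)
    case (Suc n)
    have "(1/2) ^ n * x n = real (d (x n)) * (1/2) ^ Suc n + (1/2) ^ Suc n * x (Suc n)"
      by (simp add: x right_diff_distrib diff_divide_distrib)
    with Suc show ?case by simp
  qed (simp add: x)
  have "\<bar>y - binary_value u\<bar> \<le> (1/2) ^ n" for n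
  proof -
    define q where "q = binary_value (\<lambda>i. u (i + n))"
    have q: "q \<in> {0..1}" unfolding q_def by (rule binary_value_bounds)
    have "y - binary_value u = (1/2) ^ n * (x n - q)"
      unfolding binary_value_split[of u n] q_def using eq[of n] by (simp add: algebra_simps)
    then have "\<bar>y - binary_value u\<bar> = (1/2) ^ n * \<bar>x n - q\<bar>" by (simp add: abs_mult)
    also have "\<dots> \<le> (1/2) ^ n * 1" by (intro mult_left_mono) (use q x_in[of n] in auto)
    finally show ?thesis by simp
  qed
  then have "\<bar>y - binary_value u\<bar> \<le> 0"
    by (intro LIMSEQ_le_const[OF LIMSEQ_power_zero[of "1/2::real"]]) auto
  then have "binary_value u = y" by simp
  moreover have "u \<in> sequences {..<D}" using assms by (auto simp: sequences_def u_def d_def)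
  ultimately show thesis using that by blast
qed

text \<open>A continuous injection of an interval is monotone.\<close>

lemma segment_image_subset_if_inj:
  fixes g :: "real \<Rightarrow> real"
  assumes "continuous_on s g" "inj_on g s" "connected s" "p \<in> s" "q \<in> s"
  shows "g ` closed_segment p q \<subseteq> closed_segment (g p) (g q)"
proof -
  have *: "g ` {p..q} \<subseteq> closed_segment (g p) (g q)" if "p < q" "p \<in> s" "q \<in> s" for p q
  proof (clarify)
    fix x assume x: "x \<in> {p..q}"
    have sub: "{p..q} \<subseteq> s" using assms(3) that connected_contains_Icc by blast
    have "continuous_on {p..q} g" "inj_on g {p..q}"
      using assms sub by (auto intro: continuous_on_subset inj_on_subset)
    then show "g x \<in> closed_segment (g p) (g q)"
      using continuous_inj_imp_mono[of p x q g] x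
      by (cases "x = p"; cases "x = q") (auto simp: closed_segment_eq_real_ivl)
  qed
  show ?thesis
    using *[of p q] *[of q p] assms
    by (cases p q rule: linorder_cases) (auto simp: closed_segment_eq_real_ivl closed_segment_commute split: if_splits)
qed

lemma compact_connected_real_eq_Icc:
  fixes s :: "real set"
  assumes "compact s" "connected s" "s \<noteq> {}"
  shows "s = {Inf s..Sup s}" "Inf s \<le> Sup s"
proof -
  obtain l u where s: "s = {l..u}" using assms connected_compact_interval_1[of s] by (auto simp: cbox_interval)
  then show "s = {Inf s..Sup s}" "Inf s \<le> Sup s" using assms(3) by auto
qed

text \<open>The automaton is reduced to a finite family of intervals. They may overlap, since the
  input chooses the path freely; what counts is that the image of an expanding state is an exact
  union of states.\<close>

theorem finite_automaton_factor_if_cover: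
  fixes EE TT :: "real set set" and g :: "real \<Rightarrow> real"
  assumes ab: "a \<le> b" and cont: "continuous_on {a..b} g" and maps: "g ` {a..b} \<subseteq> {a..b}"
    and fin: "finite EE" "finite TT"
    and ivl: "\<And>s. s \<in> EE \<union> TT \<Longrightarrow> compact s \<and> connected s \<and> s \<noteq> {} \<and> s \<subseteq> {a..b}"
    and cover: "{a..b} \<subseteq> \<Union>(EE \<union> TT)"
    and ex: "\<And>s. s \<in> EE \<Longrightarrow> inj_on g s" "\<And>s. s \<in> EE \<Longrightarrow> \<exists>U\<subseteq>EE \<union> TT. g ` s = \<Union>U"
    and tr: "\<And>s. s \<in> TT \<Longrightarrow> \<exists>s'\<in>TT. g ` s \<subseteq> s'"
    and shrink: "\<And>s \<epsilon>. s \<in> TT \<Longrightarrow> 0 < \<epsilon> \<Longrightarrow>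
          \<exists>k. \<forall>j\<ge>k. \<forall>x\<in>s. \<forall>y\<in>s. \<bar>(g ^^ j) x - (g ^^ j) y\<bar> < (\<epsilon>::real)"
    and expansive: "\<And>x y. x < y \<Longrightarrow> \<exists>k. \<forall>s\<in>EE. \<not> (g ^^ k) ` {x..y} \<subseteq> s"
  shows "\<exists>(T :: nat set) (A :: nat \<Rightarrow> nat set) (f :: nat \<Rightarrow> (nat \<Rightarrow> nat) \<Rightarrow> nat move).
           finite_automaton T A f \<and>
           is_factor_of {a..b} dist g (configs T A) (config_dist T) (automaton_map T f)"
proof -
  define S where "S = EE \<union> TT"
  define n where "n = card S"
  have "finite S" using fin by (simp add: S_def)
  then obtain e where "bij_betw e {..<n} S"
    using ex_bij_betw_nat_finite[of S] by (auto simp: n_def atLeast0LessThan)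
  then have e: "e ` {..<n} = S" by (simp add: bij_betw_def)
  have "S \<noteq> {}" using ab cover by (auto simp: S_def)
  then have n: "0 < n" using e by (cases n) auto
  \<comment> \<open>Every state occurs twice and \<open>nx\<close> avoids the second copy, so that a chain of traps can
    be started at any state.\<close>
  define I where "I = (\<lambda>i. e (i mod n))"
  have I_S: "I i \<in> S" for i using e n by (auto simp: I_def)
  define Tr where "Tr = {i. I i \<in> TT}"
  define nx where "nx = (\<lambda>i. if I i \<in> TT then SOME j. j < n \<and> I j \<in> TT \<and> g ` I i \<subseteq> I j else 0)"
  have nx: "nx i < n \<and> I (nx i) \<in> TT \<and> g ` I i \<subseteq> I (nx i)" if "I i \<in> TT" for i
  proof -
    have "\<exists>s'\<in>TT. g ` I i \<subseteq> s'" using tr[OF that] .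
    then obtain s' where s': "s' \<in> TT" "g ` I i \<subseteq> s'" by auto
    then have "s' \<in> e ` {..<n}" using e by (simp add: S_def)
    then obtain j where "j < n" "s' = I j" by (auto simp: I_def)
    then have "\<exists>j. j < n \<and> I j \<in> TT \<and> g ` I i \<subseteq> I j" using s' by auto
    then have "(SOME j. j < n \<and> I j \<in> TT \<and> g ` I i \<subseteq> I j) < n \<and> I (SOME j. j < n \<and> I j \<in> TT \<and> g ` I i \<subseteq> I j) \<in> TT \<and>
        g ` I i \<subseteq> I (SOME j. j < n \<and> I j \<in> TT \<and> g ` I i \<subseteq> I j)" by (rule someI_ex)
    then show ?thesis using that by (simp add: nx_def)
  qed
  have nx_less: "nx i < n" for i using nx[of i] n by (cases "I i \<in> TT") (auto simp: nx_def)
  have "\<forall>s\<in>EE. \<exists>U. U \<subseteq> S \<and> g ` s = \<Union>U" using ex(2) unfolding S_def by blast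
  then obtain U where U: "\<forall>s\<in>EE. U s \<subseteq> S \<and> g ` s = \<Union>(U s)" by (rule bchoice[THEN exE])
  \<comment> \<open>A letter that names no element of \<open>U (I i)\<close> is sent to a default
    element, so that every input drives a legal path.\<close>
  define dl where "dl = (\<lambda>i l. if l < n \<and> I l \<in> U (I i) then l else (SOME l. l < n \<and> I l \<in> U (I i)))"
  have dl: "dl i l < n \<and> I (dl i l) \<in> U (I i)" if "I i \<in> EE" for i l
  proof -
    have "g ` I i \<noteq> {}" using ivl[of "I i"] that by auto
    moreover have Ui: "U (I i) \<subseteq> S" "g ` I i = \<Union>(U (I i))" using U that by auto
    ultimately obtain s where s: "s \<in> U (I i)" by auto
    then have "s \<in> e ` {..<n}" using Ui e by auto
    then obtain j where "j < n" "s = I j" by (auto simp: I_def)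
    then have "\<exists>l. l < n \<and> I l \<in> U (I i)" using s by auto
    then have "(SOME l. l < n \<and> I l \<in> U (I i)) < n \<and> I (SOME l. l < n \<and> I l \<in> U (I i)) \<in> U (I i)"
      by (rule someI_ex)
    then show ?thesis by (auto simp: dl_def)
  qed
  have EE: "I i \<in> EE" if "i \<notin> Tr" for i using that I_S[of i] by (auto simp: Tr_def S_def)
  have Iivl: "compact (I i)" "connected (I i)" "I i \<noteq> {}" "I i \<subseteq> {a..b}" for i
    using ivl[of "I i"] I_S[of i] by (auto simp: S_def)
  \<comment> \<open>All nonzero letters count as the digit 1, so the alphabet that names successors
    serves for binary codes as well.\<close>
  define psi where "psi = (\<lambda>i u. Inf (I i) + (Sup (I i) - Inf (I i)) * binary_value u)"
  have Icc: "I i = {Inf (I i)..Sup (I i)}" "Inf (I i) \<le> Sup (I i)" for i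
    by (rule compact_connected_real_eq_Icc[OF Iivl(1-3)])+
  have psi_image: "psi i ` sequences {..<n + 2} = I i" for i
  proof
    show "psi i ` sequences {..<n + 2} \<subseteq> I i"
    proof clarify
      fix u
      have "binary_value u \<in> {0..1}" by (rule binary_value_bounds)
      then have "0 \<le> (Sup (I i) - Inf (I i)) * binary_value u" "(Sup (I i) - Inf (I i)) * binary_value u \<le> (Sup (I i) - Inf (I i)) * 1"
        using Icc(2)[of i] by (intro mult_nonneg_nonneg mult_left_mono; simp)+
      then have "psi i u \<in> {Inf (I i)..Sup (I i)}" by (auto simp: psi_def)
      then show "psi i u \<in> I i" using Icc(1) by blast
    qed
    show "I i \<subseteq> psi i ` sequences {..<n + 2}"
    proof
      fix x assume "x \<in> I i"
      then have x: "Inf (I i) \<le> x" "x \<le> Sup (I i)" using Icc(1)[of i] by (metis atLeastAtMost_iff)+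
      define y where "y = (if Sup (I i) = Inf (I i) then 0 else (x - Inf (I i)) / (Sup (I i) - Inf (I i)))"
      have "y \<in> {0..1}" using x by (auto simp: y_def field_simps)
      then obtain u where "u \<in> sequences {..<n + 2}" "binary_value u = y"
        using binary_value_surj[of y "n + 2"] by auto
      moreover from this have "psi i u = x" using x by (auto simp: psi_def y_def)
      ultimately show "x \<in> psi i ` sequences {..<n + 2}" by blast
    qed
  qed
  \<comment> \<open>If the two end points always share an expanding state, then so does everything
    between them, by monotonicity on each state. This turns expansivity for intervals into
    expansivity for pairs of points.\<close>
  have segments: "(g ^^ k) ` {x..y} \<subseteq> closed_segment ((g ^^ k) x) ((g ^^ k) y)"
    if xy: "x < y" and st: "\<And>i. I (st i) \<in> EE \<and> (g ^^ i) x \<in> I (st i) \<and> (g ^^ i) y \<in> I (st i)" for st x y k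
  proof (induction k)
    case (Suc k)
    have "(g ^^ Suc k) ` {x..y} \<subseteq> g ` closed_segment ((g ^^ k) x) ((g ^^ k) y)"
      using Suc by (auto simp flip: image_comp)
    also have "\<dots> \<subseteq> closed_segment ((g ^^ Suc k) x) ((g ^^ Suc k) y)"
      using segment_image_subset_if_inj[of "I (st k)" g] continuous_on_subset[OF cont Iivl(4)] ex(1) st[of k] Iivl(2)
      by simp
    finally show ?case .
  qed (use xy in \<open>auto simp: closed_segment_eq_real_ivl\<close>)
  have apart: "\<not> x < y" if st: "\<And>i. I (st i) \<in> EE \<and> (g ^^ i) x \<in> I (st i) \<and> (g ^^ i) y \<in> I (st i)" for st x y
  proof
    assume xy: "x < y"
    obtain k where k: "\<forall>s\<in>EE. \<not> (g ^^ k) ` {x..y} \<subseteq> s" using expansive[OF xy] by auto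
    have "closed_segment ((g ^^ k) x) ((g ^^ k) y) \<subseteq> I (st k)"
      using st[of k] Iivl(2)[of "st k"] closed_segment_subset is_interval_connected_1 is_interval_convex_1 by blast
    then have "(g ^^ k) ` {x..y} \<subseteq> I (st k)" using segments[of x y st k] xy st by blast
    then show False using k st by blast
  qed
  \<comment> \<open>There are \<open>2 * n\<close> states because of the two copies. The
    \<open>n + 2\<close> letters can name all \<open>n\<close> successors and include two digits
    whatever \<open>n\<close> is.\<close>
  interpret interval_coding a b g "2 * n" "n + 2" I Tr nx dl psi
  proof
    show "continuous_on {a..b} g" "g ` {a..b} \<subseteq> {a..b}" by (rule cont maps)+
    show "compact (I s)" "I s \<subseteq> {a..b}" "I s \<noteq> {}" for s using Iivl by auto
    show "psi s ` sequences {..<n + 2} = I s" for s by (rule psi_image)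
    show "(\<lambda>m. psi s (v m)) \<longlonglongrightarrow> psi s u" if "\<And>N. \<forall>\<^sub>F m in sequentially. \<forall>i<N. v m i = u i" for s v u
      unfolding psi_def by (intro tendsto_intros binary_value_tendsto that)
    show "x = y" if "\<And>i. st i < 2 * n \<and> st i \<notin> Tr \<and> (g ^^ i) x \<in> I (st i) \<and> (g ^^ i) y \<in> I (st i)" for st x y
      using apart[of st x y] apart[of st y x] that EE by (meson linorder_neqE_linordered_idom)
    show "inj_on g (I s)" if "s \<notin> Tr" for s using ex(1) EE[OF that] .
    show "dl s l < 2 * n" if "s \<notin> Tr" for s l using dl[OF EE[OF that], of l] by simp
    show "nx s < 2 * n \<and> nx s \<in> Tr" if "s \<in> Tr" for s using nx[of s] that by (auto simp: Tr_def)
    show "g ` I s \<subseteq> I (nx s)" if "s \<in> Tr" for s using nx[of s] that by (auto simp: Tr_def)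
    show "\<exists>k. \<forall>j\<ge>k. \<forall>x\<in>I s. \<forall>y\<in>I s. \<bar>(g ^^ j) x - (g ^^ j) y\<bar> < \<epsilon>" if "s \<in> Tr" "0 < \<epsilon>" for s \<epsilon>
      using shrink[of "I s" \<epsilon>] that by (auto simp: Tr_def)
    show "g ` I s = (\<Union>l<n + 2. I (dl s l))" if "s \<notin> Tr" for s
    proof -
      have Us: "U (I s) \<subseteq> S" "g ` I s = \<Union>(U (I s))" using U EE[OF that] by auto
      have "\<exists>l<n + 2. t = I (dl s l)" if t: "t \<in> U (I s)" for t
      proof -
        have "t \<in> e ` {..<n}" using t Us e by auto
        then obtain l where l: "l < n" "t = I l" by (auto simp: I_def)
        then have "dl s l = l" using t by (simp add: dl_def)
        then show ?thesis using l by (intro exI[of _ l]) auto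
      qed
      moreover have "I (dl s l) \<in> U (I s)" for l using dl[OF EE[OF that], of l] by auto
      ultimately show ?thesis unfolding Us(2) by fast
    qed
    show "\<exists>s<2 * n. x \<in> I s \<and> (\<forall>s'<2 * n. nx s' \<noteq> s)" if x: "x \<in> {a..b}" for x
    proof -
      have "x \<in> \<Union>S" using cover x unfolding S_def by blast
      then obtain t where t: "t \<in> S" "x \<in> t" by blast
      then have "t \<in> e ` {..<n}" using e by simp
      then obtain j where j: "j < n" "t = e j" by auto
      have "nx s' \<noteq> n + j" for s' using nx_less[of s'] by simp
      then show ?thesis using t j by (intro exI[of _ "n + j"]) (auto simp: I_def)
    qed
  qed

  show ?thesis by (rule finite_automaton_factor) simp
qed

section \<open>Negative Schwarzian derivative and cross-ratios\<close>

text \<open>Whole times middle over left times right. The absolute values make it invariant under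
  reversal of the four points, so order-reversing iterates need no separate notion.\<close>

definition cross_ratio :: "real \<Rightarrow> real \<Rightarrow> real \<Rightarrow> real \<Rightarrow> real" where
  "cross_ratio x0 x1 x2 x3 = (\<bar>x3 - x0\<bar> * \<bar>x2 - x1\<bar>) / (\<bar>x1 - x0\<bar> * \<bar>x3 - x2\<bar>)"

text \<open>With \<open>A = d + e * g\<close> affine in \<open>g\<close>, the function \<open>A / sqrt g'\<close> is the square root of the
  inverse derivative of a Moebius map after \<open>g\<close>; its convexity is the negativity of the Schwarzian.\<close>

lemma inverse_sqrt_derivative_convex:
  fixes g g1 g2 g3 :: "real \<Rightarrow> real" and d e :: real
  assumes d: "(g has_real_derivative g1 x) (at x)" "(g1 has_real_derivative g2 x) (at x)"
     "(g2 has_real_derivative g3 x) (at x)"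
    and pos: "g1 x > 0"
  defines "W \<equiv> \<lambda>x. (d + e * g x) / sqrt (g1 x)"
    and "W1 \<equiv> \<lambda>x. e * sqrt (g1 x) - (d + e * g x) * g2 x / (2 * g1 x * sqrt (g1 x))"
  shows "(W has_real_derivative W1 x) (at x)"
    and "(W1 has_real_derivative - (d + e * g x) / (2 * sqrt (g1 x)) * schwarzian g1 g2 g3 x) (at x)"
proof -
  define s where "s = sqrt (g1 x)"
  have s: "s > 0" "g1 x = s * s" using pos by (auto simp: s_def)
  show "(W has_real_derivative W1 x) (at x)"
    unfolding W_def W1_def
    apply (rule derivative_eq_intros d refl | use pos in simp; fail)+
    unfolding s_def[symmetric]
    using s by (simp add: field_simps)
  show "(W1 has_real_derivative - (d + e * g x) / (2 * sqrt (g1 x)) * schwarzian g1 g2 g3 x) (at x)"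
    unfolding W1_def schwarzian_def
    apply (rule derivative_eq_intros d refl | use pos in simp; fail)+
    unfolding s_def[symmetric]
    using s by (simp add: field_simps power2_eq_square)
qed

lemma divide_less_divide_if:
  fixes p q r s :: real
  assumes "p * s < q * r" "0 < r" "0 < s"
  shows "p / r < q / s"
  using assms by (simp add: pos_divide_less_eq pos_less_divide_eq mult.commute)

text \<open>After \<open>g\<close> is composed with a Moebius map so that the result
  \<open>f\<close> fixes \<open>x0\<close>, \<open>x1\<close> and \<open>x3\<close>, the claim
  becomes \<open>f x2 > x2\<close>. The derivative of \<open>f\<close> is \<open>kap\<close> divided
  by the square of the convex function \<open>W\<close>. By the mean value theorem it equals 1
  somewhere on either side of \<open>x1\<close>; by convexity it exceeds 1 between these places and
  is below 1 beyond the second.\<close>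

lemma cross_ratio_less_increasing:
  fixes g g1 g2 g3 :: "real \<Rightarrow> real"
  assumes ord: "x0 < x1" "x1 < x2" "x2 < x3"
    and cont: "continuous_on {x0..x3} g"
    and d: "\<And>x. x0 < x \<Longrightarrow> x < x3 \<Longrightarrow> (g has_real_derivative g1 x) (at x)"
      "\<And>x. x0 < x \<Longrightarrow> x < x3 \<Longrightarrow> (g1 has_real_derivative g2 x) (at x)"
      "\<And>x. x0 < x \<Longrightarrow> x < x3 \<Longrightarrow> (g2 has_real_derivative g3 x) (at x)"
    and pos: "\<And>x. x0 < x \<Longrightarrow> x < x3 \<Longrightarrow> g1 x > 0"
    and S: "\<And>x. x0 < x \<Longrightarrow> x < x3 \<Longrightarrow> schwarzian g1 g2 g3 x < 0"
  shows "cross_ratio x0 x1 x2 x3 < cross_ratio (g x0) (g x1) (g x2) (g x3)"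
proof -
  have mono: "g x < g y" if "x0 \<le> x" "x < y" "y \<le> x3" for x y
  proof (rule DERIV_pos_imp_increasing_open[OF that(2)])
    fix z assume "x < z" "z < y"
    then show "\<exists>w. (g has_real_derivative w) (at z) \<and> w > 0" using d(1)[of z] pos[of z] that by force
  qed (rule continuous_on_subset[OF cont], use that in auto)
  \<comment> \<open>For every positive \<open>k\<close> the map \<open>f\<close> below fixes
    \<open>x0\<close> and \<open>x3\<close>; this value makes it fix \<open>x1\<close> too.\<close>
  define k where "k = (x1 - x0) * (g x3 - g x1) / ((x3 - x1) * (g x1 - g x0))"
  have gs: "g x0 < g x1" "g x1 < g x2" "g x2 < g x3" "g x1 < g x3" "g x0 < g x3" using mono ord by auto
  have k: "k > 0" unfolding k_def using ord gs by simp
  define A where "A = (\<lambda>x. (g x3 - k * g x0) + (k - 1) * g x)"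
  \<comment> \<open>The denominator is a combination of \<open>g x3 - g x\<close> and
    \<open>g x - g x0\<close> with the positive coefficients 1 and \<open>k\<close>, so the Moebius
    map has no pole.\<close>
  have A: "A x > 0" if "x0 \<le> x" "x \<le> x3" for x
  proof -
    have "g x0 \<le> g x" "g x \<le> g x3" using mono[of x0 x] mono[of x x3] that by (cases "x = x0"; cases "x = x3"; force)+
    moreover have "A x = (g x3 - g x) + k * (g x - g x0)" by (simp add: A_def algebra_simps)
    moreover have "g x3 - g x > 0 \<or> g x - g x0 > 0" using calculation gs by linarith
    ultimately show ?thesis using k
      by (smt (verit) mult_nonneg_nonneg mult_pos_pos)
  qed
  define f where "f = (\<lambda>x. (x0 * (g x3 - g x) + k * x3 * (g x - g x0)) / A x)"
  define kap where "kap = k * (x3 - x0) * (g x3 - g x0)"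
  have kap: "kap > 0" unfolding kap_def using k ord gs by simp
  have f0: "f x0 = x0" using gs by (simp add: f_def A_def field_simps)
  have f3: "f x3 = x3" using gs k by (simp add: f_def A_def field_simps)
  have f1: "f x1 = x1"
  proof -
    have "k * ((x3 - x1) * (g x1 - g x0)) = (x1 - x0) * (g x3 - g x1)" using ord gs by (simp add: k_def)
    then have "x0 * (g x3 - g x1) + k * x3 * (g x1 - g x0) = x1 * A x1"
      unfolding A_def by (simp add: algebra_simps)
    then show ?thesis using A[of x1] ord by (simp add: f_def)
  qed
  have df: "(f has_real_derivative kap * g1 x / (A x)\<^sup>2) (at x)" if "x0 < x" "x < x3" for x
  proof -
    have Ax: "A x \<noteq> 0" using A[of x] that by simp
    have dA: "(A has_real_derivative (k - 1) * g1 x) (at x)"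
      unfolding A_def by (rule derivative_eq_intros d that refl | simp)+
    have "(f has_real_derivative ((- x0 * g1 x + k * x3 * g1 x) * A x - (x0 * (g x3 - g x) + k * x3 * (g x - g x0)) * ((k - 1) * g1 x)) / (A x * A x)) (at x)"
      unfolding f_def
      by (rule derivative_eq_intros dA d(1) that refl Ax | simp)+
    moreover have "((- x0 * g1 x + k * x3 * g1 x) * A x - (x0 * (g x3 - g x) + k * x3 * (g x - g x0)) * ((k - 1) * g1 x)) = kap * g1 x"
      unfolding A_def kap_def by (simp add: algebra_simps)
    ultimately show ?thesis by (simp add: power2_eq_square)
  qed
  have contf: "continuous_on {x0..x3} f"
    unfolding f_def A_def using A by (intro continuous_intros cont) (force simp: A_def)
  have contf': "continuous_on {u..v} f" if "x0 \<le> u" "v \<le> x3" for u v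
    using contf that by (auto intro: continuous_on_subset)
  define W where "W = (\<lambda>x. A x / sqrt (g1 x))"
  define W1 where "W1 = (\<lambda>x. (k - 1) * sqrt (g1 x) - A x * g2 x / (2 * g1 x * sqrt (g1 x)))"
  have dW: "(W has_real_derivative W1 x) (at x)" and
       dW1: "(W1 has_real_derivative - A x / (2 * sqrt (g1 x)) * schwarzian g1 g2 g3 x) (at x)"
    if "x0 < x" "x < x3" for x
    using inverse_sqrt_derivative_convex[of g g1 x g2 g3, where d = "g x3 - k * g x0" and e = "k - 1"] d pos that
    unfolding W_def W1_def A_def by auto
  have W1_mono: "W1 x < W1 y" if "x0 < x" "x < y" "y < x3" for x y
  proof (rule DERIV_pos_imp_increasing[OF that(2)])
    fix z assume "x \<le> z" "z \<le> y"
    then have z: "x0 < z" "z < x3" using that by auto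
    have "A z / (2 * sqrt (g1 z)) * schwarzian g1 g2 g3 z < 0"
      using A[of z] pos[of z] S[of z] z by (intro mult_pos_neg divide_pos_pos) auto
    then have "- A z / (2 * sqrt (g1 z)) * schwarzian g1 g2 g3 z > 0" by simp
    then show "\<exists>w. (W1 has_real_derivative w) (at z) \<and> w > 0" using dW1 z by blast
  qed
  have slope: "(kap * g1 x / (A x)\<^sup>2 > 1 \<longleftrightarrow> W x < sqrt kap)" "(kap * g1 x / (A x)\<^sup>2 = 1 \<longleftrightarrow> W x = sqrt kap)"
    if "x0 < x" "x < x3" for x
  proof -
    have p: "A x > 0" "g1 x > 0" using A pos that by auto
    have "kap * g1 x / (A x)\<^sup>2 > 1 \<longleftrightarrow> (A x)\<^sup>2 < kap * g1 x" using p by (simp add: field_simps)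
    also have "\<dots> \<longleftrightarrow> A x < sqrt (kap * g1 x)" using p kap
      by (metis real_less_rsqrt real_sqrt_less_iff less_eq_real_def real_sqrt_abs abs_of_pos)
    finally show "(kap * g1 x / (A x)\<^sup>2 > 1 \<longleftrightarrow> W x < sqrt kap)" using p
      by (simp add: W_def real_sqrt_mult field_simps)
    have "kap * g1 x / (A x)\<^sup>2 = 1 \<longleftrightarrow> (A x)\<^sup>2 = kap * g1 x" using p by (auto simp: field_simps)
    also have "\<dots> \<longleftrightarrow> A x = sqrt (kap * g1 x)" using p kap
      by (metis less_eq_real_def real_sqrt_abs abs_of_pos real_sqrt_pow2 mult_nonneg_nonneg)
    finally show "(kap * g1 x / (A x)\<^sup>2 = 1 \<longleftrightarrow> W x = sqrt kap)" using p
      by (auto simp: W_def real_sqrt_mult field_simps)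
  qed
  obtain e1 where e1: "x0 < e1" "e1 < x1" "W e1 = sqrt kap"
  proof -
    have "\<exists>l z. x0 < z \<and> z < x1 \<and> (f has_real_derivative l) (at z) \<and> f x1 - f x0 = (x1 - x0) * l"
      by (rule MVT) (use ord df contf' in \<open>auto simp: real_differentiable_def\<close>, meson df less_trans)
    then obtain l z where z: "x0 < z" "z < x1" "(f has_real_derivative l) (at z)" "x1 - x0 = (x1 - x0) * l"
      using f0 f1 by auto
    then have "l = 1" using ord by auto
    moreover have "kap * g1 z / (A z)\<^sup>2 = l" using DERIV_unique[OF df[of z] z(3)] z ord by auto
    ultimately have "kap * g1 z / (A z)\<^sup>2 = 1" by metis
    then have "W z = sqrt kap" by (rule iffD1[OF slope(2), rotated 2]) (use z ord in auto)
    with that z show ?thesis by blast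
  qed
  obtain e2 where e2: "x1 < e2" "e2 < x3" "W e2 = sqrt kap"
  proof -
    have "\<exists>l z. x1 < z \<and> z < x3 \<and> (f has_real_derivative l) (at z) \<and> f x3 - f x1 = (x3 - x1) * l"
      by (rule MVT) (use ord df contf' in \<open>auto simp: real_differentiable_def\<close>, meson df less_trans)
    then obtain l z where z: "x1 < z" "z < x3" "(f has_real_derivative l) (at z)" "x3 - x1 = (x3 - x1) * l"
      using f3 f1 by auto
    then have "l = 1" using ord by auto
    moreover have "kap * g1 z / (A z)\<^sup>2 = l" using DERIV_unique[OF df[of z] z(3)] z ord by auto
    ultimately have "kap * g1 z / (A z)\<^sup>2 = 1" by metis
    then have "W z = sqrt kap" by (rule iffD1[OF slope(2), rotated 2]) (use z ord in auto)
    with that z show ?thesis by blast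
  qed
  have MVT_W: "\<exists>z. u < z \<and> z < v \<and> W v - W u = (v - u) * W1 z" if "x0 < u" "u < v" "v < x3" for u v
    by (rule MVT2) (use that dW in auto)
  have inner: "W x < sqrt kap" if x: "e1 < x" "x < e2" for x
  proof (rule ccontr)
    assume n: "\<not> W x < sqrt kap"
    obtain z1 where z1: "e1 < z1" "z1 < x" "W x - W e1 = (x - e1) * W1 z1"
      using MVT_W[of e1 x] x e1 e2 by auto
    obtain z2 where z2: "x < z2" "z2 < e2" "W e2 - W x = (e2 - x) * W1 z2"
      using MVT_W[of x e2] x e1 e2 by auto
    have "(x - e1) * W1 z1 \<ge> 0" "(e2 - x) * W1 z2 \<le> 0" using z1 z2 e1 e2 n by auto
    then have "W1 z1 \<ge> 0" "W1 z2 \<le> 0" using x by (auto simp: zero_le_mult_iff mult_le_0_iff)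
    then show False using W1_mono[of z1 z2] z1 z2 e1 e2 ord by auto
  qed
  have outer: "W x > sqrt kap" if x: "e2 < x" "x < x3" for x
  proof -
    obtain z1 where z1: "e1 < z1" "z1 < e2" "W e2 - W e1 = (e2 - e1) * W1 z1"
      using MVT_W[of e1 e2] x e1 e2 by auto
    then have "W1 z1 = 0" using e1 e2 by auto
    obtain z2 where z2: "e2 < z2" "z2 < x" "W x - W e2 = (x - e2) * W1 z2"
      using MVT_W[of e2 x] x e1 e2 ord by auto
    have "W1 z2 > 0" using W1_mono[of z1 z2] z1 z2 \<open>W1 z1 = 0\<close> e1 x by auto
    then have "W x - W e2 > 0" using z2 x by simp
    then show ?thesis using e2 by simp
  qed
  \<comment> \<open>The difference \<open>f x - x\<close> increases from 0 at \<open>x1\<close>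
    until \<open>e2\<close> and then decreases to 0 at \<open>x3\<close>.\<close>
  have fx2: "f x2 > x2"
  proof (cases "x2 \<le> e2")
    case True
    have "f x1 - x1 < f x2 - x2"
    proof (rule DERIV_pos_imp_increasing_open[OF ord(2)])
      fix z assume z: "x1 < z" "z < x2"
      then have "kap * g1 z / (A z)\<^sup>2 > 1" using inner[of z] slope(1)[of z] True e1 e2 ord by auto
      moreover have "((\<lambda>x. f x - x) has_real_derivative kap * g1 z / (A z)\<^sup>2 - 1) (at z)"
        by (rule derivative_eq_intros df | use z ord in simp)+
      ultimately show "\<exists>w. ((\<lambda>x. f x - x) has_real_derivative w) (at z) \<and> w > 0" by force
    qed (intro continuous_intros contf', use ord in auto)
    then show ?thesis using f1 by simp
  next
    case False
    have "- (f x2 - x2) < - (f x3 - x3)"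
    proof (rule DERIV_pos_imp_increasing_open[OF ord(3)])
      fix z assume z: "x2 < z" "z < x3"
      then have x0z: "x0 < z" using ord by linarith
      have "W z > sqrt kap" using z outer[of z] False by auto
      then have "kap * g1 z / (A z)\<^sup>2 < 1"
        using slope[of z] z(2) x0z by linarith
      moreover have "((\<lambda>x. - (f x - x)) has_real_derivative - (kap * g1 z / (A z)\<^sup>2 - 1)) (at z)"
        by (rule derivative_eq_intros df | use z ord in simp)+
      ultimately show "\<exists>w. ((\<lambda>x. - (f x - x)) has_real_derivative w) (at z) \<and> w > 0" by force
    qed (intro continuous_intros contf', use ord in auto)
    then show ?thesis using f3 by simp
  qed
  have "(x2 - x0) * (g x3 - g x2) < k * (x3 - x2) * (g x2 - g x0)"
  proof -
    have "x2 * A x2 < x0 * (g x3 - g x2) + k * x3 * (g x2 - g x0)"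
      using fx2 A[of x2] ord by (simp add: f_def field_simps)
    then show ?thesis by (simp add: A_def algebra_simps)
  qed
  also have "\<dots> = (x1 - x0) * (g x3 - g x1) * ((x3 - x2) * (g x2 - g x0)) / ((x3 - x1) * (g x1 - g x0))"
    by (simp add: k_def)
  finally have main: "(x2 - x0) * (g x3 - g x2) * ((x3 - x1) * (g x1 - g x0)) < (x1 - x0) * (g x3 - g x1) * ((x3 - x2) * (g x2 - g x0))"
    using ord gs by (simp add: pos_less_divide_eq)
  \<comment> \<open>A common product cancels by \<open>(x2 - x0) * (x3 - x1) = (x1 - x0) * (x3 - x2)
    + (x3 - x0) * (x2 - x1)\<close> and the same identity for the images.\<close>
  have "(x3 - x0) * (x2 - x1) * ((g x1 - g x0) * (g x3 - g x2)) < (g x3 - g x0) * (g x2 - g x1) * ((x1 - x0) * (x3 - x2))"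
    using main by (simp add: algebra_simps)
  then have "((x3 - x0) * (x2 - x1)) / ((x1 - x0) * (x3 - x2)) < ((g x3 - g x0) * (g x2 - g x1)) / ((g x1 - g x0) * (g x3 - g x2))"
    by (intro divide_less_divide_if mult_pos_pos) (use ord gs in auto)
  then show ?thesis using ord gs by (simp add: cross_ratio_def)
qed

section \<open>Unimodal maps that expand cross-ratios\<close>

lemma cross_ratio_reverse: "cross_ratio x3 x2 x1 x0 = cross_ratio x0 x1 x2 x3"
  by (simp add: cross_ratio_def abs_minus_commute mult.commute)

text \<open>With left, middle and right lengths \<open>L\<close>, \<open>M\<close>, \<open>R\<close>
  the cross-ratio is \<open>(1 + M / L) * (1 + M / R) - 1\<close>, which decreases in
  \<open>L\<close> and in \<open>R\<close>.\<close>

lemma cross_ratio_antimono_outer: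
  assumes "x0' \<le> x0" "x0 < x1" "x1 < x2" "x2 < x3" "x3 \<le> x3'"
  shows "cross_ratio x0' x1 x2 x3' \<le> cross_ratio x0 x1 x2 x3"
proof -
  have eq: "cross_ratio p x1 x2 q = (1 + (x2 - x1) / (x1 - p)) * (1 + (x2 - x1) / (q - x2)) - 1"
    if "p < x1" "x2 < q" for p q
  proof -
    define L M R where "L = x1 - p" "M = x2 - x1" "R = q - x2"
    then have "L > 0" "M > 0" "R > 0" "q - p = L + M + R" using that assms by auto
    then show ?thesis unfolding cross_ratio_def L_M_R_def[symmetric]
      by (simp add: field_simps)
  qed
  have "(1 + (x2 - x1) / (x1 - x0')) * (1 + (x2 - x1) / (x3' - x2)) \<le>
      (1 + (x2 - x1) / (x1 - x0)) * (1 + (x2 - x1) / (x3 - x2))"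
    using assms by (intro mult_mono add_mono frac_le) auto
  then show ?thesis using assms by (simp add: eq)
qed

lemma cross_ratio_mono_inner:
  assumes "x0 < x1'" "x1' \<le> x1" "x1 < x2" "x2 \<le> x2'" "x2' < x3"
  shows "cross_ratio x0 x1 x2 x3 \<le> cross_ratio x0 x1' x2' x3"
proof -
  have "\<bar>x3 - x0\<bar> * \<bar>x2 - x1\<bar> \<le> \<bar>x3 - x0\<bar> * \<bar>x2' - x1'\<bar>" using assms by (intro mult_left_mono) auto
  moreover have "\<bar>x1' - x0\<bar> * \<bar>x3 - x2'\<bar> \<le> \<bar>x1 - x0\<bar> * \<bar>x3 - x2\<bar>" using assms by (intro mult_mono) auto
  ultimately show ?thesis unfolding cross_ratio_def using assms by (intro frac_le) auto
qed

text \<open>The orbits of the two end points are monotone and can converge only to \<open>w\<close>.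
  All other orbits are squeezed between them, whence the uniformity in \<open>x\<close>.\<close>

lemma iterates_tendsto_unique_fixpoint:
  fixes f :: "real \<Rightarrow> real"
  assumes lu: "l \<le> u" and cont: "continuous_on {l..u} f" and maps: "f ` {l..u} \<subseteq> {l..u}"
    and mono: "\<And>x y. l \<le> x \<Longrightarrow> x \<le> y \<Longrightarrow> y \<le> u \<Longrightarrow> f x \<le> f y"
    and uniq: "\<And>x. l \<le> x \<Longrightarrow> x \<le> u \<Longrightarrow> f x = x \<Longrightarrow> x = w" and "0 < \<epsilon>"
  shows "\<exists>K. \<forall>k\<ge>K. \<forall>x\<in>{l..u}. \<bar>(f ^^ k) x - w\<bar> < \<epsilon>"
proof -
  have it: "(f ^^ k) x \<in> {l..u}" if "x \<in> {l..u}" for k x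
    using that by (induction k) (use maps in \<open>auto simp del: atLeastAtMost_iff\<close>)
  have it_mono: "(f ^^ k) x \<le> (f ^^ k) y" if "x \<in> {l..u}" "y \<in> {l..u}" "x \<le> y" for k x y
    using that
  proof (induction k)
    case (Suc k)
    then show ?case using it[of x k] it[of y k] mono by auto
  qed simp
  have conv: "(\<lambda>k. (f ^^ k) x) \<longlonglongrightarrow> w" if x: "x \<in> {l..u}" and m: "monoseq (\<lambda>k. (f ^^ k) x)" for x
  proof -
    have "Bseq (\<lambda>k. (f ^^ k) x)"
    proof (rule BseqI')
      show "norm ((f ^^ n) x) \<le> max \<bar>l\<bar> \<bar>u\<bar>" for n using it[OF x, of n] by (auto simp: max_def)
    qed
    then obtain z where z: "(\<lambda>k. (f ^^ k) x) \<longlonglongrightarrow> z" using Bseq_monoseq_convergent[OF _ m] by (auto simp: convergent_def)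
    have zin: "z \<in> {l..u}" using closed_sequentially[OF closed_atLeastAtMost, of "\<lambda>k. (f ^^ k) x"] it[OF x] z by blast
    have "(\<lambda>k. f ((f ^^ k) x)) \<longlonglongrightarrow> f z"
      using cont zin it[OF x] z unfolding continuous_on_sequentially by (auto simp: o_def)
    then have "(\<lambda>k. (f ^^ Suc k) x) \<longlonglongrightarrow> f z" by simp
    then have "f z = z" using LIMSEQ_Suc[OF z] LIMSEQ_unique by blast
    then show ?thesis using uniq zin z by auto
  qed
  have fl: "l \<le> f l" "f u \<le> u" using maps lu by (auto simp: image_subset_iff)
  have "(f ^^ k) l \<le> (f ^^ Suc k) l" for k
    using it_mono[of l "f l" k] fl maps lu by (auto simp: funpow_swap1 image_subset_iff)
  then have "(\<lambda>k. (f ^^ k) l) \<longlonglongrightarrow> w" by (intro conv) (use lu in \<open>auto intro!: mono_SucI1\<close>)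
  then obtain K1 where K1: "\<And>k. k \<ge> K1 \<Longrightarrow> \<bar>(f ^^ k) l - w\<bar> < \<epsilon>" using LIMSEQ_D[OF _ \<open>0 < \<epsilon>\<close>] by fastforce
  have "(f ^^ Suc k) u \<le> (f ^^ k) u" for k
    using it_mono[of "f u" u k] fl maps lu by (auto simp: funpow_swap1 image_subset_iff)
  then have "(\<lambda>k. (f ^^ k) u) \<longlonglongrightarrow> w" by (intro conv) (use lu in \<open>auto intro!: mono_SucI2\<close>)
  then obtain K2 where K2: "\<And>k. k \<ge> K2 \<Longrightarrow> \<bar>(f ^^ k) u - w\<bar> < \<epsilon>" using LIMSEQ_D[OF _ \<open>0 < \<epsilon>\<close>] by fastforce
  have "\<bar>(f ^^ k) x - w\<bar> < \<epsilon>" if "k \<ge> max K1 K2" "x \<in> {l..u}" for k x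
    using K1[of k] K2[of k] it_mono[of l x k] it_mono[of x u k] that by auto
  then show ?thesis by blast
qed

text \<open>What is kept of the negative Schwarzian is \<open>cr\<close> and
  \<open>deriv1_nz\<close>. The assumptions on derivatives serve the distortion bound away from
  \<open>c\<close>; all other arguments on expansion rest on \<open>cr\<close>.\<close>

locale expanding_unimodal =
  fixes a b c :: real and g g1 g2 :: "real \<Rightarrow> real"
  assumes unimodal: "unimodal a b c g"
    and cr: "\<And>x0 x1 x2 x3. x0 < x1 \<Longrightarrow> x1 < x2 \<Longrightarrow> x2 < x3 \<Longrightarrow> {x0..x3} \<subseteq> {a..c} \<or> {x0..x3} \<subseteq> {c..b} \<Longrightarrow>
        cross_ratio x0 x1 x2 x3 < cross_ratio (g x0) (g x1) (g x2) (g x3)"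
    and deriv1: "\<And>x. x \<in> {a..b} \<Longrightarrow> (g has_real_derivative g1 x) (at x within {a..b})"
    and deriv2: "\<And>x. x \<in> {a..b} \<Longrightarrow> (g1 has_real_derivative g2 x) (at x within {a..b})"
    and cont2: "continuous_on {a..b} g2"
    and deriv1_nz: "\<And>x. x \<in> {a..b} \<Longrightarrow> x \<noteq> c \<Longrightarrow> g1 x \<noteq> 0"
begin

lemma ac: "a < c" and cb: "c < b" and cont: "continuous_on {a..b} g" and maps: "g ` {a..b} \<subseteq> {a..b}"
  and ga: "g a = a" and gb: "g b = a"
  using unimodal by (auto simp: unimodal_def)

lemma mono_left: "a \<le> x \<Longrightarrow> x < y \<Longrightarrow> y \<le> c \<Longrightarrow> g x < g y"
  using unimodal unfolding unimodal_def by (auto intro: strict_mono_onD)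

lemma mono_right: "c \<le> x \<Longrightarrow> x < y \<Longrightarrow> y \<le> b \<Longrightarrow> g y < g x"
  using unimodal unfolding unimodal_def by (auto simp: monotone_on_def)

lemma g_in: "x \<in> {a..b} \<Longrightarrow> g x \<in> {a..b}" using maps by blast

lemma iter_in: "x \<in> {a..b} \<Longrightarrow> (g ^^ i) x \<in> {a..b}"
  by (induction i) (use g_in in \<open>auto simp del: atLeastAtMost_iff\<close>)

lemma iter_cont: "continuous_on {a..b} (g ^^ i)"
proof (induction i)
  case (Suc i)
  have "continuous_on {a..b} (g \<circ> (g ^^ i))"
    by (rule continuous_on_compose[OF Suc], rule continuous_on_subset[OF cont]) (use iter_in in auto)
  then show ?case by simp
qed (simp add: id_def)

lemma iter_a: "(g ^^ i) a = a" by (induction i) (auto simp: ga)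

lemma less_gc: "x \<in> {a..b} \<Longrightarrow> x \<noteq> c \<Longrightarrow> g x < g c"
  using mono_left[of x c] mono_right[of c x] ac cb by (cases "x < c") auto

lemma le_gc: "x \<in> {a..b} \<Longrightarrow> g x \<le> g c"
  using less_gc[of x] by (cases "x = c") auto

lemma gc_in: "g c \<in> {a..b}" using g_in ac cb by auto

lemma iter_le_gc: "x \<in> {a..b} \<Longrightarrow> 0 < i \<Longrightarrow> (g ^^ i) x \<le> g c"
  using le_gc[OF iter_in, of x "i - 1"] by (cases i) auto

text \<open>Both sides include \<open>c\<close>, since \<open>g\<close> is injective up to
  \<open>c\<close>; orbits that hit \<open>c\<close> can thus be treated along with the
  others.\<close>

definition one_sided :: "real set \<Rightarrow> bool" where
  "one_sided S \<longleftrightarrow> S \<subseteq> {a..c} \<or> S \<subseteq> {c..b}"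

lemma one_sided_subset: "one_sided S \<Longrightarrow> R \<subseteq> S \<Longrightarrow> one_sided R"
  by (auto simp: one_sided_def)

lemma one_sided_sub: "one_sided S \<Longrightarrow> S \<subseteq> {a..b}"
  using ac cb by (auto simp: one_sided_def)

lemma one_sided_inj: "one_sided S \<Longrightarrow> inj_on g S"
  unfolding one_sided_def
proof (elim disjE)
  assume S: "S \<subseteq> {a..c}"
  then have "g x < g y" if "x \<in> S" "y \<in> S" "x < y" for x y using that by (intro mono_left) auto
  then show ?thesis by (intro linorder_inj_onI) force+
next
  assume S: "S \<subseteq> {c..b}"
  then have "g y < g x" if "x \<in> S" "y \<in> S" "x < y" for x y using that by (intro mono_right) auto
  then show ?thesis by (intro linorder_inj_onI) force+
qed

lemma one_sided_if_avoids:
  assumes "connected S" "S \<subseteq> {a..b}" "c \<notin> S"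
  shows "one_sided S"
proof (rule ccontr)
  assume "\<not> one_sided S"
  then obtain x y where "x \<in> S" "x > c" "y \<in> S" "y < c" using assms(2) by (fastforce simp: one_sided_def)
  then show False using connectedD_interval[OF assms(1), of y x c] assms(3) by auto
qed

lemma iter_monotone:
  assumes "\<And>i. i < k \<Longrightarrow> one_sided ((g ^^ i) ` S)"
  shows "(\<forall>x\<in>S. \<forall>y\<in>S. x < y \<longrightarrow> (g ^^ k) x < (g ^^ k) y) \<or> (\<forall>x\<in>S. \<forall>y\<in>S. x < y \<longrightarrow> (g ^^ k) y < (g ^^ k) x)"
  using assms
proof (induction k)
  case (Suc k)
  have "(g ^^ k) ` S \<subseteq> {a..c} \<or> (g ^^ k) ` S \<subseteq> {c..b}" using Suc.prems[of k] by (simp add: one_sided_def)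
  then have "(\<forall>x\<in>S. \<forall>y\<in>S. (g ^^ k) x < (g ^^ k) y \<longrightarrow> (g ^^ Suc k) x < (g ^^ Suc k) y) \<or>
     (\<forall>x\<in>S. \<forall>y\<in>S. (g ^^ k) x < (g ^^ k) y \<longrightarrow> (g ^^ Suc k) y < (g ^^ Suc k) x)"
  proof
    assume *: "(g ^^ k) ` S \<subseteq> {a..c}"
    show ?thesis by (rule disjI1) (use * in \<open>force intro!: mono_left\<close>)
  next
    assume *: "(g ^^ k) ` S \<subseteq> {c..b}"
    show ?thesis by (rule disjI2) (use * in \<open>force intro!: mono_right\<close>)
  qed
  then show ?case using Suc by (metis less_Suc_eq)
qed simp

text \<open>Unlike a bound on derivatives, expansion simply composes; where an iterate reverses the
  order, symmetry of the cross-ratio helps.\<close>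

lemma iter_cross_ratio:
  assumes os: "\<And>i. i < k \<Longrightarrow> one_sided ((g ^^ i) ` S)"
    and x: "x0 < x1" "x1 < x2" "x2 < x3" "x0 \<in> S" "x1 \<in> S" "x2 \<in> S" "x3 \<in> S" and "0 < k"
  shows "cross_ratio x0 x1 x2 x3 < cross_ratio ((g ^^ k) x0) ((g ^^ k) x1) ((g ^^ k) x2) ((g ^^ k) x3)"
proof -
  have "cross_ratio x0 x1 x2 x3 \<le> cross_ratio ((g ^^ j) x0) ((g ^^ j) x1) ((g ^^ j) x2) ((g ^^ j) x3) \<and>
     (0 < j \<longrightarrow> cross_ratio x0 x1 x2 x3 < cross_ratio ((g ^^ j) x0) ((g ^^ j) x1) ((g ^^ j) x2) ((g ^^ j) x3))"
    if "j \<le> k" for j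
    using that
  proof (induction j)
    case (Suc j)
    let ?y = "\<lambda>x. (g ^^ j) x"
    have sub: "?y ` S \<subseteq> {a..c} \<or> ?y ` S \<subseteq> {c..b}" using os[of j] Suc.prems by (simp add: one_sided_def)
    have "(\<forall>x\<in>S. \<forall>y\<in>S. x < y \<longrightarrow> ?y x < ?y y) \<or> (\<forall>x\<in>S. \<forall>y\<in>S. x < y \<longrightarrow> ?y y < ?y x)"
      by (rule iter_monotone) (use os Suc.prems in auto)
    then have "cross_ratio (?y x0) (?y x1) (?y x2) (?y x3) < cross_ratio (g (?y x0)) (g (?y x1)) (g (?y x2)) (g (?y x3))"
    proof
      assume "\<forall>x\<in>S. \<forall>y\<in>S. x < y \<longrightarrow> ?y x < ?y y"
      then show ?thesis using x sub by (intro cr) (auto simp: image_subset_iff)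
    next
      assume "\<forall>x\<in>S. \<forall>y\<in>S. x < y \<longrightarrow> ?y y < ?y x"
      then have "cross_ratio (?y x3) (?y x2) (?y x1) (?y x0) < cross_ratio (g (?y x3)) (g (?y x2)) (g (?y x1)) (g (?y x0))"
        using x sub by (intro cr) (auto simp: image_subset_iff)
      then show ?thesis by (simp add: cross_ratio_reverse)
    qed
    then show ?case using Suc by force
  qed simp
  then show ?thesis using \<open>0 < k\<close> by auto
qed

text \<open>The hypothesis concerns segments spanned by two orbits, because these are what
  itineraries control; one-sidedness of the images is a consequence.\<close>

lemma iter_segment:
  assumes "\<And>i. i < k \<Longrightarrow> one_sided (closed_segment ((g ^^ i) x) ((g ^^ i) y))"
  shows "(g ^^ k) ` closed_segment x y \<subseteq> closed_segment ((g ^^ k) x) ((g ^^ k) y)"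
  using assms
proof (induction k)
  case (Suc k)
  let ?s = "closed_segment ((g ^^ k) x) ((g ^^ k) y)"
  have os: "one_sided ?s" using Suc.prems[of k] by simp
  have "(g ^^ Suc k) ` closed_segment x y \<subseteq> g ` ?s" using Suc by (auto simp flip: image_comp)
  also have "\<dots> \<subseteq> closed_segment ((g ^^ Suc k) x) ((g ^^ Suc k) y)"
    using segment_image_subset_if_inj[of ?s g "(g ^^ k) x" "(g ^^ k) y"]
      continuous_on_subset[OF cont one_sided_sub[OF os]] one_sided_inj[OF os] by simp
  finally show ?case .
qed simp

end

section \<open>The attracting periodic orbit forced by an odd kneading sequence\<close>

lemma odd_periodic_kneadingE:
  assumes "odd_periodic (kneading g c)"
  obtains n where "0 < n" "\<And>i. kneading g c (i + n) = kneading g c i" "odd (\<Sum>i<n. kneading g c i)"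
proof -
  obtain v where v: "v \<noteq> []" "kneading g c = repetition v" "odd (count_list v 1)"
    using assms by (auto simp: odd_periodic_def)
  have vi: "v ! i = kneading g c i" if "i < length v" for i using v that by (simp add: repetition_def)
  have "x \<in> {0, 1}" if "x \<in> set v" for x
    using that vi itinerary_binary unfolding kneading_def by (metis in_set_conv_nth insertCI)
  then have "count_list v 1 = sum_list v" by (induction v) auto
  also have "\<dots> = (\<Sum>i<length v. kneading g c i)"
    using vi by (simp add: sum_list_sum_nth atLeast0LessThan)
  finally have "odd (\<Sum>i<length v. kneading g c i)" using v by simp
  moreover have "kneading g c (i + length v) = kneading g c i" for i using v by (simp add: repetition_def)
  ultimately show thesis using that[of "length v"] v by auto
qed
text \<open>Only weak inequalities can be recovered, since the symbol at a visit to \<open>c\<close>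
  is set by convention.\<close>

lemma kneading_side:
  "kneading g c i = 0 \<Longrightarrow> (g ^^ i) (g c) \<le> c" "kneading g c i = 1 \<Longrightarrow> c \<le> (g ^^ i) (g c)"
  using itinerary_less[where g = g and i = i and x = "g c" and c = c]
    itinerary_greater[where g = g and i = i and x = "g c" and c = c] unfolding kneading_def by force+

lemma kneading_01: "kneading g c i = 0 \<or> kneading g c i = 1"
  unfolding kneading_def by (rule itinerary_binary)

text \<open>The points \<open>g c\<close> and \<open>l\<close> follow the same symbols, so no
  iterate folds the interval between them, and oddness makes \<open>f\<close> reverse it. If
  \<open>q\<close> is the only fixed point of \<open>\<phi>\<close>, it attracts the whole interval.
  Otherwise a 2-cycle of \<open>f\<close> gives fixed points of \<open>\<phi>\<close> on both sides
  of \<open>q\<close>, and expansion of cross-ratios forces the upper one to attract.\<close>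

lemma (in expanding_unimodal) attracting_trap:
  assumes "odd_periodic (kneading g c)"
  obtains m y w where "0 < m" "a \<le> y" "y < w" "w \<le> g c" "(g ^^ m) w = w" "(g ^^ m) ` {y..g c} \<subseteq> {y..g c}"
    "\<And>\<epsilon>. 0 < \<epsilon> \<Longrightarrow> \<exists>K. \<forall>k\<ge>K. \<forall>x\<in>{y..g c}. \<bar>(g ^^ (m * k)) x - w\<bar> < \<epsilon>"
proof -
  note conclude = that
  let ?\<kappa> = "kneading g c"
  obtain n where n: "0 < n" "\<And>i. ?\<kappa> (i + n) = ?\<kappa> i" "odd (\<Sum>i<n. ?\<kappa> i)"
    using odd_periodic_kneadingE[OF assms] by metis
  define u l where "u = g c" and "l = (g ^^ n) u"
  have u_in: "u \<in> {a..b}" using gc_in by (simp add: u_def)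
  have lu_in: "l \<in> {a..b}" "l \<le> u" using iter_in[OF u_in] iter_le_gc[OF u_in] n by (auto simp: l_def u_def)
  have it_l: "(g ^^ i) l = (g ^^ (i + n)) u" for i by (simp add: l_def funpow_add)
  have seg: "one_sided (closed_segment ((g ^^ i) l) ((g ^^ i) u)) \<and>
      closed_segment ((g ^^ i) l) ((g ^^ i) u) \<subseteq> (if ?\<kappa> i = 0 then {a..c} else {c..b})" for i
  proof -
    have in_ab: "(g ^^ i) l \<in> {a..b}" "(g ^^ i) u \<in> {a..b}" using iter_in lu_in u_in by auto
    have "(g ^^ i) l \<in> (if ?\<kappa> i = 0 then {a..c} else {c..b})" "(g ^^ i) u \<in> (if ?\<kappa> i = 0 then {a..c} else {c..b})"
      using kneading_side[where g = g and c = c and i = i] kneading_side[where g = g and c = c and i = "i + n"] n(2)[of i] kneading_01[of g c i] in_ab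
      unfolding it_l u_def by auto
    then have "closed_segment ((g ^^ i) l) ((g ^^ i) u) \<subseteq> (if ?\<kappa> i = 0 then {a..c} else {c..b})"
      by (intro closed_segment_subset) auto
    then show ?thesis by (auto simp: one_sided_def split: if_splits)
  qed
  have V: "closed_segment l u = {l..u}" using lu_in by (simp add: closed_segment_eq_real_ivl)
  have img: "(g ^^ i) ` {l..u} \<subseteq> closed_segment ((g ^^ i) l) ((g ^^ i) u)" for i
    using iter_segment[of i l u] seg V by auto
  have os: "one_sided ((g ^^ i) ` {l..u})" for i using one_sided_subset[OF _ img] seg by blast
  have parity: "if even (\<Sum>j<i. ?\<kappa> j) then (g ^^ i) x < (g ^^ i) y else (g ^^ i) y < (g ^^ i) x"
    if "l \<le> x" "x < y" "y \<le> u" for i x y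
  proof (induction i)
    case (Suc i)
    have "(g ^^ i) z \<in> (if ?\<kappa> i = 0 then {a..c} else {c..b})" if "z \<in> {l..u}" for z
      using img[of i] seg[of i] that by blast
    from this[of x] this[of y]
    have "(g ^^ i) x \<in> (if ?\<kappa> i = 0 then {a..c} else {c..b})" "(g ^^ i) y \<in> (if ?\<kappa> i = 0 then {a..c} else {c..b})"
      using that by auto
    then show ?case
      using Suc kneading_01[of g c i] mono_left[of "(g ^^ i) x" "(g ^^ i) y"] mono_left[of "(g ^^ i) y" "(g ^^ i) x"]
         mono_right[of "(g ^^ i) x" "(g ^^ i) y"] mono_right[of "(g ^^ i) y" "(g ^^ i) x"]
      by (auto split: if_splits)
  qed (use that in auto)
  define f where "f = (g ^^ n)"
  have f_anti: "f y < f x" if "l \<le> x" "x < y" "y \<le> u" for x y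
    using parity[OF that, of n] n by (simp add: f_def)
  have fu: "f u = l" by (simp add: f_def l_def)
  have f_le: "f x \<le> u" if "x \<in> {a..b}" for x using iter_le_gc[OF that n(1)] by (simp add: f_def u_def)
  \<comment> \<open>Otherwise \<open>g c\<close> returns to itself after \<open>n\<close> steps and
    so hits \<open>c\<close> at time \<open>n - 1\<close>; there the convention for visits to
    \<open>c\<close> makes the sum over the period even.\<close>
  have lu: "l < u"
  proof (rule ccontr)
    assume "\<not> l < u"
    then have lu: "(g ^^ n) (g c) = g c" using lu_in by (simp add: l_def u_def)
    obtain n' where n': "n = Suc n'" using n by (cases n) auto
    have "(g ^^ n') (g c) = c"
      using less_gc[OF iter_in[OF gc_in], of n'] lu n' by auto
    then have "tau n' ?\<kappa> = 0" unfolding kneading_def by (rule itinerary_critical)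
    then show False using n(3) by (simp add: tau_def n' lessThan_Suc_atMost even_iff_mod_2_eq_zero)
  qed
  have f_in: "f x \<in> {l..u}" if "x \<in> {l..u}" for x
    using f_anti[of x u] fu f_le[of x] that lu_in u_in by (cases "x = u") auto
  have contf: "continuous_on {l..u} f"
    using continuous_on_subset[OF iter_cont] lu_in u_in by (auto simp: f_def)
  obtain q where q: "l \<le> q" "q \<le> u" "f q = q"
  proof -
    have "continuous_on {l..u} (\<lambda>x. x - f x)" by (intro continuous_intros contf)
    then have "\<exists>x\<ge>l. x \<le> u \<and> x - f x = 0"
      by (intro IVT') (use f_in[of l] fu lu in simp_all)
    then show ?thesis using that by auto
  qed
  have "f l > f u" using f_anti lu by auto
  then have ql: "l < q" "q < u" using q fu lu by (cases "q = l"; cases "q = u"; auto)+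
  define \<phi> where "\<phi> = (g ^^ (2 * n))"
  have \<phi>: "\<phi> x = f (f x)" for x by (simp add: \<phi>_def f_def mult_2 funpow_add)
  have \<phi>_mono: "\<phi> x < \<phi> y" if "l \<le> x" "x < y" "y \<le> u" for x y
    unfolding \<phi> using f_in[of x] f_in[of y] that by (intro f_anti) auto
  have \<phi>_in: "\<phi> x \<in> {l..u}" if "x \<in> {l..u}" for x using f_in that by (simp add: \<phi>)
  have \<phi>_cont: "continuous_on {y..u} \<phi>" if "l \<le> y" for y
    using continuous_on_subset[OF iter_cont] that lu_in u_in by (auto simp: \<phi>_def)
  have \<phi>_cr: "cross_ratio x0 x1 x2 x3 < cross_ratio (\<phi> x0) (\<phi> x1) (\<phi> x2) (\<phi> x3)"
    if "x0 < x1" "x1 < x2" "x2 < x3" "l \<le> x0" "x3 \<le> u" for x0 x1 x2 x3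
    unfolding \<phi>_def using iter_cross_ratio[of "2 * n" "{l..u}"] os that n(1) by auto
  have result: thesis if y: "l \<le> y" "y < w" "w \<le> u" and w: "\<phi> w = w" and yphi: "y \<le> \<phi> y"
    and uniq: "\<And>x. y \<le> x \<Longrightarrow> x \<le> u \<Longrightarrow> \<phi> x = x \<Longrightarrow> x = w" for y w
  proof -
    have mono: "\<phi> x \<le> \<phi> z" if "y \<le> x" "x \<le> z" "z \<le> u" for x z
      using \<phi>_mono[of x z] that y by (cases "x = z") auto
    have maps: "\<phi> ` {y..u} \<subseteq> {y..u}"
    proof clarify
      fix x assume "x \<in> {y..u}"
      then show "\<phi> x \<in> {y..u}" using \<phi>_in[of x] mono[of y x] y yphi by auto
    qed
    have "\<exists>K. \<forall>k\<ge>K. \<forall>x\<in>{y..u}. \<bar>(\<phi> ^^ k) x - w\<bar> < \<epsilon>" if "0 < \<epsilon>" for \<epsilon>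
      by (rule iterates_tendsto_unique_fixpoint) (use y \<phi>_cont maps mono uniq that in auto)
    then have "\<exists>K. \<forall>k\<ge>K. \<forall>x\<in>{y..g c}. \<bar>(g ^^ (2 * n * k)) x - w\<bar> < \<epsilon>" if "0 < \<epsilon>" for \<epsilon>
      using that unfolding \<phi>_def funpow_mult u_def by simp
    then show thesis
      using conclude[of "2 * n" y w] n y w maps lu_in by (auto simp: \<phi>_def u_def)
  qed
  show thesis
  proof (cases "\<forall>x\<in>{l..u}. \<phi> x = x \<longrightarrow> x = q")
    case True
    have "\<phi> q = q" using q by (simp add: \<phi>)
    then show ?thesis using True ql \<phi>_in[of l] lu by (intro result[of l q]) auto
  next
    case False
    then obtain e where e: "e \<in> {l..u}" "f (f e) = e" "e \<noteq> q" by (auto simp: \<phi>)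
    have "\<exists>q1 q2. l \<le> q1 \<and> q1 < q \<and> q < q2 \<and> q2 \<le> u \<and> \<phi> q1 = q1 \<and> \<phi> q2 = q2"
    proof (cases "e < q")
      case True
      then have "q < f e" using f_anti[of e q] e q by auto
      then show ?thesis using e f_in[of e] True by (intro exI[of _ e] exI[of _ "f e"]) (auto simp: \<phi>)
    next
      case False
      then have "f e < q" using f_anti[of q e] e q by auto
      then show ?thesis using e f_in[of e] False by (intro exI[of _ "f e"] exI[of _ e]) (auto simp: \<phi>)
    qed
    then obtain q1 q2 where q12: "l \<le> q1" "q1 < q" "q < q2" "q2 \<le> u" "\<phi> q1 = q1" "\<phi> q2 = q2" by auto
    have \<phi>q: "\<phi> q = q" using q by (simp add: \<phi>)
    \<comment> \<open>As \<open>q1\<close>, \<open>q\<close> and \<open>q2\<close> are fixed, moving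
      \<open>x\<close> down would shrink the middle interval and lower the cross-ratio. In the next
      claim \<open>x\<close> is an outer point, and moving it outwards would lower the cross-ratio
      again.\<close>
    have up: "x < \<phi> x" if "q < x" "x < q2" for x
    proof (rule ccontr)
      assume "\<not> x < \<phi> x"
      then have "cross_ratio q1 q (\<phi> x) q2 \<le> cross_ratio q1 q x q2"
        using \<phi>_mono[of q x] \<phi>q that q12 by (intro cross_ratio_mono_inner) auto
      then show False using \<phi>_cr[of q1 q x q2] that q12 \<phi>q by auto
    qed
    have down: "\<phi> x < x" if "q2 < x" "x \<le> u" for x
    proof (rule ccontr)
      assume "\<not> \<phi> x < x"
      then have "cross_ratio q1 q q2 (\<phi> x) \<le> cross_ratio q1 q q2 x"
        using that q12 by (intro cross_ratio_antimono_outer) auto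
      then show False using \<phi>_cr[of q1 q q2 x] that q12 \<phi>q by auto
    qed
    \<comment> \<open>Any point strictly between \<open>q\<close> and \<open>q2\<close> would do;
      \<open>q\<close> itself has to be left out, being another fixed point.\<close>
    let ?y = "(q + q2) / 2"
    show ?thesis
    proof (rule result[of ?y q2])
      fix x assume "?y \<le> x" "x \<le> u" "\<phi> x = x"
      then show "x = q2" using up[of x] down[of x] q12 by (cases x q2 rule: linorder_cases) auto
    qed (use up[of ?y] q12 q ql in auto)
  qed
qed

section \<open>Points attracted to the orbit of the critical value\<close>

lemma (in expanding_unimodal) iter_image_Icc:
  assumes "p \<le> q" "a \<le> p" "q \<le> b"
  obtains p' q' where "p' \<le> q'" "(g ^^ k) ` {p..q} = {p'..q'}" "a \<le> p'" "q' \<le> b"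
proof -
  have c: "continuous_on {p..q} (g ^^ k)" using continuous_on_subset[OF iter_cont] assms by auto
  have "compact ((g ^^ k) ` {p..q})" "connected ((g ^^ k) ` {p..q})" "(g ^^ k) ` {p..q} \<noteq> {}"
    using compact_continuous_image[OF c] connected_continuous_image[OF c] assms by auto
  note * = compact_connected_real_eq_Icc[OF this]
  moreover have "(g ^^ k) ` {p..q} \<subseteq> {a..b}" using iter_in assms by (auto simp: image_subset_iff)
  ultimately show thesis using that by (metis atLeastatMost_subset_iff not_le)
qed

lemma (in expanding_unimodal) avoids_critical_nearby:
  assumes "x0 \<in> {a..b}" "\<And>i. i < k \<Longrightarrow> (g ^^ i) x0 \<noteq> c"
  obtains e where "0 < e" "\<And>x i. x \<in> {a..b} \<Longrightarrow> \<bar>x - x0\<bar> < e \<Longrightarrow> i < k \<Longrightarrow> (g ^^ i) x \<noteq> c"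
proof -
  have "\<exists>e>0. \<forall>x\<in>{a..b}. \<bar>x - x0\<bar> < e \<longrightarrow> (\<forall>i<k. (g ^^ i) x \<noteq> c)"
    using assms(2)
  proof (induction k)
    case (Suc k)
    obtain e1 where e1: "e1 > 0" "\<forall>x\<in>{a..b}. \<bar>x - x0\<bar> < e1 \<longrightarrow> (\<forall>i<k. (g ^^ i) x \<noteq> c)"
      using Suc.IH Suc.prems by auto
    have "0 < \<bar>(g ^^ k) x0 - c\<bar>" using Suc.prems[of k] by simp
    then obtain e2 where e2: "e2 > 0" "\<And>x. x \<in> {a..b} \<Longrightarrow> \<bar>x - x0\<bar> < e2 \<Longrightarrow> \<bar>(g ^^ k) x - (g ^^ k) x0\<bar> < \<bar>(g ^^ k) x0 - c\<bar>"
      using iter_cont[of k] assms(1) unfolding continuous_on_iff dist_real_def by metis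
    have "\<forall>i<Suc k. (g ^^ i) x \<noteq> c" if "x \<in> {a..b}" "\<bar>x - x0\<bar> < min e1 e2" for x
      using e1(2) e2(2)[of x] that by (auto simp: less_Suc_eq abs_minus_commute)
    then show ?case using e1(1) e2(1) by (intro exI[of _ "min e1 e2"]) auto
  qed (auto intro: exI[of _ 1])
  then show thesis using that by blast
qed

text \<open>Where \<open>g x \<le> z\<close>, the point \<open>x\<close> keeps away from
  \<open>c\<close>, so \<open>g1\<close> is at least \<open>\<kappa>\<close> in absolute value and
  \<open>K = B / \<kappa>\<close> bounds its logarithmic derivative. Difference quotients on a
  common interval then differ at most by the factor \<open>exp (K * (s - p))\<close>. Products in
  place of quotients admit degenerate segments.\<close>

lemma (in expanding_unimodal) bounded_distortion:
  assumes "z < g c"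
  obtains K where "0 \<le> K" "\<And>p s u1 v1 u2 v2. {p..s} \<subseteq> {a..b} \<Longrightarrow> (\<And>x. x \<in> {p..s} \<Longrightarrow> g x \<le> z) \<Longrightarrow>
     {u1, v1, u2, v2} \<subseteq> {p..s} \<Longrightarrow> \<bar>g u1 - g v1\<bar> * \<bar>u2 - v2\<bar> \<le> exp (K * (s - p)) * (\<bar>g u2 - g v2\<bar> * \<bar>u1 - v1\<bar>)"
proof -
  define R where "R = {x \<in> {a..b}. g x \<le> z}"
  have "R = {a..b} \<inter> g -` {..z}" by (auto simp: R_def)
  then have "closed R" using continuous_closed_preimage[OF cont] by auto
  then have "compact R" by (metis R_def bounded_closed_interval bounded_subset compact_eq_bounded_closed mem_Collect_eq subsetI)
  have cR: "c \<notin> R" using assms by (simp add: R_def)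
  have cont1: "continuous_on {a..b} g1"
    using deriv2 by (intro DERIV_continuous_on) auto
  obtain \<kappa> where \<kappa>: "0 < \<kappa>" "\<And>x. x \<in> R \<Longrightarrow> \<kappa> \<le> \<bar>g1 x\<bar>"
  proof (cases "R = {}")
    case False
    have "continuous_on R (\<lambda>x. \<bar>g1 x\<bar>)"
      by (intro continuous_intros continuous_on_subset[OF cont1]) (auto simp: R_def)
    then obtain x0 where "x0 \<in> R" "\<forall>x\<in>R. \<bar>g1 x0\<bar> \<le> \<bar>g1 x\<bar>"
      using continuous_attains_inf[OF \<open>compact R\<close> False] by blast
    then show ?thesis using that[of "\<bar>g1 x0\<bar>"] deriv1_nz[of x0] cR by (force simp: R_def)
  qed (use that[of 1] in auto)
  obtain B where B: "0 < B" "\<And>x. x \<in> {a..b} \<Longrightarrow> \<bar>g2 x\<bar> \<le> B"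
    using compact_imp_bounded[OF compact_continuous_image[OF cont2 compact_Icc]]
    unfolding bounded_pos by auto
  define K where "K = B / \<kappa>"
  have K: "0 \<le> K" using B \<kappa> by (simp add: K_def)
  have mvt: "\<exists>\<xi>\<in>{p..s}. f u - f v = f1 \<xi> * (u - v)"
    if sub: "{p..s} \<subseteq> {a..b}" and uv: "u \<in> {p..s}" "v \<in> {p..s}"
      and d: "\<And>x. x \<in> {a..b} \<Longrightarrow> (f has_real_derivative f1 x) (at x within {a..b})" for p s u v f f1
  proof -
    have *: "\<exists>\<xi>\<in>{p..s}. f u - f v = f1 \<xi> * (u - v)" if "u < v" "u \<in> {p..s}" "v \<in> {p..s}" for u v
    proof -
      have uv: "{u..v} \<subseteq> {a..b}" using sub that by auto
      have "(f has_derivative (*) (f1 x)) (at x within {u..v})" if "u \<le> x" "x \<le> v" for x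
        using has_derivative_subset[OF d[unfolded has_field_derivative_def] uv] that uv by auto
      then obtain \<xi> where "\<xi> \<in> {u<..<v}" "f v - f u = f1 \<xi> * (v - u)"
        using mvt_simple[OF \<open>u < v\<close>, of f "\<lambda>x. (*) (f1 x)"] by auto
      then show ?thesis using that by (intro bexI[of _ \<xi>]) (auto simp: algebra_simps)
    qed
    show ?thesis
    proof (cases u v rule: linorder_cases)
      case greater
      then obtain \<xi> where "\<xi> \<in> {p..s}" "f v - f u = f1 \<xi> * (v - u)" using *[of v u] uv by auto
      then show ?thesis by (intro bexI[of _ \<xi>]) (auto simp: algebra_simps)
    qed (use * uv in auto)
  qed
  show thesis
  proof (rule that[OF K])
    fix p s u1 v1 u2 v2
    assume sub: "{p..s} \<subseteq> {a..b}" and reg: "\<And>x. x \<in> {p..s} \<Longrightarrow> g x \<le> z" and uv: "{u1, v1, u2, v2} \<subseteq> {p..s}"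
    obtain \<xi>1 where 1: "\<xi>1 \<in> {p..s}" "g u1 - g v1 = g1 \<xi>1 * (u1 - v1)" using mvt[OF sub, of u1 v1 g g1] uv deriv1 by auto
    obtain \<xi>2 where 2: "\<xi>2 \<in> {p..s}" "g u2 - g v2 = g1 \<xi>2 * (u2 - v2)" using mvt[OF sub, of u2 v2 g g1] uv deriv1 by auto
    obtain \<zeta> where 3: "\<zeta> \<in> {p..s}" "g1 \<xi>1 - g1 \<xi>2 = g2 \<zeta> * (\<xi>1 - \<xi>2)" using mvt[OF sub 1(1) 2(1), of g1 g2] deriv2 by auto
    have "\<xi>2 \<in> R" using 2 sub reg by (auto simp: R_def)
    then have \<kappa>2: "\<kappa> \<le> \<bar>g1 \<xi>2\<bar>" using \<kappa> by auto
    have "\<bar>g1 \<xi>1 - g1 \<xi>2\<bar> \<le> B * (s - p)"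
      unfolding 3 abs_mult by (intro mult_mono) (use B 3 1 2 sub in auto)
    also have "\<dots> = K * (s - p) * \<kappa>" using \<kappa> by (simp add: K_def)
    also have "\<dots> \<le> K * (s - p) * \<bar>g1 \<xi>2\<bar>" using \<kappa>2 K 1 by (intro mult_left_mono mult_nonneg_nonneg) auto
    finally have "\<bar>g1 \<xi>1\<bar> \<le> (1 + K * (s - p)) * \<bar>g1 \<xi>2\<bar>" by (simp add: algebra_simps)
    also have "\<dots> \<le> exp (K * (s - p)) * \<bar>g1 \<xi>2\<bar>" by (intro mult_right_mono exp_ge_add_one_self) auto
    finally have "\<bar>g1 \<xi>1\<bar> * (\<bar>u1 - v1\<bar> * \<bar>u2 - v2\<bar>) \<le> exp (K * (s - p)) * \<bar>g1 \<xi>2\<bar> * (\<bar>u1 - v1\<bar> * \<bar>u2 - v2\<bar>)"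
      by (intro mult_right_mono) auto
    then show "\<bar>g u1 - g v1\<bar> * \<bar>u2 - v2\<bar> \<le> exp (K * (s - p)) * (\<bar>g u2 - g v2\<bar> * \<bar>u1 - v1\<bar>)"
      unfolding 1 2 abs_mult by (simp add: algebra_simps)
  qed
qed

lemma sum_lengths_disjoint_segments_le:
  fixes l r :: "nat \<Rightarrow> real"
  assumes "\<And>j. l j \<in> {a..b}" "\<And>j. r j \<in> {a..b}"
    and disj: "\<And>i j. i \<noteq> j \<Longrightarrow> closed_segment (l i) (r i) \<inter> closed_segment (l j) (r j) = {}"
  shows "(\<Sum>j<k. \<bar>l j - r j\<bar>) \<le> b - a"
proof -
  let ?A = "\<lambda>j. closed_segment (l j) (r j)"
  have A: "?A j = {min (l j) (r j)..max (l j) (r j)}" for j by (auto simp: closed_segment_eq_real_ivl)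
  have m: "measure lborel (?A j) = \<bar>l j - r j\<bar>" for j unfolding A by (auto simp: min_def max_def)
  have "(\<Sum>j<k. \<bar>l j - r j\<bar>) = (\<Sum>j<k. measure lborel (?A j))" by (simp add: m)
  also have "\<dots> = measure lborel (\<Union>j<k. ?A j)"
    by (rule measure_finite_Union[symmetric]) (use disj in \<open>auto simp: A disjoint_family_on_def\<close>)
  also have "\<dots> \<le> measure lborel {a..b}"
  proof (rule measure_mono_fmeasurable)
    show "(\<Union>j<k. ?A j) \<subseteq> {a..b}" using assms(1,2) by (intro UN_least closed_segment_subset) auto
    show "{a..b} \<in> fmeasurable lborel" using fmeasurable_cbox[of a b] by (simp add: cbox_interval)
  qed (auto simp: A)
  also have "\<dots> = b - a" using assms(1)[of 0] by auto
  finally show ?thesis .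
qed

locale attracted_unimodal = expanding_unimodal +
  fixes m :: nat and y w :: real
  assumes m: "0 < m" and ay: "a \<le> y" and yw: "y < w" and wc: "w \<le> g c" and w_fix: "(g ^^ m) w = w"
    and V_maps: "(g ^^ m) ` {y..g c} \<subseteq> {y..g c}"
    and V_conv: "\<And>\<epsilon>. 0 < \<epsilon> \<Longrightarrow> \<exists>K. \<forall>k\<ge>K. \<forall>x\<in>{y..g c}. \<bar>(g ^^ (m * k)) x - w\<bar> < \<epsilon>"
begin

text \<open>As \<open>g c\<close> is the maximum of \<open>g\<close>, a point above \<open>y\<close>
  at a positive time lies in the trap \<open>{y..g c}\<close>. The strict inequality makes
  \<open>G\<close> relatively open.\<close>

definition G :: "real set" where
  "G = {x \<in> {a..b}. \<exists>k>0. y < (g ^^ k) x}"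

lemma w_in: "w \<in> {a..b}" using ay yw wc gc_in by auto

lemma G_tendsto:
  assumes "x \<in> {a..b}" "0 < k" "y < (g ^^ k) x"
  shows "(\<lambda>j. (g ^^ (k + m * j)) x) \<longlonglongrightarrow> w"
proof (rule LIMSEQ_I)
  fix e :: real assume "0 < e"
  then obtain K where K: "\<forall>k\<ge>K. \<forall>x\<in>{y..g c}. \<bar>(g ^^ (m * k)) x - w\<bar> < e" using V_conv by blast
  have "(g ^^ k) x \<in> {y..g c}" using assms iter_le_gc by auto
  then have "\<forall>j\<ge>K. norm ((g ^^ (k + m * j)) x - w) < e" using K by (simp add: funpow_add add.commute[of k])
  then show "\<exists>K. \<forall>j\<ge>K. norm ((g ^^ (k + m * j)) x - w) < e" by blast
qed

text \<open>After its entry into the trap the orbit comes close to \<open>w\<close> again and again;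
  the freedom to choose a late time is what makes \<open>G\<close> invariant under
  \<open>g\<close>.\<close>

lemma G_above:
  assumes "x \<in> G" "z < w"
  obtains k where "K < k" "z < (g ^^ k) x"
proof -
  obtain k where k: "x \<in> {a..b}" "0 < k" "y < (g ^^ k) x" using assms by (auto simp: G_def)
  have "\<forall>\<^sub>F j in sequentially. z < (g ^^ (k + m * j)) x" using order_tendstoD(1)[OF G_tendsto[OF k] assms(2)] .
  then obtain J where J: "\<And>j. j \<ge> J \<Longrightarrow> z < (g ^^ (k + m * j)) x" by (auto simp: eventually_sequentially)
  have "K * 1 \<le> m * (J + K)" using m by (simp add: add_mult_distrib2 mult.commute trans_le_add2)
  then show thesis using that[of "k + m * (J + K)"] J[of "J + K"] k(2) by auto
qed

lemma G_step: "x \<in> {a..b} \<Longrightarrow> g x \<in> G \<longleftrightarrow> x \<in> G"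
proof
  assume x: "x \<in> {a..b}" and "g x \<in> G"
  then obtain k where "0 < k" "y < (g ^^ k) (g x)" by (auto simp: G_def)
  then have "y < (g ^^ Suc k) x" by (simp only: funpow_Suc_right o_apply)
  then show "x \<in> G" using x unfolding G_def by blast
next
  assume x: "x \<in> {a..b}" and "x \<in> G"
  then obtain k where k: "1 < k" "y < (g ^^ k) x" using G_above[of x y 1] yw by auto
  then obtain k' where "k = Suc k'" "0 < k'" by (cases k) auto
  then have "y < (g ^^ k') (g x)" using k by (simp only: funpow_Suc_right o_apply)
  then show "g x \<in> G" using g_in[OF x] \<open>0 < k'\<close> unfolding G_def by blast
qed

lemma G_iter: "x \<in> {a..b} \<Longrightarrow> (g ^^ i) x \<in> G \<longleftrightarrow> x \<in> G"
  by (induction i) (auto simp: G_step[OF iter_in])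

text \<open>The level \<open>z\<close> may lie above \<open>y\<close>. This margin permits an
  interval outside \<open>G\<close> to be enlarged without entering \<open>G\<close>.\<close>

lemma not_in_G_if_bounded:
  assumes "z < w" "\<And>k. 0 < k \<Longrightarrow> (g ^^ k) x \<le> z"
  shows "x \<notin> G"
proof
  assume "x \<in> G"
  then obtain k where "0 < k" "z < (g ^^ k) x" using G_above[of x z 0] assms(1) by metis
  then show False using assms(2)[of k] by simp
qed

lemma not_in_G_le: "x \<in> {a..b} \<Longrightarrow> x \<notin> G \<Longrightarrow> 0 < k \<Longrightarrow> (g ^^ k) x \<le> y"
  unfolding G_def by (metis (mono_tags, lifting) mem_Collect_eq not_le)

lemma G_sub: "G \<subseteq> {a..b}" by (auto simp: G_def)

lemma c_G: "c \<in> G" using ac cb yw wc by (auto simp: G_def intro!: exI[of _ 1])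

lemma a_G: "a \<notin> G" using ay by (auto simp: G_def iter_a not_less)

lemma b_G: "b \<notin> G"
  using G_step[of b] gb a_G ac cb by auto

lemma w_G: "w \<in> G" using w_in m w_fix yw by (auto simp: G_def)

lemma G_open: "openin (top_of_set {a..b}) G"
proof -
  have "G = (\<Union>k\<in>{0<..}. {a..b} \<inter> (g ^^ k) -` {y<..})" by (auto simp: G_def)
  moreover have "openin (top_of_set {a..b}) ({a..b} \<inter> (g ^^ k) -` {y<..})" for k
    using iter_cont by (rule continuous_openin_preimage_gen) auto
  then have "openin (top_of_set {a..b}) (\<Union>k\<in>{0<..}. {a..b} \<inter> (g ^^ k) -` {y<..})"
    by (intro openin_Union) auto
  ultimately show ?thesis by (simp only:)
qed

lemma compl_G_compact: "compact ({a..b} - G)"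
proof -
  have "closedin (top_of_set {a..b}) ({a..b} - G)" using G_open by (simp add: closedin_def Diff_Diff_Int inf_absorb2 G_sub)
  then show ?thesis using closedin_compact_eq[of "{a..b}"] by auto
qed

text \<open>Along multiples of \<open>m\<close> the orbit settles at one point of the cycle of
  \<open>w\<close>; the residue of the entry time decides which one, and \<open>?t\<close> completes
  that time to a multiple of \<open>m\<close>.\<close>

lemma G_limit:
  assumes "x \<in> G"
  obtains t where "(\<lambda>j. (g ^^ (m * j)) x) \<longlonglongrightarrow> (g ^^ t) w"
proof -
  obtain k where k: "x \<in> {a..b}" "0 < k" "y < (g ^^ k) x" using assms by (auto simp: G_def)
  let ?t = "m * k - k"
  have tk: "?t + k = m * k" using m by auto
  have "(\<lambda>j. (g ^^ ?t) ((g ^^ (k + m * j)) x)) \<longlonglongrightarrow> (g ^^ ?t) w"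
    using iter_cont[of ?t] G_tendsto[OF k] w_in iter_in[OF k(1)]
    unfolding continuous_on_sequentially by (auto simp: o_def)
  moreover have "(g ^^ ?t) ((g ^^ (k + m * j)) x) = (g ^^ (m * (j + k))) x" for j
    using tk by (metis funpow_add o_apply add.assoc add.commute distrib_left)
  ultimately have "(\<lambda>j. (g ^^ (m * (j + k))) x) \<longlonglongrightarrow> (g ^^ ?t) w" by simp
  then show thesis using that LIMSEQ_offset[of "\<lambda>j. (g ^^ (m * j)) x" k] by blast
qed

lemma w_orbit_G: "(g ^^ t) w \<in> G" using G_iter[OF w_in] w_G by simp

text \<open>Along common multiples of \<open>k\<close> and \<open>m\<close> the orbit also tends to
  a point of the cycle of \<open>w\<close>, and this cycle lies in \<open>G\<close>.\<close>

lemma not_attracting: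
  assumes "x \<in> G" "v \<notin> G" "0 < k"
  shows "\<not> (\<lambda>j. ((g ^^ k) ^^ j) x) \<longlonglongrightarrow> v"
proof
  assume lim: "(\<lambda>j. ((g ^^ k) ^^ j) x) \<longlonglongrightarrow> v"
  obtain t where t: "(\<lambda>j. (g ^^ (m * j)) x) \<longlonglongrightarrow> (g ^^ t) w" using G_limit[OF assms(1)] .
  have "strict_mono (\<lambda>j. m * j)" "strict_mono (\<lambda>j. k * j)" using m assms by (auto simp: strict_mono_def)
  then have "(\<lambda>j. ((g ^^ k) ^^ (m * j)) x) \<longlonglongrightarrow> v" "(\<lambda>j. (g ^^ (m * (k * j))) x) \<longlonglongrightarrow> (g ^^ t) w"
    using LIMSEQ_subseq_LIMSEQ[OF lim] LIMSEQ_subseq_LIMSEQ[OF t] by (auto simp: o_def)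
  moreover have "((g ^^ k) ^^ (m * j)) x = (g ^^ (m * (k * j))) x" for j
    by (simp add: funpow_mult mult.left_commute)
  ultimately show False using LIMSEQ_unique w_orbit_G[of t] assms(2) by auto
qed

text \<open>A one-sided criterion: \<open>v\<close> is an end of \<open>{l..u}\<close> and all other
  points move towards it. It yields the contradiction at the ends of components of the complement,
  where points of \<open>G\<close> accumulate.\<close>

lemma no_attracting_fixpoint:
  assumes k: "0 < k" and lu: "l < u" "{l..u} \<subseteq> {a..b}" and v: "v = l \<or> v = u" "v \<notin> G" "(g ^^ k) v = v"
    and mono: "\<And>x z. l \<le> x \<Longrightarrow> x < z \<Longrightarrow> z \<le> u \<Longrightarrow> (g ^^ k) x < (g ^^ k) z"
    and toward: "\<And>x. x \<in> {l..u} \<Longrightarrow> x \<noteq> v \<Longrightarrow> (v = u \<longrightarrow> x < (g ^^ k) x) \<and> (v = l \<longrightarrow> (g ^^ k) x < x)"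
    and x: "x \<in> {l..u}" "x \<in> G"
  shows False
proof -
  let ?f = "g ^^ k"
  have maps: "?f ` {l..u} \<subseteq> {l..u}"
  proof clarify
    fix x assume "x \<in> {l..u}"
    then show "?f x \<in> {l..u}"
      using toward[of x] mono[of l x] mono[of x u] v lu by (cases "x = v") force+
  qed
  have "\<exists>K. \<forall>j\<ge>K. \<forall>x\<in>{l..u}. \<bar>(?f ^^ j) x - v\<bar> < \<epsilon>" if "0 < \<epsilon>" for \<epsilon>
  proof (rule iterates_tendsto_unique_fixpoint)
    show "continuous_on {l..u} ?f" using continuous_on_subset[OF iter_cont lu(2)] .
    show "?f x \<le> ?f z" if "l \<le> x" "x \<le> z" "z \<le> u" for x z using mono[of x z] that by (cases "x = z") auto
    show "x = v" if "l \<le> x" "x \<le> u" "?f x = x" for x using toward[of x] that v by force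
  qed (use lu maps that in auto)
  then have "(\<lambda>j. (?f ^^ j) x) \<longlonglongrightarrow> v" unfolding LIMSEQ_def dist_real_def using x by blast
  then show False using not_attracting[OF x(2) v(2) k] by blast
qed

end

section \<open>The complement of the basin\<close>

lemma between_if_monotone:
  fixes f :: "real \<Rightarrow> real"
  assumes m: "(\<forall>x\<in>S. \<forall>y\<in>S. x < y \<longrightarrow> f x < f y) \<or> (\<forall>x\<in>S. \<forall>y\<in>S. x < y \<longrightarrow> f y < f x)"
    and S: "t1 \<in> S" "t2 \<in> S" "t3 \<in> S" and t: "t1 \<le> t2" "t2 \<le> t3"
  shows "min (f t1) (f t3) \<le> f t2 \<and> f t2 \<le> max (f t1) (f t3)"
  using m
proof
  assume *: "\<forall>x\<in>S. \<forall>y\<in>S. x < y \<longrightarrow> f x < f y"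
  have "f t1 \<le> f t2" "f t2 \<le> f t3"
    using *[rule_format, OF S(1,2)] *[rule_format, OF S(2,3)] t by (auto simp: le_less)
  then show ?thesis by auto
next
  assume *: "\<forall>x\<in>S. \<forall>y\<in>S. x < y \<longrightarrow> f y < f x"
  have "f t2 \<le> f t1" "f t3 \<le> f t2"
    using *[rule_format, OF S(1,2)] *[rule_format, OF S(2,3)] t by (auto simp: le_less)
  then show ?thesis by auto
qed

context attracted_unimodal
begin

lemma compl_iter:
  assumes "S \<subseteq> {a..b} - G"
  shows "(g ^^ k) ` S \<subseteq> {a..b} - G"
  using assms G_iter iter_in by blast

lemma compl_one_sided:
  assumes "connected S" "S \<subseteq> {a..b} - G"
  shows "one_sided ((g ^^ k) ` S)"
proof (rule one_sided_if_avoids)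
  show "connected ((g ^^ k) ` S)"
    using connected_continuous_image[OF continuous_on_subset[OF iter_cont] assms(1)] assms(2) by blast
qed (use compl_iter[OF assms(2), of k] c_G in auto)

text \<open>A Denjoy-type argument. Disjointness bounds the sum of the lengths \<open>Len j\<close>
  by \<open>b - a\<close>, and hence the distortion along the whole orbit. The margins
  \<open>ex k\<close>, measured against \<open>Len k\<close>, thus stay small forever, and the
  images of the enlarged interval stay close to points outside \<open>G\<close>. Closeness and the
  distortion estimate justify each other, so one induction proves both.\<close>

lemma wandering_extends:
  assumes lr: "l < r" and sub: "{l..r} \<subseteq> {a..b} - G"
    and disj: "\<And>i j. i \<noteq> j \<Longrightarrow> (g ^^ i) ` {l..r} \<inter> (g ^^ j) ` {l..r} = {}"
  obtains \<eta> where "0 < \<eta>" "\<And>l' r'. a \<le> l' \<Longrightarrow> l' \<le> l \<Longrightarrow> r \<le> r' \<Longrightarrow> r' \<le> b \<Longrightarrow> (l - l') + (r' - r) \<le> \<eta> \<Longrightarrow>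
     {l'..r'} \<inter> G = {}"
proof -
  \<comment> \<open>This level leaves room above \<open>y\<close>, the bound for orbits outside
    \<open>G\<close>, and is still below both \<open>w\<close> and \<open>g c\<close>.\<close>
  define z where "z = (y + w) / 2"
  have z: "y < z" "z < w" "z < g c" using yw wc by (auto simp: z_def)
  obtain K where K: "0 \<le> K" "\<And>p s u1 v1 u2 v2. {p..s} \<subseteq> {a..b} \<Longrightarrow> (\<And>x. x \<in> {p..s} \<Longrightarrow> g x \<le> z) \<Longrightarrow>
     {u1, v1, u2, v2} \<subseteq> {p..s} \<Longrightarrow> \<bar>g u1 - g v1\<bar> * \<bar>u2 - v2\<bar> \<le> exp (K * (s - p)) * (\<bar>g u2 - g v2\<bar> * \<bar>u1 - v1\<bar>)"
    using bounded_distortion[OF z(3)] by metis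
  obtain \<delta> where \<delta>: "0 < \<delta>" "\<And>x x'. x \<in> {a..b} \<Longrightarrow> x' \<in> {a..b} \<Longrightarrow> \<bar>x' - x\<bar> < \<delta> \<Longrightarrow> \<bar>g x' - g x\<bar> < z - y"
    using compact_uniformly_continuous[OF cont compact_Icc] z
    unfolding uniformly_continuous_on_def dist_real_def by (metis diff_gt_0_iff_gt)
  have "l \<in> {l..r}" "r \<in> {l..r}" using lr by auto
  then have lr_in: "l \<in> {a..b}" "r \<in> {a..b}" using sub by blast+
  define Len where "Len = (\<lambda>j. \<bar>(g ^^ j) l - (g ^^ j) r\<bar>)"
  have Len_pos: "0 < Len j" for j
  proof -
    have "one_sided ((g ^^ i) ` {l..r})" for i by (rule compl_one_sided[OF _ sub]) simp
    moreover have "l \<in> {l..r}" "r \<in> {l..r}" using lr by auto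
    ultimately have "(g ^^ j) l < (g ^^ j) r \<or> (g ^^ j) r < (g ^^ j) l"
      using iter_monotone[of j "{l..r}"] lr by blast
    then show ?thesis by (auto simp: Len_def)
  qed
  have seg: "closed_segment ((g ^^ j) l) ((g ^^ j) r) \<subseteq> (g ^^ j) ` {l..r}" for j
  proof -
    have "connected ((g ^^ j) ` {l..r})"
      using sub by (intro connected_continuous_image continuous_on_subset[OF iter_cont]) auto
    then have "convex ((g ^^ j) ` {l..r})" using is_interval_connected_1 is_interval_convex_1 by blast
    then show ?thesis using lr by (intro closed_segment_subset) auto
  qed
  have sum_le: "(\<Sum>j<k. Len j) \<le> b - a" for k
    unfolding Len_def
  proof (rule sum_lengths_disjoint_segments_le)
    show "closed_segment ((g ^^ i) l) ((g ^^ i) r) \<inter> closed_segment ((g ^^ j) l) ((g ^^ j) r) = {}" if "i \<noteq> j" for i j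
      using disj[OF that] seg[of i] seg[of j] by blast
  qed (rule iter_in lr_in)+
  have Len_le: "Len j \<le> b - a" for j
    using sum_le[of "Suc j"] sum_nonneg[of "{..<j}" Len] Len_pos by (simp add: less_imp_le)
  have ba: "0 < b - a" using ac cb by simp
  \<comment> \<open>Bound for the total distortion; the factor 2 arises because an enlarged image is
    at most twice as long as the original one.\<close>
  define E where "E = exp (2 * K * (b - a))"
  \<comment> \<open>The bound 1 keeps the margins below \<open>Len k\<close>; the other one keeps
    them within the range \<open>\<delta>\<close> of uniform continuity.\<close>
  define \<theta> where "\<theta> = min 1 (\<delta> / 2 / (b - a))"
  have E: "0 < E" by (simp add: E_def)
  have \<theta>: "0 < \<theta>" "\<theta> \<le> 1" using \<delta> ba by (auto simp: \<theta>_def)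
  have \<theta>\<delta>: "\<theta> * (b - a) < \<delta>"
  proof -
    have "\<theta> * (b - a) \<le> \<delta> / 2 / (b - a) * (b - a)" using ba by (intro mult_right_mono) (auto simp: \<theta>_def)
    also have "\<dots> = \<delta> / 2" using nonzero_eq_divide_eq[of "b - a" "\<delta> / 2 / (b - a)" "\<delta> / 2"] ba by auto
    finally show ?thesis using \<delta> by simp
  qed
  show thesis
  proof (rule that[of "\<theta> * (r - l) / E"])
    show "0 < \<theta> * (r - l) / E" using \<theta> E lr by simp
    fix l' r' assume ends: "a \<le> l'" "l' \<le> l" "r \<le> r'" "r' \<le> b" and small: "(l - l') + (r' - r) \<le> \<theta> * (r - l) / E"
    define ex where "ex = (\<lambda>k. \<bar>(g ^^ k) l' - (g ^^ k) l\<bar> + \<bar>(g ^^ k) r' - (g ^^ k) r\<bar>)"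
    have S_in: "{l'..r'} \<subseteq> {a..b}" using ends by auto
    have P: "(\<forall>i<k. \<forall>x\<in>{l'..r'}. g ((g ^^ i) x) \<le> z) \<and>
        ex k * (r - l) \<le> exp (2 * K * (\<Sum>j<k. Len j)) * ex 0 * Len k" for k
    proof (induction k)
      case 0
      show ?case using lr by (simp add: Len_def)
    next
      case (Suc k)
      have conn: "connected ((g ^^ i) ` {l'..r'})" for i
        by (intro connected_continuous_image continuous_on_subset[OF iter_cont S_in]) auto
      have "one_sided ((g ^^ i) ` {l'..r'})" if i: "i < k" for i
      proof (rule one_sided_if_avoids[OF conn])
        show "(g ^^ i) ` {l'..r'} \<subseteq> {a..b}" using iter_in S_in by blast
        show "c \<notin> (g ^^ i) ` {l'..r'}"
        proof
          assume "c \<in> (g ^^ i) ` {l'..r'}"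
          then have "g c \<le> z" using Suc i by blast
          then show False using z by simp
        qed
      qed
      then have mono: "(\<forall>x\<in>{l'..r'}. \<forall>y\<in>{l'..r'}. x < y \<longrightarrow> (g ^^ k) x < (g ^^ k) y) \<or>
          (\<forall>x\<in>{l'..r'}. \<forall>y\<in>{l'..r'}. x < y \<longrightarrow> (g ^^ k) y < (g ^^ k) x)" by (rule iter_monotone)
      have "ex k * (r - l) \<le> exp (2 * K * (\<Sum>j<k. Len j)) * ex 0 * Len k" using Suc by simp
      also have "\<dots> \<le> E * (\<theta> * (r - l) / E) * Len k"
        unfolding E_def using small Len_pos[of k] K(1) sum_le[of k] ends
        by (intro mult_right_mono mult_mono) (auto simp: ex_def mult_left_mono E_def)
      also have "\<dots> = \<theta> * Len k * (r - l)" using E by simp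
      finally have ex_le: "ex k \<le> \<theta> * Len k" using lr by simp
      then have ex_le': "ex k \<le> Len k" using \<theta> Len_pos[of k]
        by (meson mult_left_le_one_le less_imp_le order_trans)
      have "\<theta> * Len k \<le> \<theta> * (b - a)" using \<theta> Len_le by (intro mult_left_mono) auto
      then have ex_\<delta>: "ex k < \<delta>" using ex_le \<theta>\<delta> by simp
      have bound: "g ((g ^^ k) x) \<le> z" if x: "x \<in> {l'..r'}" for x
      proof -
        have "\<exists>x0\<in>{l..r}. \<bar>(g ^^ k) x - (g ^^ k) x0\<bar> \<le> ex k"
        proof -
          consider (1) "x < l" | (2) "r < x" | (3) "x \<in> {l..r}" by force
          then show ?thesis
          proof cases
            case 1
            have "l \<in> {l'..r'}" "l' \<in> {l'..r'}" using ends lr by auto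
            then have "\<bar>(g ^^ k) x - (g ^^ k) l\<bar> \<le> \<bar>(g ^^ k) l' - (g ^^ k) l\<bar>"
              using between_if_monotone[OF mono, of l' x l] x 1 by (auto simp: min_def max_def split: if_splits)
            then show ?thesis using lr by (intro bexI[of _ l]) (auto simp: ex_def)
          next
            case 1: 2
            have "r \<in> {l'..r'}" "r' \<in> {l'..r'}" using ends lr by auto
            then have "\<bar>(g ^^ k) x - (g ^^ k) r\<bar> \<le> \<bar>(g ^^ k) r' - (g ^^ k) r\<bar>"
              using between_if_monotone[OF mono, of r x r'] x 1 by (auto simp: min_def max_def split: if_splits)
            then show ?thesis using lr by (intro bexI[of _ r]) (auto simp: ex_def)
          next
            case 3
            then show ?thesis by (intro bexI[of _ x]) (auto simp: ex_def)
          qed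
        qed
        then obtain x0 where x0: "x0 \<in> {l..r}" "\<bar>(g ^^ k) x - (g ^^ k) x0\<bar> < \<delta>" using ex_\<delta> by force
        have "x0 \<in> {a..b}" "x0 \<notin> G" "x \<in> {a..b}" using x0 sub S_in x by auto
        then have "\<bar>g ((g ^^ k) x) - g ((g ^^ k) x0)\<bar> < z - y" "g ((g ^^ k) x0) \<le> y"
          using \<delta>(2)[OF iter_in iter_in x0(2)] not_in_G_le[of x0 "Suc k"] by auto
        then show ?thesis by linarith
      qed
      define p s where "p = min ((g ^^ k) l') ((g ^^ k) r')" "s = max ((g ^^ k) l') ((g ^^ k) r')"
      have l'r': "l' \<le> r'" using ends lr by simp
      then have ps_sub: "{p..s} \<subseteq> (g ^^ k) ` {l'..r'}"
        unfolding p_s_def using connected_contains_Icc[OF conn[of k], of "(g ^^ k) l'" "(g ^^ k) r'"]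
          connected_contains_Icc[OF conn[of k], of "(g ^^ k) r'" "(g ^^ k) l'"]
        by (auto simp: min_def max_def)
      have in_ps: "(g ^^ k) x \<in> {p..s}" if x: "x \<in> {l'..r'}" for x
      proof -
        have "l' \<in> {l'..r'}" "r' \<in> {l'..r'}" using l'r' by auto
        then show ?thesis using between_if_monotone[OF mono, of l' x r'] x unfolding p_s_def by auto
      qed
      have sp: "s - p \<le> 2 * Len k"
      proof -
        have "s - p = \<bar>(g ^^ k) l' - (g ^^ k) r'\<bar>" by (auto simp: p_s_def)
        also have "\<dots> \<le> ex k + Len k" unfolding ex_def Len_def by linarith
        finally show ?thesis using ex_le' by simp
      qed
      have four: "(g ^^ k) l' \<in> {p..s}" "(g ^^ k) r' \<in> {p..s}" "(g ^^ k) l \<in> {p..s}" "(g ^^ k) r \<in> {p..s}"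
        using in_ps l'r' ends lr by auto
      have ps_ab: "{p..s} \<subseteq> {a..b}" "\<And>x. x \<in> {p..s} \<Longrightarrow> g x \<le> z"
        using ps_sub bound iter_in S_in by blast+
      have d: "\<bar>g u - g v\<bar> * Len k \<le> exp (K * (s - p)) * (Len (Suc k) * \<bar>u - v\<bar>)" if "u \<in> {p..s}" "v \<in> {p..s}" for u v
        using K(2)[OF ps_ab, of u v "(g ^^ k) l" "(g ^^ k) r"] that four by (simp add: Len_def)
      have "ex (Suc k) * Len k \<le> exp (K * (s - p)) * (Len (Suc k) * ex k)"
        using d[OF four(1,3)] d[OF four(2,4)] by (simp add: ex_def algebra_simps)
      also have "\<dots> \<le> exp (K * (2 * Len k)) * (Len (Suc k) * ex k)"
        using sp K(1) Len_pos[of "Suc k"] by (intro mult_right_mono mult_nonneg_nonneg) (auto simp: ex_def mult_left_mono)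
      finally have "ex (Suc k) * Len k * (r - l) \<le> exp (K * (2 * Len k)) * (Len (Suc k) * ex k) * (r - l)"
        using lr by (intro mult_right_mono) auto
      also have "\<dots> = exp (K * (2 * Len k)) * Len (Suc k) * (ex k * (r - l))" by simp
      also have "\<dots> \<le> exp (K * (2 * Len k)) * Len (Suc k) * (exp (2 * K * (\<Sum>j<k. Len j)) * ex 0 * Len k)"
        using Suc Len_pos[of "Suc k"] by (intro mult_left_mono) auto
      also have "\<dots> = (exp (2 * K * (\<Sum>j<Suc k. Len j)) * ex 0 * Len (Suc k)) * Len k"
        by (simp add: exp_add algebra_simps)
      finally have "(ex (Suc k) * (r - l)) * Len k \<le> (exp (2 * K * (\<Sum>j<Suc k. Len j)) * ex 0 * Len (Suc k)) * Len k"
        by (simp add: algebra_simps)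
      then have "ex (Suc k) * (r - l) \<le> exp (2 * K * (\<Sum>j<Suc k. Len j)) * ex 0 * Len (Suc k)"
        using Len_pos[of k] by simp
      moreover have "\<forall>i<Suc k. \<forall>x\<in>{l'..r'}. g ((g ^^ i) x) \<le> z" using Suc bound by (auto simp: less_Suc_eq)
      ultimately show ?case by blast
    qed
    have "x \<notin> G" if "x \<in> {l'..r'}" for x
    proof (rule not_in_G_if_bounded[OF z(2)])
      fix k :: nat assume "0 < k"
      then obtain k' where "k = Suc k'" by (cases k) auto
      then show "(g ^^ k) x \<le> z" using P[of k] that by auto
    qed
    then show "{l'..r'} \<inter> G = {}" by blast
  qed
qed

section \<open>Components of the complement of \<open>G\<close>\<close>

definition maximal_gap :: "real \<Rightarrow> real \<Rightarrow> bool" where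
  "maximal_gap l r \<longleftrightarrow> l \<le> r \<and> {l..r} \<subseteq> {a..b} - G \<and>
     (\<forall>l' r'. l' \<le> l \<longrightarrow> r \<le> r' \<longrightarrow> {l'..r'} \<subseteq> {a..b} - G \<longrightarrow> l' = l \<and> r' = r)"

lemma maximal_gapD:
  assumes "maximal_gap l r"
  shows "l \<le> r" "{l..r} \<subseteq> {a..b} - G" "\<And>l' r'. l' \<le> l \<Longrightarrow> r \<le> r' \<Longrightarrow> {l'..r'} \<subseteq> {a..b} - G \<Longrightarrow> l' = l \<and> r' = r"
  using assms unfolding maximal_gap_def by blast+

text \<open>The gap is a connected component, which is compact since the complement is. It may be a
  single point; the gap at \<open>a\<close> can be of this kind.\<close>

lemma maximal_gap_exists:
  assumes "p \<le> q" "{p..q} \<subseteq> {a..b} - G"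
  obtains l r where "maximal_gap l r" "{p..q} \<subseteq> {l..r}"
proof -
  define C where "C = connected_component_set ({a..b} - G) p"
  have pC: "p \<in> C" using assms by (auto simp: C_def)
  have "closed C" unfolding C_def using compl_G_compact by (intro closed_connected_component compact_imp_closed)
  have C_sub: "C \<subseteq> {a..b} - G" unfolding C_def by (rule connected_component_subset)
  then have "bounded C" by (meson Diff_subset bounded_closed_interval bounded_subset order_trans)
  then have "compact C" using \<open>closed C\<close> compact_eq_bounded_closed by blast
  moreover have "connected C" unfolding C_def by simp
  ultimately have C: "C = {Inf C..Sup C}" "Inf C \<le> Sup C" using compact_connected_real_eq_Icc pC by blast+
  have max: "T \<subseteq> C" if "connected T" "p \<in> T" "T \<subseteq> {a..b} - G" for T
    unfolding C_def using that by (intro connected_component_maximal)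
  show thesis
  proof (rule that[of "Inf C" "Sup C"])
    show "{p..q} \<subseteq> {Inf C..Sup C}" using max[of "{p..q}"] assms C by auto
    show "maximal_gap (Inf C) (Sup C)" unfolding maximal_gap_def
    proof (intro conjI allI impI)
      fix l' r' assume *: "l' \<le> Inf C" "Sup C \<le> r'" "{l'..r'} \<subseteq> {a..b} - G"
      have "p \<in> {Inf C..Sup C}" using pC C by blast
      then have "{l'..r'} \<subseteq> C" using * by (intro max) auto
      then have "{l'..r'} \<subseteq> {Inf C..Sup C}" using C by blast
      then show "l' = Inf C" "r' = Sup C" using * C(2) by auto
    qed (use C C_sub in auto)
  qed
qed

text \<open>The hull of two intervals that meet is their union, which is still outside
  \<open>G\<close>.\<close>

lemma maximal_gap_absorb:
  assumes "maximal_gap l r" "{p..q} \<subseteq> {a..b} - G" "{p..q} \<inter> {l..r} \<noteq> {}"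
  shows "{p..q} \<subseteq> {l..r}"
proof -
  have "{min l p..max r q} \<subseteq> {p..q} \<union> {l..r}" using assms(3) by (auto simp: min_def max_def split: if_splits)
  then have "{min l p..max r q} \<subseteq> {a..b} - G" using assms(2) maximal_gapD(2)[OF assms(1)] by blast
  then have "min l p = l" "max r q = r" using maximal_gapD(3)[OF assms(1), of "min l p" "max r q"] by auto
  then show ?thesis by auto
qed

lemma maximal_gap_eq:
  assumes "maximal_gap l r" "maximal_gap l' r'" "{l..r} \<inter> {l'..r'} \<noteq> {}"
  shows "l = l' \<and> r = r'"
  using maximal_gap_absorb[OF assms(1) maximal_gapD(2)[OF assms(2)]] maximal_gap_absorb[OF assms(2) maximal_gapD(2)[OF assms(1)]]
    assms(3) maximal_gapD(1)[OF assms(1)] maximal_gapD(1)[OF assms(2)] by auto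

lemma maximal_gap_image:
  assumes "maximal_gap l r"
  obtains l' r' where "maximal_gap l' r'" "(g ^^ k) ` {l..r} \<subseteq> {l'..r'}"
proof -
  note D = maximal_gapD[OF assms]
  have "a \<le> l" "r \<le> b" using D(1,2) by auto
  then obtain p q where pq: "p \<le> q" "(g ^^ k) ` {l..r} = {p..q}" using iter_image_Icc[OF D(1)] by metis
  then have "{p..q} \<subseteq> {a..b} - G" using compl_iter[OF D(2), of k] by simp
  then obtain l' r' where "maximal_gap l' r'" "{p..q} \<subseteq> {l'..r'}" using maximal_gap_exists[OF pq(1)] by metis
  then show thesis using that pq(2) by simp
qed

text \<open>If the gaps visited were pairwise disjoint, the first one would be wandering and could
  be enlarged, against maximality. So two of them coincide, and a gap that shares a point with its
  image gap is mapped into itself.\<close>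

lemma maximal_gap_recurs:
  assumes "l < r" "{l..r} \<subseteq> {a..b} - G"
  obtains k p L R where "maximal_gap L R" "(g ^^ k) ` {l..r} \<subseteq> {L..R}" "0 < p" "(g ^^ p) ` {L..R} \<subseteq> {L..R}"
proof -
  obtain l0 r0 where 0: "maximal_gap l0 r0" "{l..r} \<subseteq> {l0..r0}"
    using maximal_gap_exists[of l r] assms by auto
  note D0 = maximal_gapD[OF 0(1)]
  have lr0: "l0 < r0" using 0 assms by auto
  have "\<forall>k. \<exists>L R. maximal_gap L R \<and> (g ^^ k) ` {l0..r0} \<subseteq> {L..R}"
    using maximal_gap_image[OF 0(1)] by metis
  then obtain L R where LR: "\<And>k. maximal_gap (L k) (R k)" "\<And>k. (g ^^ k) ` {l0..r0} \<subseteq> {L k..R k}" by metis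
  have "\<exists>i j. i < j \<and> {L i..R i} \<inter> {L j..R j} \<noteq> {}"
  proof (rule ccontr)
    assume n: "\<not> ?thesis"
    have "(g ^^ i) ` {l0..r0} \<inter> (g ^^ j) ` {l0..r0} = {}" if "i \<noteq> j" for i j
      using n LR(2)[of i] LR(2)[of j] that by (cases i j rule: linorder_cases) blast+
    then obtain \<eta> where \<eta>: "0 < \<eta>" "\<And>l' r'. a \<le> l' \<Longrightarrow> l' \<le> l0 \<Longrightarrow> r0 \<le> r' \<Longrightarrow> r' \<le> b \<Longrightarrow> (l0 - l') + (r' - r0) \<le> \<eta> \<Longrightarrow>
       {l'..r'} \<inter> G = {}" using wandering_extends[OF lr0 D0(2)] by metis
    \<comment> \<open>Cutting off at \<open>a\<close> and \<open>b\<close> makes the enlargement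
      void only if the gap is all of \<open>{a..b}\<close>, which contains \<open>c\<close>.\<close>
    define l' r' where "l' = max a (l0 - \<eta> / 2)" "r' = min b (r0 + \<eta> / 2)"
    have in_ab: "a \<le> l0" "r0 \<le> b" using D0(1,2) by auto
    have l'r': "a \<le> l'" "l' \<le> l0" "r0 \<le> r'" "r' \<le> b" "(l0 - l') + (r' - r0) \<le> \<eta>"
      using in_ab \<eta>(1) by (auto simp: l'_r'_def)
    then have "{l'..r'} \<subseteq> {a..b} - G" using \<eta>(2) by fastforce
    then have "l' = l0 \<and> r' = r0" using D0(3) l'r' by blast
    then have "l0 = a" "r0 = b" using \<eta>(1) in_ab by (auto simp: l'_r'_def max_def min_def split: if_splits)
    then have "c \<in> {l0..r0}" using ac cb by auto
    then show False using D0(2) c_G by blast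
  qed
  then obtain i j where ij: "i < j" "{L i..R i} \<inter> {L j..R j} \<noteq> {}" by auto
  then have eq: "L i = L j" "R i = R j" using maximal_gap_eq[OF LR(1) LR(1)] by auto
  obtain L' R' where L'R': "maximal_gap L' R'" "(g ^^ (j - i)) ` {L i..R i} \<subseteq> {L'..R'}"
    using maximal_gap_image[OF LR(1)] by metis
  have "(g ^^ j) ` {l0..r0} = (g ^^ (j - i)) ` (g ^^ i) ` {l0..r0}"
    using ij(1) by (simp add: image_comp flip: funpow_add)
  then have "(g ^^ j) ` {l0..r0} \<subseteq> {L'..R'}" using L'R'(2) LR(2)[of i] by blast
  moreover have "(g ^^ j) ` {l0..r0} \<noteq> {}" using lr0 by auto
  ultimately have "{L'..R'} \<inter> {L j..R j} \<noteq> {}" using LR(2)[of j] by blast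
  then have "L' = L i" "R' = R i" using maximal_gap_eq[OF L'R'(1) LR(1)[of j]] eq by auto
  then have "(g ^^ (j - i)) ` {L i..R i} \<subseteq> {L i..R i}" using L'R'(2) by simp
  moreover have "(g ^^ i) ` {l..r} \<subseteq> {L i..R i}" using LR(2)[of i] 0(2) by blast
  ultimately show thesis using that[of "L i" "R i" i "j - i"] LR(1) ij(1) by simp
qed

end

section \<open>Gaps that return to themselves\<close>

context attracted_unimodal
begin

lemma maximal_gap_right_end:
  assumes M: "maximal_gap L R" and "R < b" "0 < e"
  obtains x where "x \<in> G" "R < x" "x < R + e"
proof (rule ccontr)
  note conclude = that
  assume "\<not> thesis"
  then have n: "x \<notin> G" if "R < x" "x < R + e" for x using conclude that by blast
  let ?r = "min b (R + e / 2)"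
  note D = maximal_gapD[OF M]
  have "x \<in> {a..b} - G" if x: "x \<in> {L..?r}" for x
  proof (cases "x \<le> R")
    case True
    then show ?thesis using x D(2) by (meson atLeastAtMost_iff subsetD)
  next
    case False
    have "L \<in> {a..b}" using D(1,2) by (meson DiffD1 atLeastAtMost_iff order_refl subsetD)
    then show ?thesis using x n[of x] False assms by auto
  qed
  then have "{L..?r} \<subseteq> {a..b} - G" by blast
  then have "?r = R" using D(3)[of L ?r] assms by simp
  then show False using assms by (auto simp: min_def split: if_splits)
qed

lemma maximal_gap_left_end:
  assumes M: "maximal_gap L R" and "a < L" "0 < e"
  obtains x where "x \<in> G" "L - e < x" "x < L"
proof (rule ccontr)
  note conclude = that
  assume "\<not> thesis"
  then have n: "x \<notin> G" if "L - e < x" "x < L" for x using conclude that by blast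
  let ?l = "max a (L - e / 2)"
  note D = maximal_gapD[OF M]
  have "x \<in> {a..b} - G" if x: "x \<in> {?l..R}" for x
  proof (cases "L \<le> x")
    case True
    then show ?thesis using x D(2) by (meson atLeastAtMost_iff subsetD)
  next
    case False
    have "R \<in> {a..b}" using D(1,2) by (meson DiffD1 atLeastAtMost_iff order_refl subsetD)
    then show ?thesis using x n[of x] False assms D(1) by auto
  qed
  then have "{?l..R} \<subseteq> {a..b} - G" by blast
  then have "?l = L" using D(3)[of ?l R] assms by simp
  then show False using assms by (auto simp: max_def split: if_splits)
qed

lemma iter_near:
  assumes "x0 \<in> {a..b}" "p < (g ^^ k) x0" "(g ^^ k) x0 < q"
  obtains e where "0 < e" "\<And>x. x \<in> {a..b} \<Longrightarrow> \<bar>x - x0\<bar> < e \<Longrightarrow> p < (g ^^ k) x \<and> (g ^^ k) x < q"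
proof -
  let ?d = "min ((g ^^ k) x0 - p) (q - (g ^^ k) x0)"
  have "0 < ?d" using assms by simp
  then obtain e where "0 < e" "\<forall>x\<in>{a..b}. \<bar>x - x0\<bar> < e \<longrightarrow> \<bar>(g ^^ k) x - (g ^^ k) x0\<bar> < ?d"
    using iter_cont[of k] assms(1) unfolding continuous_on_iff dist_real_def by metis
  then show thesis using that[of e] by force
qed

lemma maximal_gap_in:
  assumes "maximal_gap L R"
  shows "L \<in> {a..b} - G" "R \<in> {a..b} - G"
  using maximal_gapD(1,2)[OF assms] by (auto dest: subsetD)

text \<open>If \<open>R\<close> were mapped to an inner point of the gap, continuity would carry
  nearby points of \<open>G\<close> into the gap, although points of \<open>G\<close> never leave
  \<open>G\<close>.\<close>

lemma maximal_gap_fix_right: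
  assumes M: "maximal_gap L R" and R: "R < b" and maps: "(g ^^ k) ` {L..R} \<subseteq> {L..R}" and L: "L < (g ^^ k) R"
  shows "(g ^^ k) R = R"
proof (rule ccontr)
  assume "(g ^^ k) R \<noteq> R"
  moreover have "(g ^^ k) R \<in> {L..R}" using maps maximal_gapD(1)[OF M] by (auto simp: image_subset_iff)
  ultimately have "(g ^^ k) R < R" by auto
  then obtain e where e: "0 < e" "\<And>x. x \<in> {a..b} \<Longrightarrow> \<bar>x - R\<bar> < e \<Longrightarrow> L < (g ^^ k) x \<and> (g ^^ k) x < R"
    using iter_near[of R L k R] L maximal_gap_in[OF M] by blast
  obtain x where x: "x \<in> G" "R < x" "x < R + e" using maximal_gap_right_end[OF M R e(1)] .
  then have xin: "x \<in> {a..b}" using G_sub by blast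
  then have "(g ^^ k) x \<in> {L..R}" using e(2)[of x] x by auto
  then have "(g ^^ k) x \<notin> G" using maximal_gapD(2)[OF M] by blast
  then show False using G_iter[OF xin] x by simp
qed

lemma maximal_gap_fix_left:
  assumes M: "maximal_gap L R" and L: "a < L" and maps: "(g ^^ k) ` {L..R} \<subseteq> {L..R}" and R: "(g ^^ k) L < R"
  shows "(g ^^ k) L = L"
proof (rule ccontr)
  assume "(g ^^ k) L \<noteq> L"
  moreover have "(g ^^ k) L \<in> {L..R}" using maps maximal_gapD(1)[OF M] by (auto simp: image_subset_iff)
  ultimately have "L < (g ^^ k) L" by auto
  then obtain e where e: "0 < e" "\<And>x. x \<in> {a..b} \<Longrightarrow> \<bar>x - L\<bar> < e \<Longrightarrow> L < (g ^^ k) x \<and> (g ^^ k) x < R"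
    using iter_near[of L L k R] R maximal_gap_in[OF M] by blast
  obtain x where x: "x \<in> G" "L - e < x" "x < L" using maximal_gap_left_end[OF M L e(1)] .
  then have xin: "x \<in> {a..b}" using G_sub by blast
  then have "(g ^^ k) x \<in> {L..R}" using e(2)[of x] x by auto
  then have "(g ^^ k) x \<notin> G" using maximal_gapD(2)[OF M] by blast
  then show False using G_iter[OF xin] x by simp
qed

lemma compl_not_c: "x \<in> {a..b} - G \<Longrightarrow> (g ^^ i) x \<noteq> c"
  using G_iter[of x i] c_G by auto

text \<open>A gap that returns to itself is fixed at both ends. By the expansion of cross-ratios it must
  attract from the outside at an interior end, which is impossible for an end of a gap.\<close>

lemma recurrent_gap_left:
  assumes M: "maximal_gap L R" and LR: "L < R" and p: "0 < p" and maps: "(g ^^ p) ` {L..R} \<subseteq> {L..R}"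
  shows "L = a" "R < b"
proof -
  note D = maximal_gapD[OF M]
  note in_ab = maximal_gap_in[OF M]
  show Rb: "R < b"
  proof (rule ccontr)
    assume "\<not> R < b"
    then have "R = b" using in_ab by auto
    then have "(g ^^ p) R = a" using p gb iter_a by (cases p) (auto simp: funpow_swap1)
    then have "a \<in> {L..R}" using maps LR by (auto simp: image_subset_iff)
    then have "c \<in> {L..R}" using \<open>R = b\<close> ac cb by auto
    then show False using D(2) c_G by blast
  qed
  \<comment> \<open>The second return preserves the order on the gap, so that each end is mapped to
    itself and not to the other one.\<close>
  define k where "k = 2 * p"
  let ?f = "g ^^ k"
  have k: "0 < k" using p by (simp add: k_def)
  have ff: "?f x = (g ^^ p) ((g ^^ p) x)" for x by (simp add: k_def mult_2 funpow_add)
  have fmaps: "?f ` {L..R} \<subseteq> {L..R}" using maps by (auto simp: ff)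
  have inc_LR: "?f x < ?f z" if "x \<in> {L..R}" "z \<in> {L..R}" "x < z" for x z
  proof -
    have "(\<forall>x\<in>{L..R}. \<forall>y\<in>{L..R}. x < y \<longrightarrow> (g ^^ p) x < (g ^^ p) y) \<or>
        (\<forall>x\<in>{L..R}. \<forall>y\<in>{L..R}. x < y \<longrightarrow> (g ^^ p) y < (g ^^ p) x)"
      by (rule iter_monotone) (rule compl_one_sided[OF _ D(2)], simp)
    moreover have "(g ^^ p) x \<in> {L..R}" "(g ^^ p) z \<in> {L..R}" using maps that by blast+
    ultimately show ?thesis using that unfolding ff by blast
  qed
  have ends: "L \<in> {L..R}" "R \<in> {L..R}" using LR by auto
  have "?f L < ?f R" using inc_LR ends LR by blast
  moreover have "?f L \<in> {L..R}" "?f R \<in> {L..R}" using fmaps ends by blast+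
  ultimately have between: "L < ?f R" "?f L < R" by auto
  have fR: "?f R = R" using maximal_gap_fix_right[OF M Rb fmaps between(1)] .
  show "L = a"
  proof (rule ccontr)
    assume "L \<noteq> a"
    then have La: "a < L" using in_ab by auto
    have fL: "?f L = L" using maximal_gap_fix_left[OF M La fmaps between(2)] .
    obtain e1 where e1: "0 < e1" "\<And>x i. x \<in> {a..b} \<Longrightarrow> \<bar>x - L\<bar> < e1 \<Longrightarrow> i < k \<Longrightarrow> (g ^^ i) x \<noteq> c"
      using avoids_critical_nearby[of L k] in_ab compl_not_c by (metis DiffD1)
    obtain e2 where e2: "0 < e2" "\<And>x i. x \<in> {a..b} \<Longrightarrow> \<bar>x - R\<bar> < e2 \<Longrightarrow> i < k \<Longrightarrow> (g ^^ i) x \<noteq> c"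
      using avoids_critical_nearby[of R k] in_ab compl_not_c by (metis DiffD1)
    \<comment> \<open>The gap is enlarged beyond both ends, but so little that the first
      \<open>k\<close> iterates avoid \<open>c\<close>; cross-ratios then also control points
      outside the gap.\<close>
    define l r where "l = max a (L - e1 / 2)" "r = min b (R + e2 / 2)"
    have lr: "a \<le> l" "l < L" "R < r" "r \<le> b" using La Rb e1 e2 by (auto simp: l_r_def)
    let ?S = "{l..r}"
    have S_ab: "?S \<subseteq> {a..b}" using lr by auto
    have S_c: "(g ^^ i) x \<noteq> c" if "x \<in> ?S" "i < k" for x i
    proof -
      consider "x \<in> {L..R}" | "x < L" | "R < x" by force
      then show ?thesis
      proof cases
        case 1
        then show ?thesis using compl_not_c D(2) by blast
      next
        case 2
        then have "\<bar>x - L\<bar> < e1" using that e1 by (auto simp: l_r_def)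
        then show ?thesis using e1(2) that S_ab by blast
      next
        case 3
        then have "\<bar>x - R\<bar> < e2" using that e2 by (auto simp: l_r_def)
        then show ?thesis using e2(2) that S_ab by blast
      qed
    qed
    have os: "one_sided ((g ^^ i) ` ?S)" if "i < k" for i
    proof (rule one_sided_if_avoids)
      show "connected ((g ^^ i) ` ?S)"
        by (intro connected_continuous_image continuous_on_subset[OF iter_cont S_ab]) auto
      show "(g ^^ i) ` ?S \<subseteq> {a..b}" using iter_in S_ab by blast
      show "c \<notin> (g ^^ i) ` ?S" using S_c that by blast
    qed
    have "(\<forall>x\<in>?S. \<forall>y\<in>?S. x < y \<longrightarrow> ?f x < ?f y) \<or> (\<forall>x\<in>?S. \<forall>y\<in>?S. x < y \<longrightarrow> ?f y < ?f x)"
      using os by (rule iter_monotone)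
    moreover have "L \<in> ?S" "R \<in> ?S" using lr LR by auto
    ultimately have inc: "\<forall>x\<in>?S. \<forall>y\<in>?S. x < y \<longrightarrow> ?f x < ?f y"
      using fL fR LR by (metis less_asym)
    have inc': "?f x < ?f z" if "l \<le> x" "x < z" "z \<le> r" for x z using inc that by auto
    \<comment> \<open>If a point on either side moved weakly outwards, these two points and the
      fixed ends \<open>L\<close> and \<open>R\<close> would form a quadruple whose cross-ratio does
      not grow. So one of the ends attracts from outside.\<close>
    have not_both: False if "x \<in> {l..<L}" "?f x \<le> x" "z \<in> {R<..r}" "z \<le> ?f z" for x z
    proof -
      have "cross_ratio x L R z < cross_ratio (?f x) (?f L) (?f R) (?f z)"
        by (rule iter_cross_ratio[OF os]) (use that LR lr k in auto)
      moreover have "cross_ratio (?f x) L R (?f z) \<le> cross_ratio x L R z"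
        using that LR by (intro cross_ratio_antimono_outer) auto
      ultimately show False by (simp add: fL fR)
    qed
    show False
    proof (cases "\<forall>x\<in>{l..<L}. x < ?f x")
      case True
      obtain x where x: "x \<in> G" "L - (L - l) < x" "x < L" using maximal_gap_left_end[OF M La, of "L - l"] lr by auto
      show False
      proof (rule no_attracting_fixpoint[OF k, of l L L x])
        show "(L = L \<longrightarrow> x < ?f x) \<and> (L = l \<longrightarrow> ?f x < x)" if "x \<in> {l..L}" "x \<noteq> L" for x
          using True that lr by auto
      qed (use lr S_ab in_ab fL inc' x LR in auto)
    next
      case False
      then obtain x0 where "x0 \<in> {l..<L}" "?f x0 \<le> x0" by (auto simp: not_less)
      then have down: "?f z < z" if "z \<in> {R<..r}" for z using not_both that by (meson not_less)
      obtain x where x: "x \<in> G" "R < x" "x < R + (r - R)" using maximal_gap_right_end[OF M Rb, of "r - R"] lr by auto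
      show False
      proof (rule no_attracting_fixpoint[OF k, of R r R x])
        show "(R = r \<longrightarrow> x < ?f x) \<and> (R = R \<longrightarrow> ?f x < x)" if "x \<in> {R..r}" "x \<noteq> R" for x
          using down that lr by auto
      qed (use lr S_ab in_ab fR inc' x LR in auto)
    qed
  qed
qed

text \<open>Both ends are fixed, and since \<open>R\<close> cannot attract from the right, some
  \<open>z0\<close> beyond it does not move down. A point inside the gap that did not move down
  either would form with \<open>a\<close>, \<open>R\<close> and \<open>z0\<close> a quadruple whose
  cross-ratio does not grow.\<close>

lemma gap_at_a:
  assumes M: "maximal_gap a R" and R: "a < R"
  shows "R < c" "g R = R" "\<And>x. a < x \<Longrightarrow> x < R \<Longrightarrow> g x < x"
proof -
  note D = maximal_gapD[OF M]
  show Rc: "R < c"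
  proof (rule ccontr)
    assume "\<not> R < c"
    then have "c \<in> {a..R}" using ac by auto
    then show False using D(2) c_G by blast
  qed
  have maps: "g ` {a..R} \<subseteq> {a..R}"
  proof -
    obtain p q where pq: "p \<le> q" "(g ^^ 1) ` {a..R} = {p..q}"
      using iter_image_Icc[of a R 1] R Rc cb by (metis less_imp_le order_refl order_trans)
    have "(g ^^ 1) ` {a..R} \<subseteq> {a..b} - G" by (rule compl_iter[OF D(2)])
    moreover have "a \<in> (g ^^ 1) ` {a..R}" using ga R by (auto intro!: image_eqI[of _ _ a])
    ultimately have "{p..q} \<subseteq> {a..b} - G" "{p..q} \<inter> {a..R} \<noteq> {}" using pq R by auto
    then show ?thesis using maximal_gap_absorb[OF M] pq by auto
  qed
  have Rb: "R < b" using Rc cb by simp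
  have "a < g R" using mono_left[of a R] ga R Rc by simp
  then show gR: "g R = R" using maximal_gap_fix_right[OF M Rb, of 1] maps by simp
  obtain z0 where z0: "R < z0" "z0 \<le> c" "z0 \<le> g z0"
  proof (rule ccontr)
    note conclude = that
    assume "\<not> thesis"
    then have down: "g z < z" if "R < z" "z \<le> c" for z using conclude[of z] that by (meson not_less)
    obtain x where x: "x \<in> G" "R < x" "x < R + (c - R)" using maximal_gap_right_end[OF M Rb, of "c - R"] Rc by auto
    show False
    proof (rule no_attracting_fixpoint[of 1 R c R x])
      show "(R = c \<longrightarrow> x < (g ^^ 1) x) \<and> (R = R \<longrightarrow> (g ^^ 1) x < x)" if "x \<in> {R..c}" "x \<noteq> R" for x
        using down[of x] that Rc by auto
      show "(g ^^ 1) x < (g ^^ 1) z" if "R \<le> x" "x < z" "z \<le> c" for x z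
        using mono_left[of x z] that R by simp
    qed (use Rc cb R gR x maximal_gap_in[OF M] in auto)
  qed
  show "g x < x" if "a < x" "x < R" for x
  proof (rule ccontr)
    assume n: "\<not> g x < x"
    have gxR: "g x < R" using mono_left[of x R] that Rc gR by simp
    have "cross_ratio a x R z0 < cross_ratio (g a) (g x) (g R) (g z0)"
      using that z0 by (intro cr) auto
    also have "\<dots> \<le> cross_ratio a x R (g z0)"
      unfolding ga gR using that n gxR z0 by (intro cross_ratio_mono_inner) auto
    also have "\<dots> \<le> cross_ratio a x R z0"
      using that z0 by (intro cross_ratio_antimono_outer) auto
    finally show False by simp
  qed
qed

text \<open>The case \<open>r = a\<close> is allowed. Iterates are injective on intervals outside
  \<open>G\<close>, so the last clause then says that the complement of \<open>G\<close> contains no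
  proper interval.\<close>

lemma gaps_absorbed:
  obtains r where "a \<le> r" "r < c" "g r = r" "{a..r} \<inter> G = {}" "\<And>x. a < x \<Longrightarrow> x < r \<Longrightarrow> g x < x"
    "\<And>p q. p < q \<Longrightarrow> {p..q} \<subseteq> {a..b} - G \<Longrightarrow> \<exists>k. (g ^^ k) ` {p..q} \<subseteq> {a..r}"
proof -
  have "{a..a} \<subseteq> {a..b} - G" using a_G ac cb by auto
  then obtain l r where lr: "maximal_gap l r" "{a..a} \<subseteq> {l..r}" using maximal_gap_exists[of a a] by auto
  then have "l = a" using maximal_gap_in[OF lr(1)] by auto
  then have M: "maximal_gap a r" using lr by simp
  note D = maximal_gapD[OF M]
  have absorb: "\<exists>k. (g ^^ k) ` {p..q} \<subseteq> {a..r}" if pq: "p < q" "{p..q} \<subseteq> {a..b} - G" for p q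
  proof -
    obtain k n L R where LR: "maximal_gap L R" "(g ^^ k) ` {p..q} \<subseteq> {L..R}" "0 < n" "(g ^^ n) ` {L..R} \<subseteq> {L..R}"
      using maximal_gap_recurs[OF pq] by metis
    have "one_sided ((g ^^ i) ` {p..q})" for i by (rule compl_one_sided[OF _ pq(2)]) simp
    moreover have pq_in: "p \<in> {p..q}" "q \<in> {p..q}" using pq by auto
    ultimately have "(g ^^ k) p \<noteq> (g ^^ k) q"
      using iter_monotone[of k "{p..q}"] pq by (metis less_irrefl)
    moreover have "(g ^^ k) p \<in> {L..R}" "(g ^^ k) q \<in> {L..R}" using LR pq_in by blast+
    ultimately have "L < R" by auto
    then have "L = a" using recurrent_gap_left LR by metis
    then have "R = r" using maximal_gap_eq[OF LR(1) M] D(1) maximal_gapD(1)[OF LR(1)] by auto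
    then show ?thesis using LR \<open>L = a\<close> by auto
  qed
  show thesis
  proof (cases "a < r")
    case True
    then show ?thesis using that[of r] gap_at_a[OF M True] D absorb by auto
  next
    case False
    then have "r = a" using D(1) by simp
    then show ?thesis using that[of a] ac ga a_G absorb by auto
  qed
qed

end

section \<open>Traps\<close>

context attracted_unimodal
begin

definition shrinks :: "real set \<Rightarrow> bool" where
  "shrinks s \<longleftrightarrow> (\<forall>\<epsilon>>0. \<exists>k. \<forall>j\<ge>k. \<forall>x\<in>s. \<forall>x'\<in>s. \<bar>(g ^^ j) x - (g ^^ j) x'\<bar> < \<epsilon>)"

definition closed_interval :: "real set \<Rightarrow> bool" where
  "closed_interval s \<longleftrightarrow> compact s \<and> connected s \<and> s \<noteq> {} \<and> s \<subseteq> {a..b}"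

text \<open>Invariance under \<open>g\<close> is required only up to inclusion, which is all that a
  choice of \<open>nx\<close> takes.\<close>

definition trap_family :: "real set set \<Rightarrow> bool" where
  "trap_family TT \<longleftrightarrow> finite TT \<and> (\<forall>s\<in>TT. closed_interval s \<and> shrinks s \<and> (\<exists>s'\<in>TT. g ` s \<subseteq> s'))"

lemma closed_interval_image:
  assumes "closed_interval s"
  shows "closed_interval ((g ^^ i) ` s)"
proof -
  have "continuous_on s (g ^^ i)" using assms continuous_on_subset[OF iter_cont] by (auto simp: closed_interval_def)
  moreover have "(g ^^ i) ` s \<subseteq> {a..b}" using assms iter_in unfolding closed_interval_def by blast
  ultimately show ?thesis
    using assms compact_continuous_image connected_continuous_image unfolding closed_interval_def by blast
qed

lemma closed_interval_Icc: "u \<le> v \<Longrightarrow> a \<le> u \<Longrightarrow> v \<le> b \<Longrightarrow> closed_interval {u..v}"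
  by (auto simp: closed_interval_def)

lemma shrinks_subset: "shrinks s \<Longrightarrow> t \<subseteq> s \<Longrightarrow> shrinks t"
  unfolding shrinks_def by (meson subsetD)

lemma shrinks_image: "shrinks s \<Longrightarrow> shrinks ((g ^^ i) ` s)"
  unfolding shrinks_def
proof (intro allI impI)
  fix \<epsilon> :: real assume s: "\<forall>\<epsilon>>0. \<exists>k. \<forall>j\<ge>k. \<forall>x\<in>s. \<forall>x'\<in>s. \<bar>(g ^^ j) x - (g ^^ j) x'\<bar> < \<epsilon>" and "0 < \<epsilon>"
  then obtain k where k: "\<forall>j\<ge>k. \<forall>x\<in>s. \<forall>x'\<in>s. \<bar>(g ^^ j) x - (g ^^ j) x'\<bar> < \<epsilon>" by blast
  have "\<bar>(g ^^ j) ((g ^^ i) x) - (g ^^ j) ((g ^^ i) x')\<bar> < \<epsilon>" if "j \<ge> k" "x \<in> s" "x' \<in> s" for j x x'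
    using k[rule_format, of "j + i" x x'] that by (simp add: funpow_add)
  then show "\<exists>k. \<forall>j\<ge>k. \<forall>x\<in>(g ^^ i) ` s. \<forall>x'\<in>(g ^^ i) ` s. \<bar>(g ^^ j) x - (g ^^ j) x'\<bar> < \<epsilon>" by blast
qed

lemma shrinks_if_image:
  assumes "shrinks ((g ^^ i) ` s)"
  shows "shrinks s"
  unfolding shrinks_def
proof (intro allI impI)
  fix \<epsilon> :: real assume "0 < \<epsilon>"
  then obtain k where k: "\<forall>j\<ge>k. \<forall>x\<in>s. \<forall>x'\<in>s. \<bar>(g ^^ j) ((g ^^ i) x) - (g ^^ j) ((g ^^ i) x')\<bar> < \<epsilon>"
    using assms unfolding shrinks_def by blast
  have "\<bar>(g ^^ j) x - (g ^^ j) x'\<bar> < \<epsilon>" if "j \<ge> k + i" "x \<in> s" "x' \<in> s" for j x x'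
  proof -
    have "(g ^^ j) z = (g ^^ (j - i)) ((g ^^ i) z)" for z
      using that by (simp flip: funpow_add o_apply[of "g ^^ (j - i)" "g ^^ i"])
    then show ?thesis using k[rule_format, of "j - i" x x'] that by simp
  qed
  then show "\<exists>k. \<forall>j\<ge>k. \<forall>x\<in>s. \<forall>x'\<in>s. \<bar>(g ^^ j) x - (g ^^ j) x'\<bar> < \<epsilon>" by blast
qed

text \<open>Convergence is known along multiples of \<open>m\<close>; continuity at \<open>w\<close>
  of the iterates below \<open>m\<close> supplies the other residues.\<close>

lemma V_shrinks: "shrinks {y..g c}"
  unfolding shrinks_def
proof (intro allI impI)
  fix \<epsilon> :: real assume e: "0 < \<epsilon>"
  have "\<exists>\<delta>>0. \<forall>t<n. \<forall>x\<in>{a..b}. \<bar>x - w\<bar> < \<delta> \<longrightarrow> \<bar>(g ^^ t) x - (g ^^ t) w\<bar> < \<epsilon> / 2" for n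
  proof (induction n)
    case (Suc n)
    then obtain d1 where d1: "0 < d1" "\<forall>t<n. \<forall>x\<in>{a..b}. \<bar>x - w\<bar> < d1 \<longrightarrow> \<bar>(g ^^ t) x - (g ^^ t) w\<bar> < \<epsilon> / 2" by blast
    have "0 < \<epsilon> / 2" using e by simp
    then obtain d2 where d2: "0 < d2" "\<forall>x\<in>{a..b}. \<bar>x - w\<bar> < d2 \<longrightarrow> \<bar>(g ^^ n) x - (g ^^ n) w\<bar> < \<epsilon> / 2"
      using iter_cont[of n] w_in unfolding continuous_on_iff dist_real_def by metis
    show ?case using d1 d2 by (intro exI[of _ "min d1 d2"]) (auto simp: less_Suc_eq)
  qed (auto intro: exI[of _ 1])
  then obtain \<delta> where \<delta>: "0 < \<delta>" "\<forall>t<m. \<forall>x\<in>{a..b}. \<bar>x - w\<bar> < \<delta> \<longrightarrow> \<bar>(g ^^ t) x - (g ^^ t) w\<bar> < \<epsilon> / 2" by blast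
  obtain K where K: "\<forall>k\<ge>K. \<forall>x\<in>{y..g c}. \<bar>(g ^^ (m * k)) x - w\<bar> < \<delta>" using V_conv \<delta>(1) by blast
  have *: "\<bar>(g ^^ j) x - (g ^^ (j mod m)) w\<bar> < \<epsilon> / 2" if j: "j \<ge> m * K" and x: "x \<in> {y..g c}" for j x
  proof -
    have "K \<le> j div m" using j m by (simp add: less_eq_div_iff_mult_less_eq mult.commute)
    then have "\<bar>(g ^^ (m * (j div m))) x - w\<bar> < \<delta>" using K x by blast
    moreover have "x \<in> {a..b}" using x ay gc_in by auto
    ultimately have "\<bar>(g ^^ (j mod m)) ((g ^^ (m * (j div m))) x) - (g ^^ (j mod m)) w\<bar> < \<epsilon> / 2"
      using \<delta>(2) iter_in m by simp
    moreover have "(g ^^ j) x = (g ^^ (j mod m)) ((g ^^ (m * (j div m))) x)"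
      by (metis add.commute funpow_add mult_div_mod_eq o_apply)
    ultimately show ?thesis by simp
  qed
  have "\<bar>(g ^^ j) x - (g ^^ j) x'\<bar> < \<epsilon>" if "j \<ge> m * K" "x \<in> {y..g c}" "x' \<in> {y..g c}" for j x x'
    using *[of j x] *[of j x'] that by linarith
  then show "\<exists>k. \<forall>j\<ge>k. \<forall>x\<in>{y..g c}. \<forall>x'\<in>{y..g c}. \<bar>(g ^^ j) x - (g ^^ j) x'\<bar> < \<epsilon>" by blast
qed

lemma trap_family_Un: "trap_family TT \<Longrightarrow> trap_family TT' \<Longrightarrow> trap_family (TT \<union> TT')"
  unfolding trap_family_def by blast

text \<open>The family consists of the images of \<open>s\<close> up to time \<open>k\<close> and of
  one turn of images of \<open>{y..g c}\<close>, which closes up because \<open>g ^^ m\<close> maps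
  that interval into itself.\<close>

lemma trap_family_if_enters:
  assumes "closed_interval s" "(g ^^ k) ` s \<subseteq> {y..g c}"
  obtains TT where "trap_family TT" "s \<in> TT"
proof -
  let ?V = "{y..g c}"
  define A where "A = (\<lambda>i. (g ^^ i) ` s) ` {..k} \<union> (\<lambda>i. (g ^^ i) ` ?V) ` {..m}"
  have V: "closed_interval ?V" using ay yw wc gc_in by (intro closed_interval_Icc) auto
  have sh: "shrinks s" using shrinks_if_image shrinks_subset[OF V_shrinks assms(2)] .
  have img: "g ` (g ^^ i) ` X = (g ^^ Suc i) ` X" for i X by (simp add: image_comp)
  have "\<exists>s'\<in>A. g ` (g ^^ i) ` s \<subseteq> s'" if "i \<le> k" for i
  proof (cases "i = k")
    case True
    have "g ` (g ^^ i) ` s \<subseteq> (g ^^ 1) ` ?V" using assms(2) True by auto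
    moreover have "(g ^^ 1) ` ?V \<in> A" unfolding A_def using m by (intro UnI2 imageI) auto
    ultimately show ?thesis by blast
  next
    case False
    then have "(g ^^ Suc i) ` s \<in> A" unfolding A_def using that by (intro UnI1 imageI) auto
    then show ?thesis unfolding img by blast
  qed
  moreover have "\<exists>s'\<in>A. g ` (g ^^ i) ` ?V \<subseteq> s'" if "i \<le> m" for i
  proof (cases "i = m")
    case True
    have "g ` (g ^^ i) ` ?V \<subseteq> (g ^^ 1) ` ?V" using V_maps True by auto
    moreover have "(g ^^ 1) ` ?V \<in> A" unfolding A_def using m by (intro UnI2 imageI) auto
    ultimately show ?thesis by blast
  next
    case False
    then have "(g ^^ Suc i) ` ?V \<in> A" unfolding A_def using that by (intro UnI2 imageI) auto
    then show ?thesis unfolding img by blast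
  qed
  ultimately have "\<forall>s\<in>A. \<exists>s'\<in>A. g ` s \<subseteq> s'" unfolding A_def by blast
  moreover have "closed_interval t \<and> shrinks t" if "t \<in> A" for t
    using that closed_interval_image assms(1) V shrinks_image sh V_shrinks unfolding A_def by blast
  moreover have "finite A" by (simp add: A_def)
  ultimately have "trap_family A" unfolding trap_family_def by blast
  moreover have "s \<in> A" unfolding A_def by (intro UnI1 image_eqI[of _ _ 0]) auto
  ultimately show thesis using that by blast
qed

text \<open>Compactness by bisection: near a point of \<open>G\<close> one entry time serves a whole
  interval.\<close>

lemma trap_family_covering:
  assumes "p \<le> q" "{p..q} \<subseteq> G"
  obtains TT F where "trap_family TT" "F \<subseteq> TT" "{p..q} = \<Union>F"
proof -
  \<comment> \<open>The guard is there because \<open>Bolzano\<close> also asks about intervals that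
    leave \<open>{p..q}\<close>.\<close>
  define Q where "Q = (\<lambda>u v. {u..v} \<subseteq> {a..b} \<longrightarrow> (\<exists>TT F. trap_family TT \<and> F \<subseteq> TT \<and> {u..v} = \<Union>F))"
  have "Q p q"
  proof (rule Bolzano[OF assms(1)])
    fix u v t assume Q: "Q u v" "Q v t" and le: "u \<le> v" "v \<le> t"
    show "Q u t"
      unfolding Q_def
    proof
      assume "{u..t} \<subseteq> {a..b}"
      then have "{u..v} \<subseteq> {a..b}" "{v..t} \<subseteq> {a..b}" using le by auto
      then obtain TT F TT' F' where *: "trap_family TT" "F \<subseteq> TT" "{u..v} = \<Union>F" "trap_family TT'" "F' \<subseteq> TT'" "{v..t} = \<Union>F'"
        using Q unfolding Q_def by blast
      have "{u..t} = {u..v} \<union> {v..t}" using le by auto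
      then have "{u..t} = \<Union>(F \<union> F')" using * by simp
      then show "\<exists>TT F. trap_family TT \<and> F \<subseteq> TT \<and> {u..t} = \<Union>F"
        using * trap_family_Un by (metis Un_mono)
    qed
  next
    fix x assume "p \<le> x" "x \<le> q"
    then have "x \<in> G" using assms by auto
    then obtain k where k: "x \<in> {a..b}" "0 < k" "y < (g ^^ k) x" by (auto simp: G_def)
    have "(g ^^ k) x < g c + 1" using iter_le_gc[OF k(1,2)] by simp
    then obtain e where e: "0 < e" "\<And>x'. x' \<in> {a..b} \<Longrightarrow> \<bar>x' - x\<bar> < e \<Longrightarrow> y < (g ^^ k) x' \<and> (g ^^ k) x' < g c + 1"
      using iter_near[OF k(1,3)] by metis
    have "Q u v" if uv: "u \<le> x" "x \<le> v" "v - u < e" for u v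
      unfolding Q_def
    proof
      assume sub: "{u..v} \<subseteq> {a..b}"
      have "y \<le> (g ^^ k) x' \<and> (g ^^ k) x' \<le> g c" if "x' \<in> {u..v}" for x'
        using e(2)[of x'] sub that uv iter_le_gc[of x' k] k(2) by force
      then have "(g ^^ k) ` {u..v} \<subseteq> {y..g c}" by auto
      moreover have "closed_interval {u..v}" using sub uv by (intro closed_interval_Icc) auto
      ultimately obtain TT where "trap_family TT" "{u..v} \<in> TT" using trap_family_if_enters by metis
      then show "\<exists>TT F. trap_family TT \<and> F \<subseteq> TT \<and> {u..v} = \<Union>F"
        by (intro exI[of _ TT] exI[of _ "{{u..v}}"]) auto
    qed
    then show "\<exists>d>0. \<forall>u v. u \<le> x \<and> x \<le> v \<and> v - u < d \<longrightarrow> Q u v" using e(1) by blast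
  qed
  moreover have "{p..q} \<subseteq> {a..b}" using assms G_sub by blast
  ultimately show thesis using that unfolding Q_def by blast
qed

section \<open>The component of \<open>G\<close> at the critical value and its repelling end\<close>

lemma V_G: "{y..g c} \<subseteq> G"
proof
  fix x assume x: "x \<in> {y..g c}"
  then have x_in: "x \<in> {a..b}" using ay gc_in by auto
  have "0 < w - y" using yw by simp
  then obtain K where "\<forall>k\<ge>K. \<forall>x\<in>{y..g c}. \<bar>(g ^^ (m * k)) x - w\<bar> < w - y" using V_conv by blast
  then have "\<bar>(g ^^ (m * Suc K)) x - w\<bar> < w - y" using x le_SucI by blast
  then have "y < (g ^^ (m * Suc K)) x" by linarith
  moreover have "0 < m * Suc K" using m by simp
  ultimately show "x \<in> G" unfolding G_def using x_in by blast
qed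

text \<open>\<open>v0\<close> is the last point below \<open>g c\<close> outside \<open>G\<close>.
  The interval above it is invariant under \<open>g ^^ m\<close>, since its image is connected,
  avoids \<open>v0\<close> and contains a point of the trap. By continuity \<open>v0\<close> cannot
  move down, and as a point outside \<open>G\<close> it cannot move into the interval; so it is
  fixed.\<close>

lemma critical_value_component:
  obtains v0 where "a \<le> v0" "v0 < y" "v0 \<notin> G" "{v0<..g c} \<subseteq> G" "(g ^^ m) v0 = v0"
    "\<And>x. x \<in> {v0<..g c} \<Longrightarrow> (g ^^ m) x \<in> {v0<..g c}"
proof -
  have "{a..g c} - G = ({a..b} - G) \<inter> {..g c}" using gc_in by auto
  then have "compact ({a..g c} - G)" using compl_G_compact by (simp add: compact_Int_closed)
  moreover have "a \<in> {a..g c} - G" using a_G gc_in by auto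
  ultimately obtain v0 where v0: "v0 \<in> {a..g c} - G" "\<forall>x\<in>{a..g c} - G. x \<le> v0"
    using compact_attains_sup[of "{a..g c} - G"] by blast
  have v0y: "v0 < y"
  proof (rule ccontr)
    assume "\<not> v0 < y"
    then have "v0 \<in> {y..g c}" using v0 by auto
    then show False using V_G v0 by blast
  qed
  have above: "{v0<..g c} \<subseteq> G"
  proof
    fix x assume "x \<in> {v0<..g c}"
    then have "x \<in> {a..g c}" "\<not> x \<le> v0" using v0(1) by auto
    then show "x \<in> G" using v0(2) by blast
  qed
  have gc: "g c \<in> {v0<..g c}" "g c \<in> {y..g c}" using v0y yw wc by auto
  have S_in: "{v0<..g c} \<subseteq> {a..b}" using above G_sub by blast
  let ?h = "g ^^ m"
  have conn: "connected (?h ` {v0<..g c})"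
    by (intro connected_continuous_image continuous_on_subset[OF iter_cont S_in]) auto
  have hG: "?h x \<in> G" if "x \<in> {v0<..g c}" for x using G_iter[of x m] that above S_in by blast
  have maps: "?h x \<in> {v0<..g c}" if x: "x \<in> {v0<..g c}" for x
  proof -
    have le: "?h x \<le> g c" using iter_le_gc[of x m] m x S_in by blast
    have "v0 < ?h x"
    proof (rule ccontr)
      assume "\<not> v0 < ?h x"
      moreover have "v0 \<le> ?h (g c)" using V_maps gc v0y by fastforce
      ultimately have "v0 \<in> ?h ` {v0<..g c}" using connectedD_interval[OF conn, of "?h x" "?h (g c)" v0] x gc by auto
      then show False using hG v0 by auto
    qed
    then show ?thesis using le by simp
  qed
  have v0_in: "v0 \<in> {a..b}" using v0 gc_in by auto
  have "v0 \<le> ?h v0"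
  proof (rule ccontr)
    assume n: "\<not> v0 \<le> ?h v0"
    then have "?h v0 - 1 < ?h v0" "?h v0 < v0" by auto
    then obtain e where e: "0 < e" "\<And>x. x \<in> {a..b} \<Longrightarrow> \<bar>x - v0\<bar> < e \<Longrightarrow> ?h v0 - 1 < ?h x \<and> ?h x < v0"
      using iter_near[OF v0_in] by metis
    define x where "x = min (g c) (v0 + e / 2)"
    have "x \<in> {v0<..g c}" "\<bar>x - v0\<bar> < e" using e(1) gc by (auto simp: x_def)
    then show False using e(2)[of x] maps[of x] S_in by auto
  qed
  moreover have "?h v0 \<notin> {v0<..g c}" using G_iter[OF v0_in, of m] above v0 by blast
  moreover have "?h v0 \<le> g c" using iter_le_gc[OF v0_in m] .
  ultimately have "?h v0 = v0" by auto
  then show thesis using that[of v0] v0 v0y above maps by auto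
qed

text \<open>Repulsion is a consequence of the absence of nearby limits. If a point just above
  \<open>v0\<close> did not move up under \<open>g ^^ m\<close>, its orbit would remain between
  \<open>v0\<close> and that point, with a limit in the cycle of \<open>w\<close>; but
  \<open>y0\<close> is chosen below all points of this cycle above \<open>v0\<close>.\<close>

lemma repelling_neighbourhood:
  assumes v0: "a \<le> v0" "v0 < y" "v0 \<notin> G" "{v0<..g c} \<subseteq> G" "(g ^^ m) v0 = v0"
    and maps: "\<And>x. x \<in> {v0<..g c} \<Longrightarrow> (g ^^ m) x \<in> {v0<..g c}"
    and z: "y < z"
  obtains y0 where "v0 < y0" "y0 < y" "\<And>i x. i < m \<Longrightarrow> x \<in> {v0..y0} \<Longrightarrow> (g ^^ i) x \<noteq> c \<and> g ((g ^^ i) x) \<le> z"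
    "y0 < (g ^^ m) y0" "(g ^^ m) ` {v0..y0} = {v0..(g ^^ m) y0}"
proof -
  let ?h = "g ^^ m"
  have ygc: "y < g c" using yw wc by simp
  have v0_in: "v0 \<in> {a..b}" using v0 ygc gc_in by auto
  have v0_iter: "(g ^^ i) v0 \<noteq> c" "0 < i \<Longrightarrow> (g ^^ i) v0 \<le> y" for i
    using G_iter[OF v0_in, of i] c_G v0(3) not_in_G_le[OF v0_in v0(3)] by auto
  have "\<exists>e>0. \<forall>x\<in>{a..b}. \<bar>x - v0\<bar> < e \<longrightarrow> (\<forall>i<n. g ((g ^^ i) x) \<le> z)" for n
  proof (induction n)
    case (Suc n)
    then obtain e1 where e1: "0 < e1" "\<forall>x\<in>{a..b}. \<bar>x - v0\<bar> < e1 \<longrightarrow> (\<forall>i<n. g ((g ^^ i) x) \<le> z)" by blast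
    have "(g ^^ Suc n) v0 - 1 < (g ^^ Suc n) v0" "(g ^^ Suc n) v0 < z" using v0_iter(2)[of "Suc n"] z by auto
    then obtain e2 where e2: "0 < e2" "\<And>x. x \<in> {a..b} \<Longrightarrow> \<bar>x - v0\<bar> < e2 \<Longrightarrow> (g ^^ Suc n) v0 - 1 < (g ^^ Suc n) x \<and> (g ^^ Suc n) x < z"
      using iter_near[OF v0_in] by metis
    then have "g ((g ^^ n) x) \<le> z" if "x \<in> {a..b}" "\<bar>x - v0\<bar> < e2" for x using that by force
    then show ?case using e1 e2(1) by (intro exI[of _ "min e1 e2"]) (auto simp: less_Suc_eq)
  qed (auto intro: exI[of _ 1])
  then obtain e1 where e1: "0 < e1" "\<forall>x\<in>{a..b}. \<bar>x - v0\<bar> < e1 \<longrightarrow> (\<forall>i<m. g ((g ^^ i) x) \<le> z)" by blast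
  obtain e2 where e2: "0 < e2" "\<And>x i. x \<in> {a..b} \<Longrightarrow> \<bar>x - v0\<bar> < e2 \<Longrightarrow> i < m \<Longrightarrow> (g ^^ i) x \<noteq> c"
    using avoids_critical_nearby[OF v0_in v0_iter(1), of m] by metis
  define Orb where "Orb = (\<lambda>t. (g ^^ t) w) ` {..<m} \<inter> {v0<..}"
  have Orb: "(g ^^ t) w \<in> Orb" if "v0 < (g ^^ t) w" for t
    using that funpow_mod_eq[OF w_fix, of t] m unfolding Orb_def by (auto intro!: image_eqI[of _ _ "t mod m"])
  \<comment> \<open>Inserting \<open>y\<close> keeps the set nonempty and places \<open>y0\<close>
    below \<open>y\<close>.\<close>
  define o0 where "o0 = Min (insert y Orb)"
  have "finite Orb" by (simp add: Orb_def)
  then have o0: "v0 < o0" "o0 \<le> y" "\<And>x. x \<in> Orb \<Longrightarrow> o0 \<le> x"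
    using v0(2) by (auto simp: o0_def Orb_def)
  define y0 where "y0 = v0 + min (min (e1 / 2) (e2 / 2)) ((o0 - v0) / 2)"
  have y0: "v0 < y0" "y0 < o0" "y0 < y" "y0 - v0 < e1" "y0 - v0 < e2"
  proof -
    show "v0 < y0" using e1(1) e2(1) o0(1) by (simp add: y0_def)
    have "y0 \<le> v0 + (o0 - v0) / 2" unfolding y0_def by (intro add_left_mono min.cobounded2)
    then show "y0 < o0" using o0(1) by (simp add: field_simps)
    then show "y0 < y" using o0(2) by simp
    have "y0 \<le> v0 + e1 / 2" "y0 \<le> v0 + e2 / 2" by (auto simp: y0_def)
    then show "y0 - v0 < e1" "y0 - v0 < e2" using e1(1) e2(1) by linarith+
  qed
  have S_in: "{v0..y0} \<subseteq> {a..b}" using v0(1) y0(3) ygc gc_in by auto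
  have near: "(g ^^ i) x \<noteq> c \<and> g ((g ^^ i) x) \<le> z" if "i < m" "x \<in> {v0..y0}" for i x
  proof -
    have "x \<in> {a..b}" "\<bar>x - v0\<bar> < e1" "\<bar>x - v0\<bar> < e2" using that S_in y0 by auto
    then show ?thesis using e1(2) e2(2) that by blast
  qed
  have "one_sided ((g ^^ i) ` {v0..y0})" if "i < m" for i
  proof (rule one_sided_if_avoids)
    show "connected ((g ^^ i) ` {v0..y0})"
      by (intro connected_continuous_image continuous_on_subset[OF iter_cont S_in]) auto
    show "(g ^^ i) ` {v0..y0} \<subseteq> {a..b}" using iter_in S_in by blast
    show "c \<notin> (g ^^ i) ` {v0..y0}" using near that by blast
  qed
  then have "(\<forall>x\<in>{v0..y0}. \<forall>y\<in>{v0..y0}. x < y \<longrightarrow> ?h x < ?h y) \<or> (\<forall>x\<in>{v0..y0}. \<forall>y\<in>{v0..y0}. x < y \<longrightarrow> ?h y < ?h x)"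
    by (rule iter_monotone)
  moreover have "v0 \<in> {v0..y0}" "y0 \<in> {v0..y0}" "v0 < ?h y0" using y0 maps[of y0] ygc by auto
  ultimately have sinc: "\<forall>x\<in>{v0..y0}. \<forall>y\<in>{v0..y0}. x < y \<longrightarrow> ?h x < ?h y"
    using v0(5) y0(1) by (metis less_asym)
  have inc: "?h x \<le> ?h x'" if "v0 \<le> x" "x \<le> x'" "x' \<le> y0" for x x'
  proof (cases "x = x'")
    case False
    then have "x < x'" "x \<in> {v0..y0}" "x' \<in> {v0..y0}" using that by auto
    then show ?thesis using sinc by (meson less_imp_le)
  qed simp
  have up: "x < ?h x" if x: "v0 < x" "x \<le> y0" for x
  proof (rule ccontr)
    assume n: "\<not> x < ?h x"
    have it: "(?h ^^ j) x \<in> {v0..x}" for j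
    proof (induction j)
      case (Suc j)
      then have "?h v0 \<le> ?h ((?h ^^ j) x)" "?h ((?h ^^ j) x) \<le> ?h x" using x by (auto intro!: inc)
      then show ?case using n v0(5) by simp
    qed (use x in auto)
    have xG: "x \<in> G" using v0(4) x y0 ygc by auto
    obtain t where t: "(\<lambda>j. (g ^^ (m * j)) x) \<longlonglongrightarrow> (g ^^ t) w" using G_limit[OF xG] .
    have "(g ^^ (m * j)) x \<in> {v0..x}" for j using it[of j] by (simp add: funpow_mult)
    then have lim: "(g ^^ t) w \<in> {v0..x}"
      using closed_sequentially[OF closed_atLeastAtMost, of "\<lambda>j. (g ^^ (m * j)) x" v0 x] t by blast
    moreover have "(g ^^ t) w \<noteq> v0" using w_orbit_G[of t] v0(3) by auto
    ultimately have "(g ^^ t) w \<in> Orb" using Orb by auto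
    then show False using o0(3) lim x y0 by fastforce
  qed
  have "?h ` {v0..y0} = {v0..?h y0}"
  proof
    show "?h ` {v0..y0} \<subseteq> {v0..?h y0}" using inc[of v0] inc[of _ y0] v0(5) by auto
    have "connected (?h ` {v0..y0})"
      by (intro connected_continuous_image continuous_on_subset[OF iter_cont S_in]) auto
    then show "{v0..?h y0} \<subseteq> ?h ` {v0..y0}"
      by (rule connected_contains_Icc) (use v0(5) y0(1) in \<open>auto intro: image_eqI[of _ _ v0]\<close>)
  qed
  then show thesis using that[of y0] y0 near up[of y0] by auto
qed

end

section \<open>Partition into states\<close>

text \<open>Pieces of a finite partition, unrelated to the predicate
  \<open>maximal_gap\<close>.\<close>

definition gaps :: "real set \<Rightarrow> real set set" where
  "gaps P = {{x..x'} | x x'. x \<in> P \<and> x' \<in> P \<and> x < x' \<and> {x<..<x'} \<inter> P = {}}"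

lemma finite_gaps: "finite P \<Longrightarrow> finite (gaps P)"
proof -
  assume "finite P"
  moreover have "gaps P \<subseteq> (\<lambda>(x, x'). {x..x'}) ` (P \<times> P)" unfolding gaps_def by auto
  ultimately show ?thesis by (meson finite_SigmaI finite_imageI finite_subset)
qed

lemma Icc_eq_Union_gaps:
  assumes P: "finite P" and uv: "u \<in> P" "v \<in> P" "u < v"
  shows "{u..v} = \<Union>{s \<in> gaps P. s \<subseteq> {u..v}}"
proof
  show "{u..v} \<subseteq> \<Union>{s \<in> gaps P. s \<subseteq> {u..v}}"
  proof
    fix t assume t: "t \<in> {u..v}"
    define x where "x = Max {p \<in> P. p \<le> t \<and> p < v}"
    define x' where "x' = Min {p \<in> P. x < p}"
    have A: "finite {p \<in> P. p \<le> t \<and> p < v}" "u \<in> {p \<in> P. p \<le> t \<and> p < v}" using P uv t by auto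
    then have "x \<in> {p \<in> P. p \<le> t \<and> p < v}" unfolding x_def by (intro Max_in) auto
    moreover have x_max: "p \<le> x" if "p \<in> P" "p \<le> t" "p < v" for p unfolding x_def using A that by (intro Max_ge) auto
    ultimately have x: "x \<in> P" "x \<le> t" "x < v" "u \<le> x" using A by auto
    have B: "finite {p \<in> P. x < p}" "v \<in> {p \<in> P. x < p}" using P uv x by auto
    then have "x' \<in> {p \<in> P. x < p}" unfolding x'_def by (intro Min_in) auto
    moreover have x'_min: "x' \<le> p" if "p \<in> P" "x < p" for p unfolding x'_def using B that by (intro Min_le) auto
    ultimately have x': "x' \<in> P" "x < x'" "x' \<le> v" using B by auto
    have "t \<le> x'" using x_max[of x'] x' t by (cases "x' < v") force+
    have "{x<..<x'} \<inter> P = {}" using x'_min by force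
    then have "{x..x'} \<in> gaps P" unfolding gaps_def using x x' by blast
    moreover have "{x..x'} \<subseteq> {u..v}" "t \<in> {x..x'}" using x x' \<open>t \<le> x'\<close> by auto
    ultimately show "t \<in> \<Union>{s \<in> gaps P. s \<subseteq> {u..v}}" by blast
  qed
qed auto

context attracted_unimodal
begin

lemma one_sided_segment_image:
  assumes "one_sided {p..q}" "p \<le> q"
  shows "g ` {p..q} = closed_segment (g p) (g q)"
proof
  have sub: "{p..q} \<subseteq> {a..b}" using one_sided_sub[OF assms(1)] .
  have c: "continuous_on {p..q} g" using continuous_on_subset[OF cont sub] .
  show "g ` {p..q} \<subseteq> closed_segment (g p) (g q)"
    using segment_image_subset_if_inj[OF c one_sided_inj[OF assms(1)], of p q] assms(2)
    by (simp add: closed_segment_eq_real_ivl)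
  have "connected (g ` {p..q})" using connected_continuous_image[OF c] by simp
  then have "convex (g ` {p..q})" using is_interval_connected_1 is_interval_convex_1 by blast
  then show "closed_segment (g p) (g q) \<subseteq> g ` {p..q}" using assms(2) by (intro closed_segment_subset) auto
qed

lemma one_sided_Icc: "a \<le> p \<Longrightarrow> q \<le> b \<Longrightarrow> c \<notin> {p..q} \<Longrightarrow> one_sided {p..q}"
  by (intro one_sided_if_avoids) auto

lemma iter_tendsto_a:
  assumes r: "r < c" and down: "\<And>x. a < x \<Longrightarrow> x < r \<Longrightarrow> g x < x" and u: "a < u" "u < r" and "0 < \<epsilon>"
  shows "\<exists>k. \<forall>j\<ge>k. \<forall>x\<in>{a..u}. \<bar>(g ^^ j) x - a\<bar> < \<epsilon>"
proof (rule iterates_tendsto_unique_fixpoint)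
  show "continuous_on {a..u} g" using continuous_on_subset[OF cont] u r cb by auto
  show mono: "g x \<le> g x'" if "a \<le> x" "x \<le> x'" "x' \<le> u" for x x'
    using mono_left[of x x'] that u r by (cases "x = x'") auto
  show "g ` {a..u} \<subseteq> {a..u}"
  proof clarify
    fix x assume x: "x \<in> {a..u}"
    then have "g x \<le> x" using down[of x] u ga by (cases "x = a") auto
    moreover have "a \<le> g x" using mono[of a x] x ga by auto
    ultimately show "g x \<in> {a..u}" using x by auto
  qed
  show "x = a" if "a \<le> x" "x \<le> u" "g x = x" for x using down[of x] that u by force
qed (use u assms in auto)

text \<open>If \<open>r\<close> is fixed, \<open>{g u..u}\<close> is what the image of
  \<open>{u..r}\<close> adds to \<open>{u..r}\<close>; it is listed so that this image is an exact
  union of states.\<close>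

lemma trap_family_at_a:
  assumes r: "r < c" and down: "\<And>x. a < x \<Longrightarrow> x < r \<Longrightarrow> g x < x" and u: "a < u" "u < r"
  shows "trap_family {{a..u}, {g u..u}}"
proof -
  have ub: "u \<le> b" using u r cb by simp
  have au: "a \<le> g u" "g u \<le> u" using mono_left[of a u] down[of u] u r ga by auto
  have "g x \<in> {a..u}" if x: "x \<in> {a..u}" for x
  proof -
    have "g x \<le> x" using down[of x] u ga x by (cases "x = a") auto
    moreover have "a \<le> g x" using mono_left[of a x] x u r ga by (cases "x = a") auto
    ultimately show ?thesis using x by auto
  qed
  then have maps: "g ` {a..u} \<subseteq> {a..u}" by blast
  have "shrinks {a..u}"
    unfolding shrinks_def
  proof (intro allI impI)
    fix \<epsilon> :: real assume "0 < \<epsilon>"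
    then have "0 < \<epsilon> / 2" by simp
    then obtain k where k: "\<And>j x. j \<ge> k \<Longrightarrow> x \<in> {a..u} \<Longrightarrow> \<bar>(g ^^ j) x - a\<bar> < \<epsilon> / 2"
      using iter_tendsto_a[OF r down u] by blast
    have "\<bar>(g ^^ j) x - (g ^^ j) x'\<bar> < \<epsilon>" if "j \<ge> k" "x \<in> {a..u}" "x' \<in> {a..u}" for j x x'
      using k[of j x] k[of j x'] that by linarith
    then show "\<exists>k. \<forall>j\<ge>k. \<forall>x\<in>{a..u}. \<forall>x'\<in>{a..u}. \<bar>(g ^^ j) x - (g ^^ j) x'\<bar> < \<epsilon>" by blast
  qed
  moreover have sub: "{g u..u} \<subseteq> {a..u}" using au by auto
  moreover have "g ` {g u..u} \<subseteq> {a..u}" using maps sub by blast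
  ultimately show ?thesis
    unfolding trap_family_def
    using shrinks_subset[of "{a..u}" "{g u..u}"] maps closed_interval_Icc[of a u] closed_interval_Icc[of "g u" u] u ub au by auto
qed

text \<open>Expansivity is the delicate point. An interval that never leaves the expanding states
  avoids \<open>G\<close>, is absorbed by \<open>{a..r}\<close> and must remain in
  \<open>{r0..r}\<close>, whereas all points of this basin except \<open>r\<close> tend to
  \<open>a\<close>.\<close>

theorem finite_automaton_factor:
  "\<exists>(T :: nat set) (A :: nat \<Rightarrow> nat set) (f :: nat \<Rightarrow> (nat \<Rightarrow> nat) \<Rightarrow> nat move).
     finite_automaton T A f \<and>
     is_factor_of {a..b} dist g (configs T A) (config_dist T) (automaton_map T f)"
proof -
  obtain r where r: "a \<le> r" "r < c" "g r = r" "{a..r} \<inter> G = {}" "\<And>x. a < x \<Longrightarrow> x < r \<Longrightarrow> g x < x"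
    "\<And>p q. p < q \<Longrightarrow> {p..q} \<subseteq> {a..b} - G \<Longrightarrow> \<exists>k. (g ^^ k) ` {p..q} \<subseteq> {a..r}"
    using gaps_absorbed by metis
  obtain v0 where v0: "a \<le> v0" "v0 < y" "v0 \<notin> G" "{v0<..g c} \<subseteq> G" "(g ^^ m) v0 = v0"
    "\<And>x. x \<in> {v0<..g c} \<Longrightarrow> (g ^^ m) x \<in> {v0<..g c}"
    using critical_value_component by metis
  \<comment> \<open>Expanding states reach a little into \<open>G\<close>, so their images need a
    bound above \<open>y\<close>; it stays below \<open>w\<close> to keep the criterion for avoiding
    \<open>G\<close>.\<close>
  define z where "z = (y + w) / 2"
  have z: "y < z" "z < w" using yw by (auto simp: z_def)
  obtain y0 where y0: "v0 < y0" "y0 < y" "\<And>i x. i < m \<Longrightarrow> x \<in> {v0..y0} \<Longrightarrow> (g ^^ i) x \<noteq> c \<and> g ((g ^^ i) x) \<le> z"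
    "y0 < (g ^^ m) y0" "(g ^^ m) ` {v0..y0} = {v0..(g ^^ m) y0}"
    using repelling_neighbourhood[OF v0(1-5) v0(6) z(1)] by metis
  have ygc: "y < g c" using yw wc by simp
  have ab: "a < b" using ac cb by simp
  have v0_in: "v0 \<in> {a..b}" using v0 ygc gc_in by auto
  have r_G: "r \<notin> G" using r(1,4) by (auto simp: disjoint_iff)
  have r_in: "r \<in> {a..b}" using r(1,2) cb by auto
  have rgc: "r \<le> y" using not_in_G_le[OF r_in r_G, of 1] r(3) by simp
  have ivtL: "\<exists>x. a \<le> x \<and> x \<le> c \<and> g x = v" if "a \<le> v" "v \<le> g c" for v
    using IVT'[of g a v c] that ga ac continuous_on_subset[OF cont, of "{a..c}"] cb by auto
  have ivtR: "\<exists>x. c \<le> x \<and> x \<le> b \<and> g x = v" if "a \<le> v" "v \<le> g c" for v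
    using IVT2'[of g b v c] that gb cb continuous_on_subset[OF cont, of "{c..b}"] ac by auto
  \<comment> \<open>The component of \<open>G\<close> around \<open>c\<close> is the preimage of
    \<open>{v0<..g c}\<close>, with ends \<open>pL\<close> and \<open>pR\<close>; the points
    \<open>xL\<close> and \<open>xR\<close> over \<open>y0\<close> cut off the strips at these
    ends.\<close>
  obtain pL where pL: "a \<le> pL" "pL \<le> c" "g pL = v0" using ivtL[of v0] v0 ygc by auto
  obtain xL where xL: "a \<le> xL" "xL \<le> c" "g xL = y0" using ivtL[of y0] v0 y0 ygc by auto
  obtain pR where pR: "c \<le> pR" "pR \<le> b" "g pR = v0" using ivtR[of v0] v0 ygc by auto
  obtain xR where xR: "c \<le> xR" "xR \<le> b" "g xR = y0" using ivtR[of y0] v0 y0 ygc by auto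
  obtain r' where r': "c \<le> r'" "r' \<le> b" "g r' = r" using ivtR[of r] r rgc ygc by auto
  have ord: "pL < xL" "xL < c" "c < xR" "xR < pR"
  proof -
    show "xL < c" "c < xR" using xL xR y0 ygc by (auto simp: le_less)
    show "pL < xL" using mono_left[of xL pL] xL pL y0 by (cases pL xL rule: linorder_cases) auto
    show "xR < pR" using mono_right[of pR xR] xR pR y0 by (cases pR xR rule: linorder_cases) auto
  qed
  have lt_L: "g x < v0" if "a \<le> x" "x < pL" for x using mono_left[of x pL] that pL by simp
  have gt_R: "g x < v0" if "pR < x" "x \<le> b" for x using mono_right[of pR x] that pR by simp
  have J_G: "x \<in> G" if x: "pL < x" "x < pR" for x
  proof -
    have x_in: "x \<in> {a..b}" using x pL pR by auto
    have "v0 < g x" using mono_left[of pL x] mono_right[of x pR] x pL pR by (cases "x \<le> c") auto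
    then have "g x \<in> G" using v0(4) le_gc[OF x_in] by auto
    then show ?thesis using G_step[OF x_in] by simp
  qed
  define J where "J = {pL..pR}"
  define B where "B = (\<lambda>i. (g ^^ i) ` {v0..y0})"
  have y0_in: "y0 \<in> {a..b}" using v0 y0 ygc gc_in by auto
  have B_ivl: "closed_interval (B i)" for i
    unfolding B_def by (intro closed_interval_image closed_interval_Icc) (use v0_in y0_in y0 in auto)
  have B_os: "one_sided (B i)" if "i < m" for i
  proof (rule one_sided_if_avoids)
    show "c \<notin> B i" unfolding B_def using y0(3)[OF that] by blast
  qed (use B_ivl[of i] in \<open>auto simp: closed_interval_def\<close>)
  \<comment> \<open>\<open>g\<close> maps \<open>P\<close> into itself. Its gaps are expanding states, except that the gap \<open>J\<close> around \<open>c\<close> and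
    the basin \<open>{a..r}\<close> are split into traps and expanding pieces next to their repelling ends; the
    \<open>B i\<close> follow such a piece of \<open>J\<close> until it returns.\<close>
  define P where "P = {a, b, r, r', pL, pR} \<union> (\<lambda>i. (g ^^ i) v0) ` {..<m}"
  have P_fin: "finite P" by (simp add: P_def)
  have v0_orb: "(g ^^ i) v0 \<in> P" for i
    using funpow_mod_eq[OF v0(5), of i] m unfolding P_def by (auto intro!: image_eqI[of _ _ "i mod m"])
  have P_in: "P \<subseteq> {a..b}" using r r' pL pR ab iter_in[OF v0_in] cb by (auto simp: P_def simp del: atLeastAtMost_iff) auto
  have P_G: "p \<notin> G" if "p \<in> P" for p
  proof -
    have "(g ^^ i) v0 \<notin> G" for i using G_iter[OF v0_in] v0(3) by simp
    moreover have "r' \<notin> G" using G_step[of r'] r' r_G ac by auto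
    moreover have "pL \<notin> G" "pR \<notin> G" using G_step[of pL] G_step[of pR] pL pR v0(3) ac cb by auto
    ultimately show ?thesis using that a_G b_G r_G unfolding P_def by auto
  qed
  have P_maps: "g p \<in> P" if p: "p \<in> P" for p
  proof -
    have in_P: "a \<in> P" "r \<in> P" "v0 \<in> P" using v0_orb[of 0] by (auto simp: P_def)
    have orb: "g ((g ^^ i) v0) \<in> P" for i using v0_orb[of "Suc i"] by simp
    consider "p = a" | "p = b" | "p = r" | "p = r'" | "p = pL" | "p = pR" | i where "p = (g ^^ i) v0"
      using p unfolding P_def by blast
    then show ?thesis by cases (use ga gb r(3) r'(3) pL(3) pR(3) in_P orb in simp_all)
  qed
  have desc: "(g ^^ j) v \<in> {a<..<r} \<and> (0 < j \<longrightarrow> (g ^^ j) v < v)" if "v \<in> {a<..<r}" for v j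
  proof (induction j)
    case (Suc j)
    have "a < (g ^^ j) v" "(g ^^ j) v < r" using Suc by auto
    then have "a < g ((g ^^ j) v)" "g ((g ^^ j) v) < (g ^^ j) v"
      using mono_left[of a "(g ^^ j) v"] ga r by auto
    then show ?case using Suc that by (cases "j = 0") auto
  qed (use that in auto)
  \<comment> \<open>Points inside the basin of \<open>a\<close> descend strictly, so the periodic
    orbit of \<open>v0\<close> cannot pass through it.\<close>
  have P_ar: "{a<..<r} \<inter> P = {}"
  proof -
    have per: "(g ^^ i) v0 \<notin> {a<..<r}" for i
    proof
      assume "(g ^^ i) v0 \<in> {a<..<r}"
      then have "(g ^^ m) ((g ^^ i) v0) < (g ^^ i) v0" using desc m by blast
      moreover have "(g ^^ m) ((g ^^ i) v0) = (g ^^ i) v0"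
        using v0(5) by (metis add.commute funpow_add o_apply)
      ultimately show False by simp
    qed
    have "pL \<notin> {a<..<r}" using per[of 0] desc[of pL 1] pL by auto
    then show ?thesis using per r' pR r ab cb ac unfolding P_def by auto
  qed
  have sub1: "{xL..xR} \<subseteq> G" using J_G ord by auto
  have "xL \<le> xR" using ord by simp
  then obtain TT1 F1 where F1: "trap_family TT1" "F1 \<subseteq> TT1" "{xL..xR} = \<Union>F1"
    using trap_family_covering[OF _ sub1] by metis
  have "(g ^^ m) y0 \<in> {v0<..g c}" using v0(6)[of y0] y0 ygc by auto
  then have sub2: "{y0..(g ^^ m) y0} \<subseteq> G" using v0(4) y0 by force
  obtain TT2 F2 where F2: "trap_family TT2" "F2 \<subseteq> TT2" "{y0..(g ^^ m) y0} = \<Union>F2"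
    using trap_family_covering[OF less_imp_le[OF y0(4)] sub2] by metis
  define r0 where "r0 = (a + r) / 2"
  define TT3 where "TT3 = (if a < r then {{a..r0}, {g r0..r0}} else {})"
  have r0: "a < r0" "r0 < r" if "a < r" using that by (auto simp: r0_def)
  have TT3: "trap_family TT3"
    unfolding TT3_def using trap_family_at_a[OF r(2,5), of r0] r0 by (auto simp: trap_family_def)
  define TT where "TT = TT1 \<union> TT2 \<union> TT3"
  have TT: "trap_family TT" unfolding TT_def by (intro trap_family_Un F1(1) F2(1) TT3)
  define E1 where "E1 = gaps P - {J, {a..r}}"
  define E2 where "E2 = B ` {..<m} \<union> {{pL..xL}, {xR..pR}}"
  define E3 where "E3 = (if a < r then {{r0..r}} else {})"
  define EE where "EE = E1 \<union> E2 \<union> E3"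
  \<comment> \<open>Exact unions of states are closed under union, so images can be assembled piece
    by piece.\<close>
  define rep where "rep = (\<lambda>X. \<exists>U\<subseteq>EE \<union> TT. X = \<Union>U)"
  have rep_base: "rep X" if "X \<in> EE \<union> TT" for X unfolding rep_def using that by (intro exI[of _ "{X}"]) auto
  have F_sub: "F1 \<subseteq> EE \<union> TT" "F2 \<subseteq> EE \<union> TT" using F1(2) F2(2) unfolding TT_def by blast+
  have rep_F: "rep {xL..xR}" "rep {y0..(g ^^ m) y0}"
    unfolding rep_def by (rule exI[of _ F1], rule conjI[OF F_sub(1) F1(3)])
      (rule exI[of _ F2], rule conjI[OF F_sub(2) F2(3)])
  have rep_Union: "rep (\<Union>\<X>)" if "\<And>X. X \<in> \<X> \<Longrightarrow> rep X" for \<X>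
  proof -
    have "\<forall>X\<in>\<X>. \<exists>U. U \<subseteq> EE \<union> TT \<and> X = \<Union>U" using that unfolding rep_def by simp
    then obtain U where U: "\<forall>X\<in>\<X>. U X \<subseteq> EE \<union> TT \<and> X = \<Union>(U X)" by (rule bchoice[THEN exE])
    have "\<Union>\<X> = (\<Union>X\<in>\<X>. \<Union>(U X))" using U by simp
    also have "\<dots> = \<Union>(\<Union>(U ` \<X>))" by blast
    finally have "\<Union>\<X> = \<Union>(\<Union>(U ` \<X>))" .
    moreover have "\<Union>(U ` \<X>) \<subseteq> EE \<union> TT" using U by (simp add: UN_least)
    ultimately show ?thesis unfolding rep_def by blast
  qed
  have rep_Un: "rep (X \<union> Y)" if "rep X" "rep Y" for X Y using rep_Union[of "{X, Y}"] that by auto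
  have rep_a: "rep {a..r0}" "rep {g r0..r0}" "rep {r0..r}" if "a < r"
    using that by (auto intro!: rep_base simp: TT_def TT3_def EE_def E3_def)
  have rep_B: "rep (B i)" if "i < m" for i
    using that by (intro rep_base) (simp add: EE_def E2_def)
  have rep_LR: "rep {pL..xL}" "rep {xR..pR}"
    by (rule rep_base, simp add: EE_def E2_def)+
  have rep_ar: "rep {a..r}" if "a < r"
  proof -
    have "{a..r} = {a..r0} \<union> {r0..r}" using r0 that by auto
    then show ?thesis using rep_Un[OF rep_a(1,3)[OF that]] by simp
  qed
  have rep_J: "rep J"
  proof -
    have "J = {pL..xL} \<union> {xL..xR} \<union> {xR..pR}" using ord by (auto simp: J_def)
    then show ?thesis using rep_Un[OF rep_Un[OF rep_LR(1) rep_F(1)] rep_LR(2)] by simp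
  qed
  have rep_gap: "rep s" if "s \<in> gaps P" for s
  proof -
    have "{a..r} \<in> gaps P \<Longrightarrow> a < r" by (auto simp: gaps_def)
    then show ?thesis using that rep_J rep_ar rep_base[of s] unfolding EE_def E1_def by blast
  qed
  have rep_P: "rep {u..v}" if "u \<in> P" "v \<in> P" "u < v" for u v
    using rep_Union[of "{s \<in> gaps P. s \<subseteq> {u..v}}"] rep_gap Icc_eq_Union_gaps[OF P_fin that] by auto
  \<comment> \<open>No point of \<open>P\<close> lies in \<open>G\<close>, hence none inside
    \<open>J\<close>; every other gap therefore avoids the interior of \<open>J\<close> and lies on
    one side of \<open>c\<close>.\<close>
  have gap_J: "x' \<le> pL \<or> pR \<le> x" if s: "{x..x'} \<noteq> J" "x \<in> P" "x' \<in> P" "x < x'" "{x<..<x'} \<inter> P = {}" for x x'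
  proof -
    have "pL \<in> P" "pR \<in> P" by (auto simp: P_def)
    then have "x' \<le> pL \<or> pL \<le> x" "x' \<le> pR \<or> pR \<le> x" using s(5) by force+
    moreover have "x \<le> pL \<or> pR \<le> x" "x' \<le> pL \<or> pR \<le> x'" using J_G P_G s(2,3) not_le by blast+
    ultimately show ?thesis using s(1,4) unfolding J_def by (smt (verit))
  qed
  have E1_dest: "\<exists>x x'. s = {x..x'} \<and> x \<in> P \<and> x' \<in> P \<and> x < x' \<and> {x<..<x'} \<inter> P = {} \<and> one_sided s \<and> (\<forall>t\<in>s. g t \<le> z) \<and> s \<noteq> {a..r}"
    if "s \<in> E1" for s
  proof -
    obtain x x' where s: "s = {x..x'}" "x \<in> P" "x' \<in> P" "x < x'" "{x<..<x'} \<inter> P = {}" "s \<noteq> J" "s \<noteq> {a..r}"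
      using \<open>s \<in> E1\<close> unfolding E1_def gaps_def by blast
    have J: "x' \<le> pL \<or> pR \<le> x" using gap_J s by blast
    have ab': "a \<le> x" "x' \<le> b" using s P_in by auto
    have os: "one_sided s" unfolding s(1) using J ord ab' by (intro one_sided_Icc) auto
    have "g t \<le> z" if "t \<in> s" for t
    proof -
      have "a \<le> t \<and> t \<le> pL \<or> pR \<le> t \<and> t \<le> b" using that J ab' s by auto
      then have "g t \<le> v0" using lt_L[of t] gt_R[of t] pL pR by (auto simp: le_less)
      then show ?thesis using v0(2) z(1) by simp
    qed
    then show ?thesis using s os by blast
  qed
  have os_L: "one_sided {pL..xL}" "one_sided {xR..pR}"
    using pL ord pR xL xR by (auto intro!: one_sided_Icc)
  have os_r: "one_sided {r0..r}" if "a < r"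
    using r0[OF that] r(2) cb by (intro one_sided_Icc) auto
  have r0_le: "a \<le> g r0" "g r0 < r0" if "a < r"
    using r0[OF that] mono_left[of a r0] r ga by auto
  have TT_D: "closed_interval s" "shrinks s" "\<exists>s'\<in>TT. g ` s \<subseteq> s'" if "s \<in> TT" for s
    using TT that unfolding trap_family_def by auto
  have EE_cases: "s \<in> E1 \<or> (\<exists>i<m. s = B i) \<or> s = {pL..xL} \<or> s = {xR..pR} \<or> a < r \<and> s = {r0..r}" if "s \<in> EE" for s
    using that by (auto simp: EE_def E2_def E3_def split: if_splits)
  have EE_os: "one_sided s" if "s \<in> EE" for s
    using EE_cases[OF that] E1_dest[of s] B_os os_L os_r by auto
  have EE_le: "g t \<le> z" if "s \<in> EE" "t \<in> s" for s t
    using EE_cases[OF that(1)]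
  proof (elim disjE exE conjE)
    assume "s \<in> E1"
    then show ?thesis using E1_dest that by blast
  next
    fix i assume "i < m" "s = B i"
    then show ?thesis using y0(3) that unfolding B_def by blast
  next
    assume "s = {pL..xL}"
    then have "g t \<le> g xL" using mono_left[of t xL] that pL xL by (auto simp: le_less)
    then show ?thesis using xL y0 z by simp
  next
    assume "s = {xR..pR}"
    then have "g t \<le> g xR" using mono_right[of xR t] that pR xR by (auto simp: le_less)
    then show ?thesis using xR y0 z by simp
  next
    assume "a < r" "s = {r0..r}"
    then have "g t \<le> g r" using mono_left[of t r] that r r0 by (auto simp: le_less)
    then show ?thesis using r rgc z by simp
  qed
  show ?thesis
  proof (rule finite_automaton_factor_if_cover[of a b g EE TT])
    show "a \<le> b" using ab by simp
    show "continuous_on {a..b} g" "g ` {a..b} \<subseteq> {a..b}" by (rule cont maps)+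
    show "finite EE" using finite_gaps[OF P_fin] by (auto simp: EE_def E1_def E2_def E3_def)
    show "finite TT" using TT by (simp add: trap_family_def)
    show "compact s \<and> connected s \<and> s \<noteq> {} \<and> s \<subseteq> {a..b}" if s: "s \<in> EE \<union> TT" for s
    proof -
      have "closed_interval s"
      proof (cases "s \<in> TT")
        case False
        then have "s \<in> EE" using s by blast
        from EE_cases[OF this] show ?thesis
        proof (elim disjE exE conjE)
          assume "s \<in> E1"
          then obtain x x' where "s = {x..x'}" "x \<in> P" "x' \<in> P" "x < x'" using E1_dest by blast
          then have "x \<in> {a..b}" "x' \<in> {a..b}" using P_in by blast+
          then show ?thesis using closed_interval_Icc[of x x'] \<open>s = {x..x'}\<close> \<open>x < x'\<close> by auto
        next
          assume "s = {pL..xL}"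
          then show ?thesis using pL xL ord cb by (auto intro!: closed_interval_Icc)
        next
          assume "s = {xR..pR}"
          then show ?thesis using pR xR ord ac by (auto intro!: closed_interval_Icc)
        next
          assume "a < r" "s = {r0..r}"
          then show ?thesis using r0 r cb by (auto intro!: closed_interval_Icc)
        qed (use B_ivl in auto)
      qed (use TT_D in auto)
      then show ?thesis by (simp add: closed_interval_def)
    qed
    have "rep {a..b}" using rep_P[of a b] ab by (auto simp: P_def)
    then show "{a..b} \<subseteq> \<Union>(EE \<union> TT)" unfolding rep_def by blast
    show "inj_on g s" if "s \<in> EE" for s using one_sided_inj[OF EE_os[OF that]] .
    show "\<exists>s'\<in>TT. g ` s \<subseteq> s'" if "s \<in> TT" for s using TT_D(3)[OF that] .
    show "\<exists>k. \<forall>j\<ge>k. \<forall>x\<in>s. \<forall>y\<in>s. \<bar>(g ^^ j) x - (g ^^ j) y\<bar> < \<epsilon>" if "s \<in> TT" "0 < \<epsilon>" for s \<epsilon>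
      using TT_D(2)[OF that(1)] that(2) unfolding shrinks_def by blast
    show "\<exists>U\<subseteq>EE \<union> TT. g ` s = \<Union>U" if s: "s \<in> EE" for s
    proof -
      have B0: "B 0 = {v0..y0}" "rep (B 0)" using rep_B[OF m] by (simp_all add: B_def)
      have "rep (g ` s)"
        using EE_cases[OF s]
      proof (elim disjE exE conjE)
        assume "s \<in> E1"
        then obtain x x' where x: "s = {x..x'}" "x \<in> P" "x' \<in> P" "x < x'" using E1_dest by blast
        have os: "one_sided {x..x'}" using EE_os[OF s] x by simp
        have "g x \<noteq> g x'" using one_sided_inj[OF os] x(4) by (auto dest: inj_onD)
        then have "rep (closed_segment (g x) (g x'))"
          using rep_P[of "g x" "g x'"] rep_P[of "g x'" "g x"] P_maps x(2,3)
          by (auto simp: closed_segment_eq_real_ivl)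
        then show ?thesis using one_sided_segment_image[OF os] x by simp
      next
        fix i assume i: "i < m" "s = B i"
        then have gs: "g ` s = B (Suc i)" by (simp add: B_def image_comp)
        show ?thesis
        proof (cases "Suc i < m")
          case True
          then show ?thesis unfolding gs by (rule rep_B)
        next
          case False
          \<comment> \<open>The strip has returned: its image covers it again, and the remainder
            lies in \<open>G\<close>, where traps cover it.\<close>
          then have "Suc i = m" using i by simp
          then have "g ` s = {v0..y0} \<union> {y0..(g ^^ m) y0}" using gs y0 by (auto simp: B_def)
          then show ?thesis using rep_Un[OF B0(2) rep_F(2)] B0(1) by simp
        qed
      next
        assume "s = {pL..xL}"
        then have "g ` s = B 0" using one_sided_segment_image[OF os_L(1)] ord pL xL y0 B0
          by (simp add: closed_segment_eq_real_ivl)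
        then show ?thesis using B0 by simp
      next
        assume "s = {xR..pR}"
        then have "g ` s = B 0" using one_sided_segment_image[OF os_L(2)] ord pR xR y0 B0
          by (simp add: closed_segment_eq_real_ivl)
        then show ?thesis using B0 by simp
      next
        assume ar: "a < r" and "s = {r0..r}"
        then have "g ` s = {g r0..r0} \<union> {r0..r}"
          using one_sided_segment_image[OF os_r[OF ar]] r0[OF ar] r0_le[OF ar] r
          by (auto simp: closed_segment_eq_real_ivl)
        then show ?thesis using rep_Un[OF rep_a(2,3)[OF ar]] by simp
      qed
      then show ?thesis unfolding rep_def .
    qed
    show "\<exists>k. \<forall>s\<in>EE. \<not> (g ^^ k) ` {x..x'} \<subseteq> s" if xx': "x < x'" for x x'
    proof (rule ccontr)
      assume "\<not> ?thesis"
      then have cyl: "\<exists>s\<in>EE. (g ^^ k) ` {x..x'} \<subseteq> s" for k by blast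
      have "\<exists>s\<in>EE. {x..x'} \<subseteq> s" using cyl[of 0] by simp
      then have x_in: "{x..x'} \<subseteq> {a..b}" using EE_os one_sided_sub by blast
      \<comment> \<open>The images of all expanding states lie below \<open>z\<close>, and
        \<open>z < w\<close>.\<close>
      have "t \<notin> G" if t: "t \<in> {x..x'}" for t
      proof (rule not_in_G_if_bounded[OF z(2)])
        fix k :: nat assume "0 < k"
        then obtain j where "k = Suc j" by (cases k) auto
        moreover obtain s where "s \<in> EE" "(g ^^ j) t \<in> s" using cyl[of j] t by blast
        ultimately show "(g ^^ k) t \<le> z" using EE_le[of s "(g ^^ j) t"] by simp
      qed
      then have x_G: "{x..x'} \<subseteq> {a..b} - G" using x_in by blast
      obtain k where k: "(g ^^ k) ` {x..x'} \<subseteq> {a..r}" using r(6)[OF xx' x_G] by blast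
      have ar_maps: "g t \<in> {a..r}" if "t \<in> {a..r}" for t
        using mono_left[of a t] mono_left[of t r] that ga r(2,3) by (auto simp: le_less)
      have img: "(g ^^ (j + k)) t \<in> {a..r}" if "t \<in> {x..x'}" for j t
        by (induction j) (use k that ar_maps in \<open>auto simp del: atLeastAtMost_iff\<close>)
      have ends: "x \<in> {x..x'}" "x' \<in> {x..x'}" using xx' by auto
      have "one_sided ((g ^^ i) ` {x..x'})" for i by (rule compl_one_sided[OF _ x_G]) simp
      then have distinct: "(g ^^ i) x \<noteq> (g ^^ i) x'" for i
        using iter_monotone[of i "{x..x'}"] ends xx' by (metis less_irrefl)
      have ar: "a < r" using distinct[of k] img[of x 0] img[of x' 0] ends by auto
      \<comment> \<open>Outside \<open>G\<close> each \<open>B i\<close> and each end piece of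
        \<open>J\<close> has only one point. A gap of \<open>P\<close> with two points of
        \<open>{a..r}\<close> would be \<open>{a..r}\<close> itself, which is not an expanding
        state.\<close>
      have only_E3: "s = {r0..r}" if s: "s \<in> EE" "{p, q} \<subseteq> s" and pq: "{p, q} \<subseteq> {a..r}" "p < q" for s p q
      proof -
        have pq_G: "p \<notin> G" "q \<notin> G" using pq(1) r(4) by blast+
        show ?thesis
          using EE_cases[OF s(1)]
        proof (elim disjE exE conjE)
          assume "s \<in> E1"
          then obtain x1 x2 where e: "s = {x1..x2}" "x1 \<in> P" "x2 \<in> P" "{x1<..<x2} \<inter> P = {}" "s \<noteq> {a..r}"
            using E1_dest by blast
          have b: "x1 \<le> p" "q \<le> x2" "a \<le> p" "q \<le> r" using s(2) pq(1) e(1) by auto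
          have "x1 \<notin> {a<..<r}" "x2 \<notin> {a<..<r}" using P_ar e by auto
          then have "x1 = a" "r \<le> x2" using b pq(2) P_in e(2) by auto
          moreover have "r \<notin> {x1<..<x2}" using e(4) by (auto simp: P_def)
          ultimately have "x2 = r" using ar by auto
          then show ?thesis using e \<open>x1 = a\<close> by simp
        next
          fix i assume i: "i < m" "s = B i"
          have "t = (g ^^ i) v0" if "t \<in> B i" "t \<notin> G" for t
          proof -
            obtain t' where t': "t' \<in> {v0..y0}" "t = (g ^^ i) t'" using \<open>t \<in> B i\<close> by (auto simp: B_def)
            then have t'_in: "t' \<in> {a..b}" using v0_in y0_in by auto
            have "t' \<notin> G" using G_iter[OF t'_in, of i] t' \<open>t \<notin> G\<close> by simp
            then have "t' \<notin> {v0<..g c}" using v0(4) by blast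
            then have "t' = v0" using t'(1) y0(2) ygc by simp
            then show ?thesis using t' by simp
          qed
          then have "p = q" using s(2) i pq_G by blast
          then show ?thesis using pq by simp
        next
          assume "s = {pL..xL}"
          then have "p = pL" "q = pL" using s(2) J_G[of p] J_G[of q] pq_G ord by force+
          then show ?thesis using pq by simp
        next
          assume "s = {xR..pR}"
          then have "p = pR" "q = pR" using s(2) J_G[of p] J_G[of q] pq_G ord by force+
          then show ?thesis using pq by simp
        qed
      qed
      have above: "r0 \<le> (g ^^ (j + k)) x \<and> r0 \<le> (g ^^ (j + k)) x'" for j
      proof -
        obtain s where s: "s \<in> EE" "(g ^^ (j + k)) ` {x..x'} \<subseteq> s" using cyl by blast
        then have in_s: "(g ^^ (j + k)) x \<in> s" "(g ^^ (j + k)) x' \<in> s" using ends by blast+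
        have "s = {r0..r}"
          using only_E3[of s "(g ^^ (j + k)) x" "(g ^^ (j + k)) x'"] only_E3[of s "(g ^^ (j + k)) x'" "(g ^^ (j + k)) x"]
            s(1) in_s img[OF ends(1), of j] img[OF ends(2), of j] distinct[of "j + k"]
          by (meson empty_subsetI insert_subset linorder_neqE_linordered_idom)
        then show ?thesis using in_s by simp
      qed
      \<comment> \<open>The smaller of the two points is below \<open>r\<close>, hence tends to
        \<open>a\<close> and passes \<open>r0\<close>.\<close>
      define t where "t = min ((g ^^ k) x) ((g ^^ k) x')"
      have t_above: "r0 \<le> (g ^^ j) t" for j
        using above[of j] by (simp add: t_def min_def funpow_add)
      have "t < r" using distinct[of k] img[OF ends(1), of 0] img[OF ends(2), of 0] by (auto simp: t_def min_def)
      moreover have "a < t" using t_above[of 0] r0[OF ar] by simp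
      moreover have "0 < r0 - a" using r0[OF ar] by simp
      ultimately obtain j where "\<bar>(g ^^ j) t - a\<bar> < r0 - a"
        using iter_tendsto_a[OF r(2,5), of t "r0 - a"] by fastforce
      then show False using t_above[of j] by linarith
    qed
  qed
qed

end

section \<open>The theorem\<close>

text \<open>Strict monotonicity and the nonvanishing of \<open>g1\<close> off \<open>c\<close> fix
  its sign on either side. To the right of \<open>c\<close> the increasing case applies to
  \<open>- g\<close>, which has the same Schwarzian and the same cross-ratios.\<close>

lemma S_unimodal_expanding:
  assumes "S_unimodal a b c g"
  obtains g1 g2 where "expanding_unimodal a b c g g1 g2"
proof -
  obtain g1 g2 g3 where uni: "unimodal a b c g"
    and d1: "\<And>x. x \<in> {a..b} \<Longrightarrow> (g has_real_derivative g1 x) (at x within {a..b})"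
    and d2: "\<And>x. x \<in> {a..b} \<Longrightarrow> (g1 has_real_derivative g2 x) (at x within {a..b})"
    and d3: "\<And>x. x \<in> {a..b} \<Longrightarrow> (g2 has_real_derivative g3 x) (at x within {a..b})"
    and S: "\<And>x. x \<in> {a..b} \<Longrightarrow> x \<noteq> c \<Longrightarrow> schwarzian g1 g2 g3 x < 0"
    using assms unfolding S_unimodal_def by blast
  have acb: "a < c" "c < b" and cont: "continuous_on {a..b} g"
    using uni by (auto simp: unimodal_def)
  have inc: "g x < g y" if "a \<le> x" "x < y" "y \<le> c" for x y
    using uni that unfolding unimodal_def by (auto intro: strict_mono_onD)
  have dec: "g y < g x" if "c \<le> x" "x < y" "y \<le> b" for x y
    using uni that unfolding unimodal_def by (auto simp: monotone_on_def)
  have nz: "g1 x \<noteq> 0" if "x \<in> {a..b}" "x \<noteq> c" for x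
    using S[OF that] by (auto simp: schwarzian_def)
  have at: "at x within {a..b} = at x" if "a < x" "x < b" for x
    using that by (rule at_within_Icc_at)
  have pos: "0 < g1 x" if x: "a < x" "x < c" for x
  proof (rule ccontr)
    assume "\<not> 0 < g1 x"
    then have "g1 x < 0" using nz[of x] x acb by (simp add: less_le)
    moreover have "(g has_real_derivative g1 x) (at x)" using d1[of x] at[of x] x acb by simp
    ultimately obtain \<delta> where \<delta>: "0 < \<delta>" "\<And>h. 0 < h \<Longrightarrow> h < \<delta> \<Longrightarrow> g (x + h) < g x"
      using DERIV_neg_dec_right by blast
    define h where "h = min (\<delta> / 2) (c - x)"
    have "0 < h" "h < \<delta>" "x + h \<le> c" using \<delta>(1) x by (auto simp: h_def)
    then show False using \<delta>(2)[of h] inc[of x "x + h"] x by simp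
  qed
  have neg: "g1 x < 0" if x: "c < x" "x < b" for x
  proof (rule ccontr)
    assume "\<not> g1 x < 0"
    then have "0 < g1 x" using nz[of x] x acb by (simp add: less_le)
    moreover have "(g has_real_derivative g1 x) (at x)" using d1[of x] at[of x] x acb by simp
    ultimately obtain \<delta> where \<delta>: "0 < \<delta>" "\<And>h. 0 < h \<Longrightarrow> h < \<delta> \<Longrightarrow> g x < g (x + h)"
      using DERIV_pos_inc_right by blast
    define h where "h = min (\<delta> / 2) (b - x)"
    have "0 < h" "h < \<delta>" "x + h \<le> b" using \<delta>(1) x by (auto simp: h_def)
    then show False using \<delta>(2)[of h] dec[of x "x + h"] x by simp
  qed
  have "expanding_unimodal a b c g g1 g2"
  proof
    show "unimodal a b c g" by (rule uni)
    show "continuous_on {a..b} g2" using d3 by (intro DERIV_continuous_on) auto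
    fix x0 x1 x2 x3
    assume ord: "x0 < x1" "x1 < x2" "x2 < x3" and "{x0..x3} \<subseteq> {a..c} \<or> {x0..x3} \<subseteq> {c..b}"
    then have "a \<le> x0 \<and> x3 \<le> c \<or> c \<le> x0 \<and> x3 \<le> b" by auto
    then show "cross_ratio x0 x1 x2 x3 < cross_ratio (g x0) (g x1) (g x2) (g x3)"
    proof (elim disjE conjE)
      assume s: "a \<le> x0" "x3 \<le> c"
      then have in_ab: "x \<in> {a..b}" "a < x" "x < b" "x < c" if "x0 < x" "x < x3" for x using that acb by auto
      show ?thesis
      proof (rule cross_ratio_less_increasing[OF ord, where ?g1.0 = g1 and ?g2.0 = g2 and ?g3.0 = g3])
        show "continuous_on {x0..x3} g" using continuous_on_subset[OF cont] s acb by auto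
        fix x assume x: "x0 < x" "x < x3"
        note in_ab = in_ab[OF x]
        show "(g has_real_derivative g1 x) (at x)" "(g1 has_real_derivative g2 x) (at x)"
          "(g2 has_real_derivative g3 x) (at x)"
          using d1[OF in_ab(1)] d2[OF in_ab(1)] d3[OF in_ab(1)] unfolding at[OF in_ab(2,3)] by auto
        show "0 < g1 x" "schwarzian g1 g2 g3 x < 0" using pos S in_ab by auto
      qed
    next
      assume s: "c \<le> x0" "x3 \<le> b"
      then have in_ab: "x \<in> {a..b}" "a < x" "x < b" "c < x" if "x0 < x" "x < x3" for x using that acb by auto
      have "cross_ratio x0 x1 x2 x3 < cross_ratio (- g x0) (- g x1) (- g x2) (- g x3)"
      proof (rule cross_ratio_less_increasing[OF ord, where g = "\<lambda>x. - g x" and ?g1.0 = "\<lambda>x. - g1 x" and ?g2.0 = "\<lambda>x. - g2 x" and ?g3.0 = "\<lambda>x. - g3 x"])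
        show "continuous_on {x0..x3} (\<lambda>x. - g x)"
          using continuous_on_subset[OF cont, of "{x0..x3}"] s acb by (intro continuous_intros) auto
        fix x assume x: "x0 < x" "x < x3"
        note in_ab = in_ab[OF x]
        show "((\<lambda>x. - g x) has_real_derivative - g1 x) (at x)" "((\<lambda>x. - g1 x) has_real_derivative - g2 x) (at x)"
          "((\<lambda>x. - g2 x) has_real_derivative - g3 x) (at x)"
          using d1[OF in_ab(1)] d2[OF in_ab(1)] d3[OF in_ab(1)] unfolding at[OF in_ab(2,3)]
          by (auto intro: DERIV_minus)
        show "0 < - g1 x" using neg in_ab by auto
        show "schwarzian (\<lambda>x. - g1 x) (\<lambda>x. - g2 x) (\<lambda>x. - g3 x) x < 0"
          using S in_ab by (auto simp: schwarzian_def)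
      qed
      also have "\<dots> = cross_ratio (g x0) (g x1) (g x2) (g x3)"
        unfolding cross_ratio_def by (simp add: abs_minus_commute)
      finally show ?thesis .
    qed
  qed (use d1 d2 nz in auto)
  then show thesis by (rule that)
qed

theorem theorem9:
  fixes a b c :: real and g :: "real \<Rightarrow> real"
  assumes "S_unimodal a b c g"
    and "periodic (kneading g c)"
    and "odd_periodic (kneading g c)"
  shows "\<exists>(T :: nat set) (A :: nat \<Rightarrow> nat set) (f :: nat \<Rightarrow> (nat \<Rightarrow> nat) \<Rightarrow> nat move).
           finite_automaton T A f \<and>
           is_factor_of {a..b} dist g (configs T A) (config_dist T) (automaton_map T f)"
proof -
  obtain g1 g2 where "expanding_unimodal a b c g g1 g2"
    using S_unimodal_expanding[OF assms(1)] .
  then interpret expanding_unimodal a b c g g1 g2 .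
  show ?thesis
  proof (rule attracting_trap[OF assms(3)])
    fix m y w
    assume "0 < m" "a \<le> y" "y < w" "w \<le> g c" "(g ^^ m) w = w" "(g ^^ m) ` {y..g c} \<subseteq> {y..g c}"
      and "\<And>\<epsilon>. 0 < \<epsilon> \<Longrightarrow> \<exists>K. \<forall>k\<ge>K. \<forall>x\<in>{y..g c}. \<bar>(g ^^ (m * k)) x - w\<bar> < \<epsilon>"
    then interpret attracted_unimodal a b c g g1 g2 m y w
      by unfold_locales
    show ?thesis by (rule finite_automaton_factor)
  qed
qed

end
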